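(* Let $A$ and $B$ be $C^*$-algebras. As functors on $\mathrm{PosCor}(A,B)$, $\mathrm{KSGNS}^2=\mathrm{KSGNS}\circ\mathrm{KSGNS}$ is naturally isomorphic to $\mathrm{KSGNS}$.
   Context: Hilbert modules are right modules with inner product linear in the second variable; $\mathcal{L}(E_1,E_2)$ is the set of adjointable maps and $\mathcal{L}(E)=\mathcal{L}(E,E)$. A completely positive map $\phi:A\to\mathcal{L}(E)$ is strict if there is an approximate unit $(a_\lambda)$ of $A$ such that $(\phi(a_\lambda))$ is Cauchy in the strict topology on $\mathcal{L}(E)$, i.e. the topology generated by the seminorms $T\mapsto\|Tx\|$ and $T\mapsto\|T^*x\|$, $x\in E$. The category $\mathrm{PosCor}(A,B)$: objects are pairs $(E,\phi)$ with $E$ a Hilbert $B$-module and $\phi:A\to\mathcal{L}(E)$ a strict completely positive map; a morphism $(E_1,\phi_1)\to(E_2,\phi_2)$ is a pair $(\eta,\alpha)$ with $\eta\in\mathcal{L}(E_1,E_2)$ and $\alpha$ a $*$-automorphism of $A$ such that $\phi_2(\alpha(a))\circ\eta=\eta\circ\phi_1(a)$ for all $a\in A$; composition is $(\xi,\beta)\circ(\eta,\alpha)=(\xi\circ\eta,\beta\circ\alpha)$. KSGNS construction: for $(E,\phi)\in\mathrm{PosCor}(A,B)$, $F_\phi=A\otimes_\phi E$ is the Hilbert $B$-module obtained from $A\otimes_{\mathrm{alg}}E$ with the semi-inner product $\langle a_1\otimes x_1,a_2\otimes x_2\rangle_\phi=\langle x_1,\phi(a_1^*a_2)x_2\rangle_E$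 by quotienting by the null submodule $\{z:\langle z,z\rangle_\phi=0\}$ and completing; $a\dot\otimes x$ is the class of $a\otimes x$. The map $\pi_\phi:A\to\mathcal{L}(F_\phi)$ is the non-degenerate $*$-homomorphism with $\pi_\phi(a')(a\dot\otimes x)=a'a\dot\otimes x$. The endofunctor $\mathrm{KSGNS}$ of $\mathrm{PosCor}(A,B)$ sends $(E,\phi)$ to $(F_\phi,\pi_\phi)$ and a morphism $(\eta,\alpha):(E_1,\phi_1)\to(E_2,\phi_2)$ to $(\tilde\eta,\alpha)$, where $\tilde\eta\in\mathcal{L}(F_{\phi_1},F_{\phi_2})$ is determined by $\tilde\eta(a\dot\otimes x)=\alpha(a)\dot\otimes\eta(x)$. *)

theory Defs
  imports "HOL-Analysis.Analysis" "HOL-Library.Multiset" "HOL-Library.FuncSet"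
begin

section \<open>C*-algebras\<close>

class scaleC =
  fixes scaleC :: "complex \<Rightarrow> 'a \<Rightarrow> 'a"  (infixr "*\<^sub>C" 75)

class star =
  fixes star :: "'a \<Rightarrow> 'a"

text \<open>C*-algebras are not assumed to be unital or nonzero.\<close>

class cstar_algebra = real_normed_algebra + banach + scaleC + star +
  assumes scaleR_scaleC: "r *\<^sub>R a = complex_of_real r *\<^sub>C a"
    and scaleC_add_right: "c *\<^sub>C (a + b) = c *\<^sub>C a + c *\<^sub>C b"
    and scaleC_add_left: "(c + d) *\<^sub>C a = c *\<^sub>C a + d *\<^sub>C a"
    and scaleC_scaleC: "c *\<^sub>C (d *\<^sub>C a) = (c * d) *\<^sub>C a"
    and scaleC_one: "1 *\<^sub>C a = a"
    and mult_scaleC_left: "(c *\<^sub>C a) * b = c *\<^sub>C (a * b)"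
    and mult_scaleC_right: "a * (c *\<^sub>C b) = c *\<^sub>C (a * b)"
    and norm_scaleC: "norm (c *\<^sub>C a) = cmod c * norm a"
    and star_star: "star (star a) = a"
    and star_add: "star (a + b) = star a + star b"
    and star_scaleC: "star (c *\<^sub>C a) = cnj c *\<^sub>C star a"
    and star_mult: "star (a * b) = star b * star a"
    and cstar_identity: "norm (star a * a) = (norm a)\<^sup>2"

definition cs_positive :: "'a::cstar_algebra \<Rightarrow> bool" where
  "cs_positive a \<longleftrightarrow> (\<exists>b. a = star b * b)"

text \<open>An approximate unit is an increasing net of positive elements of the closed unit ball that
  is a two-sided approximate identity.  Nets are represented by their tail filters: a net is
  increasing for a suitable choice of index set with the given tail filter if and only if
  eventually each of its terms is eventually dominated.\<close>

definition approximate_unit :: "'a::cstar_algebra filter \<Rightarrow> bool" where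
  "approximate_unit U \<longleftrightarrow>
     U \<noteq> bot \<and>
     (\<forall>\<^sub>F u in U. cs_positive u \<and> norm u \<le> 1 \<and> (\<forall>\<^sub>F v in U. cs_positive (v - u))) \<and>
     (\<forall>a. ((\<lambda>u. u * a) \<longlongrightarrow> a) U \<and> ((\<lambda>u. a * u) \<longlongrightarrow> a) U)"

definition star_automorphism :: "('a::cstar_algebra \<Rightarrow> 'a) \<Rightarrow> bool" where
  "star_automorphism \<alpha> \<longleftrightarrow>
     bij \<alpha> \<and>
     (\<forall>a b. \<alpha> (a + b) = \<alpha> a + \<alpha> b) \<and>
     (\<forall>c a. \<alpha> (c *\<^sub>C a) = c *\<^sub>C \<alpha> a) \<and>
     (\<forall>a b. \<alpha> (a * b) = \<alpha> a * \<alpha> b) \<and>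
     (\<forall>a. \<alpha> (star a) = star (\<alpha> a))"

text \<open>Positivity in the C*-algebra $M_n(A)$, i.e. $M = C^*C$ for some $C \in M_n(A)$.
  Only the entries with indices below \<open>n\<close> are relevant.\<close>

definition matrix_positive :: "nat \<Rightarrow> (nat \<Rightarrow> nat \<Rightarrow> 'a::cstar_algebra) \<Rightarrow> bool" where
  "matrix_positive n M \<longleftrightarrow>
     (\<exists>C. \<forall>i<n. \<forall>j<n. M i j = (\<Sum>k<n. star (C k i) * C k j))"


section \<open>Hilbert modules\<close>

record ('b, 'e) rmod =
  mcar :: "'e set"
  mzero :: 'e
  madd :: "'e \<Rightarrow> 'e \<Rightarrow> 'e"
  mscale :: "complex \<Rightarrow> 'e \<Rightarrow> 'e"
  mact :: "'e \<Rightarrow> 'b \<Rightarrow> 'e"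
  mip :: "'e \<Rightarrow> 'e \<Rightarrow> 'b"

definition mdiff :: "('b, 'e) rmod \<Rightarrow> 'e \<Rightarrow> 'e \<Rightarrow> 'e" where
  "mdiff E x y = madd E x (mscale E (-1) y)"

definition mnorm :: "('b::cstar_algebra, 'e) rmod \<Rightarrow> 'e \<Rightarrow> real" where
  "mnorm E x = sqrt (norm (mip E x x))"

primrec msum :: "('b, 'e) rmod \<Rightarrow> (nat \<Rightarrow> 'e) \<Rightarrow> nat \<Rightarrow> 'e" where
  "msum E f 0 = mzero E"
| "msum E f (Suc n) = madd E (msum E f n) (f n)"

definition mcauchy :: "('b::cstar_algebra, 'e) rmod \<Rightarrow> (nat \<Rightarrow> 'e) \<Rightarrow> bool" where
  "mcauchy E s \<longleftrightarrow>
     (\<forall>n. s n \<in> mcar E) \<and>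
     (\<forall>\<epsilon>>0. \<exists>N. \<forall>m\<ge>N. \<forall>n\<ge>N. mnorm E (mdiff E (s m) (s n)) < \<epsilon>)"

locale hilbert_module =
  fixes E :: "('b::cstar_algebra, 'e) rmod"
  assumes zero_closed: "mzero E \<in> mcar E"
    and add_closed: "\<lbrakk>x \<in> mcar E; y \<in> mcar E\<rbrakk> \<Longrightarrow> madd E x y \<in> mcar E"
    and scale_closed: "x \<in> mcar E \<Longrightarrow> mscale E c x \<in> mcar E"
    and act_closed: "x \<in> mcar E \<Longrightarrow> mact E x b \<in> mcar E"
    and add_assoc: "\<lbrakk>x \<in> mcar E; y \<in> mcar E; z \<in> mcar E\<rbrakk>
      \<Longrightarrow> madd E (madd E x y) z = madd E x (madd E y z)"
    and add_commute: "\<lbrakk>x \<in> mcar E; y \<in> mcar E\<rbrakk> \<Longrightarrow> madd E x y = madd E y x"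
    and add_zero: "x \<in> mcar E \<Longrightarrow> madd E x (mzero E) = x"
    and add_neg: "x \<in> mcar E \<Longrightarrow> madd E x (mscale E (-1) x) = mzero E"
    and scale_add_right: "\<lbrakk>x \<in> mcar E; y \<in> mcar E\<rbrakk>
      \<Longrightarrow> mscale E c (madd E x y) = madd E (mscale E c x) (mscale E c y)"
    and scale_add_left: "x \<in> mcar E
      \<Longrightarrow> mscale E (c + d) x = madd E (mscale E c x) (mscale E d x)"
    and scale_scale: "x \<in> mcar E \<Longrightarrow> mscale E c (mscale E d x) = mscale E (c * d) x"
    and scale_one: "x \<in> mcar E \<Longrightarrow> mscale E 1 x = x"
    and act_add_left: "\<lbrakk>x \<in> mcar E; y \<in> mcar E\<rbrakk>
      \<Longrightarrow> mact E (madd E x y) b = madd E (mact E x b) (mact E y b)"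
    and act_add_right: "x \<in> mcar E \<Longrightarrow> mact E x (a + b) = madd E (mact E x a) (mact E x b)"
    and act_mult: "x \<in> mcar E \<Longrightarrow> mact E x (a * b) = mact E (mact E x a) b"
    and act_scale_left: "x \<in> mcar E \<Longrightarrow> mact E (mscale E c x) b = mscale E c (mact E x b)"
    and act_scale_right: "x \<in> mcar E \<Longrightarrow> mact E x (c *\<^sub>C b) = mscale E c (mact E x b)"
    and ip_add: "\<lbrakk>x \<in> mcar E; y \<in> mcar E; z \<in> mcar E\<rbrakk>
      \<Longrightarrow> mip E x (madd E y z) = mip E x y + mip E x z"
    and ip_scale: "\<lbrakk>x \<in> mcar E; y \<in> mcar E\<rbrakk> \<Longrightarrow> mip E x (mscale E c y) = c *\<^sub>C mip E x y"
    and ip_act: "\<lbrakk>x \<in> mcar E; y \<in> mcar E\<rbrakk> \<Longrightarrow> mip E x (mact E y b) = mip E x y * b"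
    and ip_star: "\<lbrakk>x \<in> mcar E; y \<in> mcar E\<rbrakk> \<Longrightarrow> star (mip E x y) = mip E y x"
    and ip_positive: "x \<in> mcar E \<Longrightarrow> cs_positive (mip E x x)"
    and ip_definite: "\<lbrakk>x \<in> mcar E; mip E x x = 0\<rbrakk> \<Longrightarrow> x = mzero E"
    and complete: "mcauchy E s \<Longrightarrow> \<exists>x\<in>mcar E. (\<lambda>n. mnorm E (mdiff E (s n) x)) \<longlonglongrightarrow> 0"

text \<open>Maps are required to be \<open>undefined\<close> outside the carrier, so that equality in
  $\mathcal{L}(E_1,E_2)$ is equality on $E_1$.\<close>

definition adjointable :: "('b, 'e) rmod \<Rightarrow> ('b, 'f) rmod \<Rightarrow> ('e \<Rightarrow> 'f) set" where
  "adjointable E1 E2 =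
     {T \<in> mcar E1 \<rightarrow>\<^sub>E mcar E2.
        \<exists>S \<in> mcar E2 \<rightarrow>\<^sub>E mcar E1.
          \<forall>x\<in>mcar E1. \<forall>y\<in>mcar E2. mip E2 (T x) y = mip E1 x (S y)}"

definition madjoint ::
  "('b, 'e) rmod \<Rightarrow> ('b, 'f) rmod \<Rightarrow> ('e \<Rightarrow> 'f) \<Rightarrow> ('f \<Rightarrow> 'e)" where
  "madjoint E1 E2 T =
     (THE S. S \<in> mcar E2 \<rightarrow>\<^sub>E mcar E1 \<and>
        (\<forall>x\<in>mcar E1. \<forall>y\<in>mcar E2. mip E2 (T x) y = mip E1 x (S y)))"

text \<open>Positivity in the C*-algebra $M_n(\mathcal{L}(E))$, i.e. $T = S^*S$ for some
  $S \in M_n(\mathcal{L}(E))$.\<close>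

definition operator_matrix_positive ::
  "('b, 'e) rmod \<Rightarrow> nat \<Rightarrow> (nat \<Rightarrow> nat \<Rightarrow> 'e \<Rightarrow> 'e) \<Rightarrow> bool" where
  "operator_matrix_positive E n T \<longleftrightarrow>
     (\<exists>S. (\<forall>i<n. \<forall>j<n. S i j \<in> adjointable E E) \<and>
          (\<forall>i<n. \<forall>j<n. \<forall>x\<in>mcar E.
             T i j x = msum E (\<lambda>k. madjoint E E (S k i) (S k j x)) n))"

definition completely_positive ::
  "('b, 'e) rmod \<Rightarrow> ('a::cstar_algebra \<Rightarrow> 'e \<Rightarrow> 'e) \<Rightarrow> bool" where
  "completely_positive E \<phi> \<longleftrightarrow>
     (\<forall>a. \<phi> a \<in> adjointable E E) \<and>
     (\<forall>a b. \<forall>x\<in>mcar E. \<phi> (a + b) x = madd E (\<phi> a x) (\<phi> b x)) \<and>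
     (\<forall>c a. \<forall>x\<in>mcar E. \<phi> (c *\<^sub>C a) x = mscale E c (\<phi> a x)) \<and>
     (\<forall>n M. matrix_positive n M \<longrightarrow> operator_matrix_positive E n (\<lambda>i j. \<phi> (M i j)))"

definition strictly_cauchy :: "('b::cstar_algebra, 'e) rmod \<Rightarrow> ('e \<Rightarrow> 'e) filter \<Rightarrow> bool" where
  "strictly_cauchy E G \<longleftrightarrow>
     (\<forall>x\<in>mcar E. \<forall>\<epsilon>>0. \<forall>\<^sub>F (S, T) in G \<times>\<^sub>F G.
        mnorm E (mdiff E (S x) (T x)) < \<epsilon> \<and>
        mnorm E (mdiff E (madjoint E E S x) (madjoint E E T x)) < \<epsilon>)"

definition strict_map ::
  "('b::cstar_algebra, 'e) rmod \<Rightarrow> ('a::cstar_algebra \<Rightarrow> 'e \<Rightarrow> 'e) \<Rightarrow> bool" where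
  "strict_map E \<phi> \<longleftrightarrow> (\<exists>U. approximate_unit U \<and> strictly_cauchy E (filtermap \<phi> U))"


section \<open>Categories, functors and natural isomorphisms\<close>

record ('o, 'm) cat =
  Obj :: "'o set"
  Hom :: "'o \<Rightarrow> 'o \<Rightarrow> 'm set"
  Ident :: "'o \<Rightarrow> 'm"
  Comp :: "'o \<Rightarrow> 'o \<Rightarrow> 'o \<Rightarrow> 'm \<Rightarrow> 'm \<Rightarrow> 'm"
    \<comment> \<open>\<open>Comp C X Y Z g f\<close> is the composite of \<open>f : X \<rightarrow> Y\<close> and \<open>g : Y \<rightarrow> Z\<close>\<close>

locale is_category =
  fixes C :: "('o, 'm) cat"
  assumes Ident_in_Hom: "X \<in> Obj C \<Longrightarrow> Ident C X \<in> Hom C X X"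
    and Comp_in_Hom: "\<lbrakk>X \<in> Obj C; Y \<in> Obj C; Z \<in> Obj C; f \<in> Hom C X Y; g \<in> Hom C Y Z\<rbrakk>
      \<Longrightarrow> Comp C X Y Z g f \<in> Hom C X Z"
    and Comp_Ident_left: "\<lbrakk>X \<in> Obj C; Y \<in> Obj C; f \<in> Hom C X Y\<rbrakk>
      \<Longrightarrow> Comp C X Y Y (Ident C Y) f = f"
    and Comp_Ident_right: "\<lbrakk>X \<in> Obj C; Y \<in> Obj C; f \<in> Hom C X Y\<rbrakk>
      \<Longrightarrow> Comp C X X Y f (Ident C X) = f"
    and Comp_assoc: "\<lbrakk>W \<in> Obj C; X \<in> Obj C; Y \<in> Obj C; Z \<in> Obj C;
        f \<in> Hom C W X; g \<in> Hom C X Y; h \<in> Hom C Y Z\<rbrakk>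
      \<Longrightarrow> Comp C W Y Z h (Comp C W X Y g f) = Comp C W X Z (Comp C X Y Z h g) f"

record ('o, 'm, 'p, 'n) funct =
  fobj :: "'o \<Rightarrow> 'p"
  fmap :: "'o \<Rightarrow> 'o \<Rightarrow> 'm \<Rightarrow> 'n"

locale is_functor = dom: is_category C + cod: is_category D
  for C :: "('o, 'm) cat" and D :: "('p, 'n) cat" +
  fixes F :: "('o, 'm, 'p, 'n) funct"
  assumes fobj_in_Obj: "X \<in> Obj C \<Longrightarrow> fobj F X \<in> Obj D"
    and fmap_in_Hom: "\<lbrakk>X \<in> Obj C; Y \<in> Obj C; f \<in> Hom C X Y\<rbrakk>
      \<Longrightarrow> fmap F X Y f \<in> Hom D (fobj F X) (fobj F Y)"
    and fmap_Ident: "X \<in> Obj C \<Longrightarrow> fmap F X X (Ident C X) = Ident D (fobj F X)"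
    and fmap_Comp: "\<lbrakk>X \<in> Obj C; Y \<in> Obj C; Z \<in> Obj C; f \<in> Hom C X Y; g \<in> Hom C Y Z\<rbrakk>
      \<Longrightarrow> fmap F X Z (Comp C X Y Z g f) =
          Comp D (fobj F X) (fobj F Y) (fobj F Z) (fmap F Y Z g) (fmap F X Y f)"

definition comp_funct ::
  "('p, 'n, 'q, 'k) funct \<Rightarrow> ('o, 'm, 'p, 'n) funct \<Rightarrow> ('o, 'm, 'q, 'k) funct"
  (infixl "\<circ>\<^bsub>F\<^esub>" 55) where
  "G \<circ>\<^bsub>F\<^esub> F =
     \<lparr>fobj = \<lambda>X. fobj G (fobj F X),
      fmap = \<lambda>X Y f. fmap G (fobj F X) (fobj F Y) (fmap F X Y f)\<rparr>"

definition is_iso :: "('o, 'm) cat \<Rightarrow> 'o \<Rightarrow> 'o \<Rightarrow> 'm \<Rightarrow> bool" where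
  "is_iso C X Y f \<longleftrightarrow>
     f \<in> Hom C X Y \<and>
     (\<exists>g \<in> Hom C Y X. Comp C X Y X g f = Ident C X \<and> Comp C Y X Y f g = Ident C Y)"

definition naturally_isomorphic ::
  "('o, 'm) cat \<Rightarrow> ('p, 'n) cat \<Rightarrow>
   ('o, 'm, 'p, 'n) funct \<Rightarrow> ('o, 'm, 'p, 'n) funct \<Rightarrow> bool" where
  "naturally_isomorphic C D F G \<longleftrightarrow>
     is_functor C D F \<and> is_functor C D G \<and>
     (\<exists>\<theta>. (\<forall>X\<in>Obj C. is_iso D (fobj F X) (fobj G X) (\<theta> X)) \<and>
          (\<forall>X\<in>Obj C. \<forall>Y\<in>Obj C. \<forall>f\<in>Hom C X Y.
             Comp D (fobj F X) (fobj F Y) (fobj G Y) (\<theta> Y) (fmap F X Y f) =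
             Comp D (fobj F X) (fobj G X) (fobj G Y) (fmap G X Y f) (\<theta> X)))"


section \<open>The category of positive correspondences\<close>

type_synonym ('a, 'b, 'e) poscor = "('b, 'e) rmod \<times> ('a \<Rightarrow> 'e \<Rightarrow> 'e)"
type_synonym ('a, 'e) poscor_mor = "('e \<Rightarrow> 'e) \<times> ('a \<Rightarrow> 'a)"

text \<open>The algebras $A$ and $B$ are the types \<open>'a\<close> and \<open>'b\<close>; the underlying sets of the
  Hilbert modules are the subsets of \<open>'e\<close>.\<close>

definition PosCor ::
  "(('a::cstar_algebra, 'b::cstar_algebra, 'e) poscor, ('a, 'e) poscor_mor) cat" where
  "PosCor =
     \<lparr>Obj = {(E, \<phi>). hilbert_module E \<and> completely_positive E \<phi> \<and> strict_map E \<phi>},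
      Hom = (\<lambda>(E1, \<phi>1) (E2, \<phi>2).
        {(\<eta>, \<alpha>). \<eta> \<in> adjointable E1 E2 \<and> star_automorphism \<alpha> \<and>
           (\<forall>a. \<forall>x\<in>mcar E1. \<phi>2 (\<alpha> a) (\<eta> x) = \<eta> (\<phi>1 a x))}),
      Ident = (\<lambda>(E, \<phi>). (restrict id (mcar E), id)),
      Comp = (\<lambda>(E1, \<phi>1) (E2, \<phi>2) (E3, \<phi>3) (\<xi>, \<beta>) (\<eta>, \<alpha>).
        (compose (mcar E1) \<xi> \<eta>, \<beta> \<circ> \<alpha>))\<rparr>"


section \<open>The KSGNS construction\<close>

definition rep :: "'x set \<Rightarrow> 'x" where
  "rep X = (SOME x. x \<in> X)"

text \<open>The quotient by an equivalence relation on the carrier compatible with the operations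
  and the inner product.\<close>

definition quotient_rmod :: "('x \<times> 'x) set \<Rightarrow> ('b, 'x) rmod \<Rightarrow> ('b, 'x set) rmod" where
  "quotient_rmod R E =
     \<lparr>mcar = mcar E // R,
      mzero = R `` {mzero E},
      madd = \<lambda>X Y. R `` {madd E (rep X) (rep Y)},
      mscale = \<lambda>c X. R `` {mscale E c (rep X)},
      mact = \<lambda>X b. R `` {mact E (rep X) b},
      mip = \<lambda>X Y. mip E (rep X) (rep Y)\<rparr>"

text \<open>The algebraic tensor product over the complex numbers: the commutative monoid generated by
  the symbols $a \otimes x$, written as multisets of pairs, modulo biadditivity and balancedness.
  Negatives exist because $(-a) \otimes x$ is the negative of $a \otimes x$.\<close>

inductive tensor_eq ::
  "('b, 'e) rmod \<Rightarrow> ('a::cstar_algebra \<times> 'e) multiset \<Rightarrow> ('a \<times> 'e) multiset \<Rightarrow> bool"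
  for E where
  refl: "set_mset z \<subseteq> UNIV \<times> mcar E \<Longrightarrow> tensor_eq E z z"
| sym: "tensor_eq E z w \<Longrightarrow> tensor_eq E w z"
| trans: "tensor_eq E z w \<Longrightarrow> tensor_eq E w v \<Longrightarrow> tensor_eq E z v"
| plus: "tensor_eq E z z' \<Longrightarrow> tensor_eq E w w' \<Longrightarrow> tensor_eq E (z + w) (z' + w')"
| zero: "x \<in> mcar E \<Longrightarrow> tensor_eq E {#(0, x)#} {#}"
| add_left: "x \<in> mcar E \<Longrightarrow> tensor_eq E {#(a + b, x)#} {#(a, x), (b, x)#}"
| add_right: "x \<in> mcar E \<Longrightarrow> y \<in> mcar E \<Longrightarrow>
    tensor_eq E {#(a, madd E x y)#} {#(a, x), (a, y)#}"
| scale: "x \<in> mcar E \<Longrightarrow> tensor_eq E {#(c *\<^sub>C a, x)#} {#(a, mscale E c x)#}"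

definition formal_tensors ::
  "('a::cstar_algebra, 'b::cstar_algebra, 'e) poscor \<Rightarrow> ('b, ('a \<times> 'e) multiset) rmod" where
  "formal_tensors = (\<lambda>(E, \<phi>).
     \<lparr>mcar = {z. set_mset z \<subseteq> UNIV \<times> mcar E},
      mzero = {#},
      madd = (+),
      mscale = \<lambda>c. image_mset (\<lambda>(a, x). (c *\<^sub>C a, x)),
      mact = \<lambda>z b. image_mset (\<lambda>(a, x). (a, mact E x b)) z,
      mip = \<lambda>z w. \<Sum>(a1, x1)\<in>#z. \<Sum>(a2, x2)\<in>#w. mip E x1 (\<phi> (star a1 * a2) x2)\<rparr>)"

definition tensor_rel ::
  "('a::cstar_algebra, 'b::cstar_algebra, 'e) poscor
   \<Rightarrow> (('a \<times> 'e) multiset \<times> ('a \<times> 'e) multiset) set" where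
  "tensor_rel X = {(z, w). tensor_eq (fst X) z w}"

definition alg_tensor ::
  "('a::cstar_algebra, 'b::cstar_algebra, 'e) poscor \<Rightarrow> ('b, ('a \<times> 'e) multiset set) rmod" where
  "alg_tensor X = quotient_rmod (tensor_rel X) (formal_tensors X)"

definition null_rel :: "('b::zero, 'x) rmod \<Rightarrow> ('x \<times> 'x) set" where
  "null_rel E =
     {(z, w). z \<in> mcar E \<and> w \<in> mcar E \<and> mip E (mdiff E z w) (mdiff E z w) = 0}"

definition null_quotient :: "('b::zero, 'x) rmod \<Rightarrow> ('b, 'x set) rmod" where
  "null_quotient E = quotient_rmod (null_rel E) E"

definition cauchy_sequences :: "('b::cstar_algebra, 'x) rmod \<Rightarrow> ('b, nat \<Rightarrow> 'x) rmod" where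
  "cauchy_sequences E =
     \<lparr>mcar = {s. mcauchy E s},
      mzero = \<lambda>n. mzero E,
      madd = \<lambda>s t n. madd E (s n) (t n),
      mscale = \<lambda>c s n. mscale E c (s n),
      mact = \<lambda>s b n. mact E (s n) b,
      mip = \<lambda>s t. lim (\<lambda>n. mip E (s n) (t n))\<rparr>"

definition completion_rel ::
  "('b::cstar_algebra, 'x) rmod \<Rightarrow> ((nat \<Rightarrow> 'x) \<times> (nat \<Rightarrow> 'x)) set" where
  "completion_rel E =
     {(s, t). mcauchy E s \<and> mcauchy E t \<and> (\<lambda>n. mnorm E (mdiff E (s n) (t n))) \<longlonglongrightarrow> 0}"

definition completion :: "('b::cstar_algebra, 'x) rmod \<Rightarrow> ('b, (nat \<Rightarrow> 'x) set) rmod" where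
  "completion E = quotient_rmod (completion_rel E) (cauchy_sequences E)"

text \<open>The construction changes the type of module elements, whereas an endofunctor needs a single
  one.  The following type contains an arbitrary type \<open>'k\<close> and has a code for every sequence of
  formal tensors over itself, hence also for every element of the KSGNS module (a class of
  sequences of classes of classes of formal tensors) of a module with elements in it.
  The elements of the KSGNS module are replaced by codes, injectively on the carrier.\<close>

datatype ('a, 'k) univ = Atom 'k | Code "nat \<Rightarrow> ('a \<times> ('a, 'k) univ) multiset"

definition encode ::
  "(nat \<Rightarrow> ('a \<times> ('a, 'k) univ) multiset set set) set \<Rightarrow> ('a, 'k) univ" where
  "encode c = Code (\<lambda>n. rep (rep (rep c n)))"

definition transport :: "('x \<Rightarrow> 'y) \<Rightarrow> ('b, 'x) rmod \<Rightarrow> ('b, 'y) rmod" where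
  "transport f E =
     (let g = inv_into (mcar E) f in
      \<lparr>mcar = f ` mcar E,
       mzero = f (mzero E),
       madd = \<lambda>x y. f (madd E (g x) (g y)),
       mscale = \<lambda>c x. f (mscale E c (g x)),
       mact = \<lambda>x b. f (mact E (g x) b),
       mip = \<lambda>x y. mip E (g x) (g y)\<rparr>)"

text \<open>$F_\phi = A \otimes_\phi E$ and its elementary tensors $a \mathbin{\dot\otimes} x$.\<close>

definition ksgns_module ::
  "('a::cstar_algebra, 'b::cstar_algebra, ('a, 'k) univ) poscor \<Rightarrow> ('b, ('a, 'k) univ) rmod" where
  "ksgns_module X = transport encode (completion (null_quotient (alg_tensor X)))"

definition elementary_tensor ::
  "('a::cstar_algebra, 'b::cstar_algebra, ('a, 'k) univ) poscor
   \<Rightarrow> 'a \<Rightarrow> ('a, 'k) univ \<Rightarrow> ('a, 'k) univ" where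
  "elementary_tensor X a x =
     (let t = tensor_rel X `` {{#(a, x)#}};
          u = null_rel (alg_tensor X) `` {t}
      in encode (completion_rel (null_quotient (alg_tensor X)) `` {\<lambda>n. u}))"

definition ksgns_rep ::
  "('a::cstar_algebra, 'b::cstar_algebra, ('a, 'k) univ) poscor
   \<Rightarrow> 'a \<Rightarrow> ('a, 'k) univ \<Rightarrow> ('a, 'k) univ" where
  "ksgns_rep X a' =
     (THE T. T \<in> adjointable (ksgns_module X) (ksgns_module X) \<and>
        (\<forall>a. \<forall>x\<in>mcar (fst X).
           T (elementary_tensor X a x) = elementary_tensor X (a' * a) x))"

definition ksgns_mor ::
  "('a::cstar_algebra, 'b::cstar_algebra, ('a, 'k) univ) poscor
   \<Rightarrow> ('a, 'b, ('a, 'k) univ) poscor \<Rightarrow> ('a, ('a, 'k) univ) poscor_mor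
   \<Rightarrow> ('a, ('a, 'k) univ) poscor_mor" where
  "ksgns_mor X1 X2 = (\<lambda>(\<eta>, \<alpha>).
     (THE T. T \<in> adjointable (ksgns_module X1) (ksgns_module X2) \<and>
        (\<forall>a. \<forall>x\<in>mcar (fst X1).
           T (elementary_tensor X1 a x) = elementary_tensor X2 (\<alpha> a) (\<eta> x)), \<alpha>))"

definition KSGNS ::
  "(('a::cstar_algebra, 'b::cstar_algebra, ('a, 'k) univ) poscor, ('a, ('a, 'k) univ) poscor_mor,
    ('a, 'b, ('a, 'k) univ) poscor, ('a, ('a, 'k) univ) poscor_mor) funct" where
  "KSGNS = \<lparr>fobj = \<lambda>X. (ksgns_module X, ksgns_rep X), fmap = ksgns_mor\<rparr>"

end

theory Submission
  imports Defs
begin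

text \<open>
  The module \<open>F\<^sub>\<phi>\<close> is used only through its elementary tensors: they generate it, and
  \<open>\<langle>a \<otimes> x, b \<otimes> y\<rangle> = \<langle>x, \<phi>(a\<^sup>* b) y\<rangle>\<close>.  A map given on generators, bounded on their sums and with an
  adjoint on generators, extends to an adjointable map.  For \<open>\<pi>(a)\<close> and \<open>\<eta>\<close> the bound on sums
  follows by iterating the Cauchy-Schwarz inequality for the powers of \<open>a\<^sup>* a\<close> and \<open>\<eta>\<^sup>* \<eta>\<close>, so that
  no square roots of operators are needed.  The isomorphism \<open>KSGNS\<^sup>2 \<cong> KSGNS\<close> is
  \<open>a \<otimes> z \<mapsto> \<pi>(a) z\<close>: it is isometric because \<open>\<langle>\<pi>(a) z, \<pi>(b) w\<rangle> = \<langle>z, \<pi>(a\<^sup>* b) w\<rangle>\<close>, and its range is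
  dense because \<open>\<pi>(u) z \<longrightarrow> z\<close> along an approximate unit; naturality is the intertwining relation.

  The order on a C*-algebra is that of its unitization, where \<open>a = a\<^sup>*\<close> is positive if and only if
  \<open>\<parallel>t - a\<parallel> \<le> t\<close> for some real \<open>t \<ge> 0\<close>.
\<close>

section \<open>Positive elements of C*-algebras\<close>

text \<open>Neither a completely positive map nor a member of \<open>adjointable\<close> comes with
  a norm bound, yet every operator on \<open>F\<close> is built by extension from generators and
  therefore needs one. Two uniform boundedness arguments supply constants of unknown size:
  \<open>\<tau>_bounded\<close> for \<open>\<phi>\<close> and \<open>bounded\<close> for adjointable
  maps. The iterated Cauchy-Schwarz inequality discards such constants, since they enter only under
  a 2^k-th root, and for \<pi>(a) it leaves the exact ratio \<open>norm (star a * a)\<close>. The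
  resulting contractivity is what lets \<pi>(u) converge strongly along an approximate unit.

  Positivity is defined by a factorization, which hides even closure under sums. The norm condition
  makes sums and limits easy; the bridge is that \<open>star b * b\<close> satisfies it, proved with
  square roots and absolute values but without spectra.

  Prescribing an adjoint on generators along with the map pays twice: it pins down the limits that
  define the extension, and for the isomorphism an exchange of the two families yields the
  inverse.\<close>

lemma scaleC_real: "complex_of_real r *\<^sub>C a = r *\<^sub>R (a::'a::cstar_algebra)"
  by (simp add: scaleR_scaleC)

lemma scaleC_zero_left [simp]: "0 *\<^sub>C a = (0::'a::cstar_algebra)"
  using scaleR_scaleC[of 0 a] by simp

lemma scaleC_zero_right [simp]: "c *\<^sub>C 0 = (0::'a::cstar_algebra)"
  using scaleC_add_right[of c 0 "0::'a"] by simp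

lemma scaleC_minus_one: "(-1) *\<^sub>C a = - (a::'a::cstar_algebra)"
  using scaleR_scaleC[of "-1" a] by simp

lemma scaleC_minus_right: "c *\<^sub>C (- a) = - (c *\<^sub>C (a::'a::cstar_algebra))"
  by (metis scaleC_minus_one scaleC_scaleC mult.commute)

lemma scaleC_minus_left: "(- c) *\<^sub>C a = - (c *\<^sub>C (a::'a::cstar_algebra))"
  by (metis scaleC_minus_one scaleC_scaleC mult_minus1)

lemma scaleC_diff_right: "c *\<^sub>C (a - b) = c *\<^sub>C a - c *\<^sub>C (b::'a::cstar_algebra)"
  using scaleC_add_right[of c a "- b"] by (simp add: scaleC_minus_right)

lemma star_scaleR: "star (r *\<^sub>R a) = r *\<^sub>R star (a::'a::cstar_algebra)"
  by (simp add: scaleR_scaleC star_scaleC)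

lemma star_zero [simp]: "star 0 = (0::'a::cstar_algebra)"
  using star_scaleR[of 0 0] by simp

lemma star_minus: "star (- a) = - star (a::'a::cstar_algebra)"
  using star_scaleR[of "-1" a] by simp

lemma star_diff: "star (a - b) = star a - star (b::'a::cstar_algebra)"
  using star_add[of a "- b"] by (simp add: star_minus)

lemma norm_star [simp]: "norm (star a) = norm (a::'a::cstar_algebra)"
proof -
  have le: "norm a \<le> norm (star a)" for a :: 'a
  proof (cases "a = 0")
    case False
    have "norm a * norm a \<le> norm (star a) * norm a"
      using cstar_identity[of a] norm_mult_ineq[of "star a" a] by (simp add: power2_eq_square)
    then show ?thesis
      using False by simp
  qed simp
  show ?thesis
    using le[of a] le[of "star a"] by (simp add: star_star)
qed

lemma bounded_linear_star: "bounded_linear (star :: 'a::cstar_algebra \<Rightarrow> 'a)"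
  by (rule bounded_linear_intro[where K = 1]) (simp_all add: star_add star_scaleR)

lemmas tendsto_star = bounded_linear.tendsto[OF bounded_linear_star]

lemma bounded_linear_scaleC: "bounded_linear (\<lambda>a::'a::cstar_algebra. c *\<^sub>C a)"
  by (rule bounded_linear_intro[where K = "cmod c"])
    (simp_all add: scaleC_add_right scaleR_scaleC scaleC_scaleC norm_scaleC mult.commute)

lemma star_sum: "star (\<Sum>i\<in>I. f i) = (\<Sum>i\<in>I. star (f i :: 'a::cstar_algebra))"
  by (induction I rule: infinite_finite_induct) (simp_all add: star_add)

subsection \<open>Unital C*-algebras\<close>

class cstar_algebra_1 = cstar_algebra + real_normed_algebra_1

lemma star_one [simp]: "star 1 = (1::'a::cstar_algebra_1)"
  by (metis star_star star_mult mult_1_right)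

lemma star_of_real [simp]: "star (of_real r) = (of_real r :: 'a::cstar_algebra_1)"
  by (simp add: of_real_def star_scaleR)

text \<open>In spectral terms, the spectrum of \<open>a\<close> lies in [0, 2t]. In this form sums
  and nonnegative multiples are settled by the triangle inequality and scaling, with no
  factorization to be found.\<close>

definition nonneg :: "'a::cstar_algebra_1 \<Rightarrow> bool" where
  "nonneg a \<longleftrightarrow> star a = a \<and> (\<exists>t\<ge>0. norm (of_real t - a) \<le> t)"

lemma cstar_identity_selfadjoint:
  "star a = a \<Longrightarrow> norm (a * a) = (norm (a::'a::cstar_algebra))\<^sup>2"
  using cstar_identity[of a] by simp

section \<open>Square roots by a fixed-point iteration\<close>

fun sqrt_seq :: "'a::cstar_algebra_1 \<Rightarrow> nat \<Rightarrow> 'a" where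
  "sqrt_seq h 0 = 0"
| "sqrt_seq h (Suc n) = (1/2) *\<^sub>R (h + sqrt_seq h n * sqrt_seq h n)"

text \<open>The same iteration for the scalar 1 in place of \<open>h\<close>. It increases and stays
  below 1, and it majorizes both the norms and the increments of \<open>sqrt_seq h\<close>. A
  majorant is needed because for \<open>norm h = 1\<close> the iteration need not contract at a
  uniform rate.\<close>

fun sqrt_bound :: "nat \<Rightarrow> real" where
  "sqrt_bound 0 = 0"
| "sqrt_bound (Suc n) = (1 + sqrt_bound n * sqrt_bound n) / 2"

lemma sqrt_bound_01: "0 \<le> sqrt_bound n \<and> sqrt_bound n \<le> 1"
proof (induction n)
  case (Suc n)
  then have "sqrt_bound n * sqrt_bound n \<le> 1 * 1" by (intro mult_mono) auto
  with Suc show ?case by auto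
qed simp

lemma sqrt_bound_mono: "sqrt_bound n \<le> sqrt_bound (Suc n)"
proof -
  have "0 \<le> (1 - sqrt_bound n)\<^sup>2" by simp
  then show ?thesis by (simp add: power2_eq_square algebra_simps)
qed

lemma norm_sqrt_seq: "norm h \<le> 1 \<Longrightarrow> norm (sqrt_seq h n) \<le> sqrt_bound n"
proof (induction n)
  case (Suc n)
  have "norm (sqrt_seq h n * sqrt_seq h n) \<le> sqrt_bound n * sqrt_bound n"
    using Suc sqrt_bound_01[of n]
    by (intro order_trans[OF norm_mult_ineq] mult_mono) auto
  then show ?case
    using Suc.prems norm_triangle_ineq[of h "sqrt_seq h n * sqrt_seq h n"] by simp
qed simp

text \<open>For consecutive iterates, \<open>w * w - v * v = w * (w - v) + (w - v) * v\<close> holds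
  without commutativity. The scalar iteration satisfies the same identity, so domination passes from
  one increment to the next.\<close>

lemma norm_sqrt_seq_Suc_diff:
  assumes "norm h \<le> 1"
  shows "norm (sqrt_seq h (Suc n) - sqrt_seq h n) \<le> sqrt_bound (Suc n) - sqrt_bound n"
proof (induction n)
  case 0
  then show ?case using assms by simp
next
  case (Suc n)
  define v w where "v = sqrt_seq h n" and "w = sqrt_seq h (Suc n)"
  define s t where "s = sqrt_bound n" and "t = sqrt_bound (Suc n)"
  have "norm (w * (w - v)) \<le> t * (t - s)" "norm ((w - v) * v) \<le> (t - s) * s"
    using Suc norm_sqrt_seq[OF assms, of n] norm_sqrt_seq[OF assms, of "Suc n"]
      sqrt_bound_01[of n] sqrt_bound_01[of "Suc n"] sqrt_bound_mono[of n]
    unfolding v_def w_def s_def t_def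
    by (auto simp del: sqrt_seq.simps sqrt_bound.simps intro!: order_trans[OF norm_mult_ineq] mult_mono)
  then have "norm (w * (w - v) + (w - v) * v) \<le> t * t - s * s"
    using norm_triangle_ineq[of "w * (w - v)" "(w - v) * v"] by (simp add: algebra_simps)
  moreover have "sqrt_seq h (Suc (Suc n)) - w = (1/2) *\<^sub>R (w * (w - v) + (w - v) * v)"
    unfolding w_def[symmetric] sqrt_seq.simps(2)[of h "Suc n"]
    by (subst (3) w_def) (simp add: v_def[symmetric] algebra_simps)
  moreover have "sqrt_bound (Suc (Suc n)) - t = (t * t - s * s) / 2"
    unfolding t_def[symmetric] sqrt_bound.simps(2)[of "Suc n"]
    by (subst (3) t_def) (simp add: s_def[symmetric] field_simps)
  ultimately show ?case
    unfolding w_def[symmetric] t_def[symmetric] by simp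
qed

lemma norm_sqrt_seq_diff:
  assumes "norm h \<le> 1" "n \<le> m"
  shows "norm (sqrt_seq h m - sqrt_seq h n) \<le> sqrt_bound m - sqrt_bound n"
  using assms(2)
proof (induction m rule: dec_induct)
  case (step m)
  have "norm (sqrt_seq h (Suc m) - sqrt_seq h n)
      \<le> norm (sqrt_seq h (Suc m) - sqrt_seq h m) + norm (sqrt_seq h m - sqrt_seq h n)"
    by (rule norm_diff_triangle_ineq[of _ _ "sqrt_seq h m" "sqrt_seq h m", simplified]
        | metis norm_triangle_ineq diff_add_cancel add_diff_eq)+
  then show ?case
    using step norm_sqrt_seq_Suc_diff[OF assms(1), of m] by linarith
qed simp

lemma Cauchy_sqrt_seq:
  assumes "norm (h::'a::cstar_algebra_1) \<le> 1"
  shows "Cauchy (sqrt_seq h)"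
proof -
  have "incseq sqrt_bound" by (rule incseq_SucI) (rule sqrt_bound_mono)
  then have "convergent sqrt_bound"
    by (metis sqrt_bound_01 incseq_convergent convergentI)
  then have "Cauchy sqrt_bound" by (rule convergent_Cauchy)
  show ?thesis
  proof (rule CauchyI')
    fix e :: real assume "0 < e"
    then obtain M where M: "\<And>m n. m \<ge> M \<Longrightarrow> n \<ge> M \<Longrightarrow> norm (sqrt_bound m - sqrt_bound n) < e"
      using \<open>Cauchy sqrt_bound\<close> by (metis CauchyD)
    have "norm (sqrt_seq h m - sqrt_seq h n) < e" if "m \<ge> M" "m < n" for m n
      using M[of n m] that norm_sqrt_seq_diff[OF assms, of m n] by (simp add: norm_minus_commute)
    then show "\<exists>M. \<forall>m\<ge>M. \<forall>n>m. dist (sqrt_seq h m) (sqrt_seq h n) < e"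
      by (auto simp: dist_norm)
  qed
qed

text \<open>The square root of \<open>1 - h\<close> is \<open>1 - w\<close> with \<open>w = (h + w\<^sup>2) / 2\<close>.\<close>

lemma sqrt_one_minus:
  assumes sa: "star h = h" and le: "norm (h::'a::cstar_algebra_1) \<le> 1"
  obtains c where "star c = c" "c * c = 1 - h" "norm (1 - c) \<le> 1"
    "\<And>x. x * h = h * x \<Longrightarrow> x * c = c * x"
proof -
  obtain w where w: "sqrt_seq h \<longlonglongrightarrow> w"
    using Cauchy_sqrt_seq[OF le] by (auto simp: Cauchy_convergent_iff convergent_def)
  have "star (sqrt_seq h n) = sqrt_seq h n" for n
    by (induction n) (simp_all add: star_add star_mult star_scaleR sa)
  then have star_w: "star w = w"
    using LIMSEQ_unique[OF tendsto_star[OF w]] w by simp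
  have "(\<lambda>n. sqrt_seq h (Suc n)) \<longlonglongrightarrow> (1/2) *\<^sub>R (h + w * w)"
    unfolding sqrt_seq.simps by (intro tendsto_intros w)
  then have w_eq: "w = (1/2) *\<^sub>R (h + w * w)"
    using LIMSEQ_Suc[OF w] LIMSEQ_unique by blast
  have "w + w = h + w * w"
    using arg_cong[OF w_eq, of "scaleR 2"] by (simp add: scaleR_2)
  then have sq: "(1 - w) * (1 - w) = 1 - h" by (simp add: algebra_simps)
  have "norm (sqrt_seq h n) \<le> 1" for n
    using norm_sqrt_seq[OF le, of n] sqrt_bound_01[of n] by linarith
  then have nw: "norm w \<le> 1"
    using LIMSEQ_le_const2[OF tendsto_norm[OF w]] by blast
  have comm: "x * w = w * x" if "x * h = h * x" for x
  proof -
    have "x * sqrt_seq h n = sqrt_seq h n * x" for n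
    proof (induction n)
      case (Suc n)
      have "x * (sqrt_seq h n * sqrt_seq h n) = (sqrt_seq h n * sqrt_seq h n) * x"
        using Suc by (metis mult.assoc)
      then show ?case using that by (simp add: algebra_simps)
    qed simp
    then show ?thesis
      using LIMSEQ_unique[OF tendsto_mult_left[OF w, of x]] tendsto_mult_right[OF w, of x] by simp
  qed
  show thesis
  proof
    show "star (1 - w) = 1 - w" by (simp add: star_diff star_w)
    show "x * (1 - w) = (1 - w) * x" if "x * h = h * x" for x
      using comm[OF that] by (simp add: algebra_simps)
  qed (use sq nw in auto)
qed

text \<open>The condition \<open>norm (of_real t - a) \<le> t\<close> says that
  \<open>1 - a/t\<close> is a contraction, so \<open>sqrt_one_minus\<close> gives a root of
  \<open>a/t\<close>. Its clause \<open>norm (1 - c) \<le> 1\<close> rescales to the witness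
  \<open>sqrt t\<close> for the nonnegativity of the root. The commutation clause stands in for
  membership of the root in the algebra generated by \<open>a\<close>.\<close>

lemma nonneg_sqrt:
  assumes "nonneg (a::'a::cstar_algebra_1)"
  obtains c where "star c = c" "c * c = a" "nonneg c" "\<And>x. x * a = a * x \<Longrightarrow> x * c = c * x"
proof -
  obtain t where t: "star a = a" "t \<ge> 0" "norm (of_real t - a) \<le> t"
    using assms by (auto simp: nonneg_def)
  show thesis
  proof (cases "t = 0")
    case True
    then have "a = 0" using t by simp
    then show thesis by (intro that[of 0]) (auto simp: nonneg_def)
  next
    case False
    then have "t > 0" using t by simp
    define h where "h = 1 - (1/t) *\<^sub>R a"
    have "norm h = norm ((1/t) *\<^sub>R (of_real t - a))"
      using \<open>t > 0\<close> by (simp add: h_def scaleR_diff_right of_real_def)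
    also have "\<dots> \<le> 1" using t \<open>t > 0\<close> by (simp add: divide_simps)
    finally have "norm h \<le> 1" .
    moreover have "star h = h" by (simp add: h_def star_diff star_scaleR t)
    ultimately obtain c where c: "star c = c" "c * c = 1 - h" "norm (1 - c) \<le> 1"
      "\<And>x. x * h = h * x \<Longrightarrow> x * c = c * x"
      using sqrt_one_minus by blast
    show thesis
    proof
      let ?c = "sqrt t *\<^sub>R c"
      show "star ?c = ?c" by (simp add: star_scaleR c)
      show "?c * ?c = a" using \<open>t > 0\<close> c(2) by (simp add: h_def)
      have "norm (of_real (sqrt t) - ?c) = sqrt t * norm (1 - c)"
        using \<open>t > 0\<close> by (metis norm_scaleR scaleR_diff_right of_real_def abs_of_nonneg
            real_sqrt_ge_zero t(2))
      also have "\<dots> \<le> sqrt t" using c(3) \<open>t > 0\<close> by (simp add: mult_left_le)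
      finally show "nonneg ?c"
        using \<open>t > 0\<close> \<open>star ?c = ?c\<close> unfolding nonneg_def by (metis real_sqrt_ge_zero t(2))
      show "x * ?c = ?c * x" if "x * a = a * x" for x
        using c(4)[of x] that by (simp add: h_def algebra_simps)
    qed
  qed
qed

text \<open>For a self-adjoint contraction \<open>x\<close>, \<open>u = x + i * sqrt (1 - x\<^sup>2)\<close> is unitary, and
  \<open>2 x\<^sup>2 - 1\<close> is the real part of \<open>u\<^sup>2\<close>.\<close>

lemma norm_double_square_minus_one:
  assumes sa: "star x = x" and le: "norm (x::'a::cstar_algebra_1) \<le> 1"
  shows "norm (2 *\<^sub>R (x * x) - 1) \<le> 1"
proof -
  have "norm (x * x) \<le> 1"
    using cstar_identity_selfadjoint[OF sa] le by (simp add: power_le_one)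
  moreover have "star (x * x) = x * x" by (simp add: star_mult sa)
  ultimately obtain c where c: "star c = c" "c * c = 1 - x * x"
    "\<And>y. y * (x * x) = (x * x) * y \<Longrightarrow> y * c = c * y"
    using sqrt_one_minus by metis
  have xc: "x * c = c * x" using c(3)[of x] by (simp add: mult.assoc)
  define u where "u = x + \<i> *\<^sub>C c"
  have su: "star u = x - \<i> *\<^sub>C c"
    by (simp add: u_def star_add star_scaleC sa c(1) scaleC_minus_left)
  have "star u * u = x * x + c * c"
    unfolding su unfolding u_def
    by (simp add: algebra_simps mult_scaleC_left mult_scaleC_right scaleC_scaleC scaleC_minus_one
        scaleC_add_right scaleC_diff_right xc)
  then have "norm u = 1"
    using cstar_identity[of u] c(2) by (simp add: power2_eq_1_iff) (metis norm_ge_zero not_one_le_zero neg_0_le_iff_le)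
  have "u * u + star u * star u = 2 *\<^sub>R (x * x - c * c)"
    unfolding su unfolding u_def
    by (simp add: algebra_simps mult_scaleC_left mult_scaleC_right scaleC_scaleC scaleC_minus_one
        scaleC_add_right scaleC_diff_right xc scaleR_2)
  also have "\<dots> = 2 *\<^sub>R (2 *\<^sub>R (x * x) - 1)"
    by (simp add: c(2) scaleR_2 algebra_simps)
  finally have "2 * norm (2 *\<^sub>R (x * x) - 1) = norm (u * u + star u * star u)"
    by simp
  also have "\<dots> \<le> norm u * norm u + norm (star u) * norm (star u)"
    by (intro order_trans[OF norm_triangle_ineq] add_mono norm_mult_ineq)
  also have "\<dots> = 2" using \<open>norm u = 1\<close> by simp
  finally show ?thesis by simp
qed

text \<open>Rescaling \<open>norm_double_square_minus_one\<close> to \<open>x\<close> settles the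
  midpoint \<open>s\<close> of the interval [0, \<open>(norm x)\<^sup>2\<close>]. A larger
  \<open>t\<close> costs the additional \<open>t - s\<close> on both sides.\<close>

lemma norm_of_real_minus_square:
  assumes sa: "star x = x" and t: "(norm (x::'a::cstar_algebra_1))\<^sup>2 / 2 \<le> t"
  shows "norm (of_real t - x * x) \<le> t"
proof (cases "x = 0")
  case True
  then show ?thesis using t by simp
next
  case False
  define y where "y = (1 / norm x) *\<^sub>R x"
  define s where "s = (norm x)\<^sup>2 / 2"
  have "norm (2 *\<^sub>R (y * y) - 1) \<le> 1"
    using False by (intro norm_double_square_minus_one) (simp_all add: y_def star_scaleR sa)
  moreover have "of_real s - x * x = (- s) *\<^sub>R (2 *\<^sub>R (y * y) - 1)"
    using False by (simp add: s_def y_def of_real_def scaleR_diff_right power2_eq_square field_simps)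
  ultimately have "norm (of_real s - x * x) \<le> s"
    by (simp add: s_def mult_left_le)
  moreover have "norm (of_real (t - s) :: 'a) = t - s"
    using t unfolding norm_of_real s_def by simp
  ultimately have "norm (of_real s - x * x) + norm (of_real (t - s) :: 'a) \<le> t" by simp
  then show ?thesis
    using norm_triangle_ineq[of "of_real s - x * x" "of_real (t - s) :: 'a"] by simp
qed

lemma nonneg_square: "star x = x \<Longrightarrow> nonneg (x * x)"
  using norm_of_real_minus_square[of x "(norm x)\<^sup>2 / 2"] unfolding nonneg_def
  by (metis star_mult order_refl zero_le_power2 divide_nonneg_nonneg zero_le_numeral)

text \<open>Writing \<open>a\<close> as the square of a self-adjoint element frees the estimate from
  the particular witness in \<open>nonneg\<close>: every \<open>t\<close> from half the norm on will
  do. The comparisons of norms rest on this freedom.\<close>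

lemma nonneg_norm_le:
  assumes "nonneg a" "norm a / 2 \<le> t"
  shows "norm (of_real t - a) \<le> t"
  using assms by (metis nonneg_sqrt cstar_identity_selfadjoint norm_of_real_minus_square)

section \<open>The closed cone of nonnegative elements\<close>

lemma nonnegD: "nonneg a \<Longrightarrow> star a = a"
  by (simp add: nonneg_def)

lemma nonnegI: "star a = a \<Longrightarrow> norm (of_real t - a) \<le> t \<Longrightarrow> nonneg a"
  unfolding nonneg_def by (meson norm_ge_zero order_trans)

lemma nonneg_add:
  assumes "nonneg a" "nonneg b"
  shows "nonneg (a + b)"
proof -
  obtain s t where "norm (of_real s - a) \<le> s" "norm (of_real t - b) \<le> t"
    using assms by (auto simp: nonneg_def)
  then have "norm (of_real (s + t) - (a + b)) \<le> s + t"
    using norm_triangle_ineq[of "of_real s - a" "of_real t - b"] by (simp add: algebra_simps)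
  then show ?thesis
    using assms by (intro nonnegI[of _ "s + t"]) (simp_all add: star_add nonneg_def)
qed

lemma nonneg_scaleR:
  assumes "nonneg a" "0 \<le> r"
  shows "nonneg (r *\<^sub>R a)"
proof -
  obtain t where "norm (of_real t - a) \<le> t"
    using assms by (auto simp: nonneg_def)
  then have "norm (of_real (r * t) - r *\<^sub>R a) \<le> r * t"
    using assms(2) mult_left_mono[of "norm (of_real t - a)" t r]
    by (metis norm_scaleR abs_of_nonneg scaleR_diff_right of_real_def scaleR_scaleR)
  then show ?thesis
    using assms by (intro nonnegI[of _ "r * t"]) (simp_all add: star_scaleR nonneg_def)
qed

lemma nonneg_of_real: "0 \<le> r \<Longrightarrow> nonneg (of_real r)"
  by (rule nonnegI[of _ r]) simp_all

lemma nonneg_norm_diff: "star a = a \<Longrightarrow> nonneg (of_real (norm a) - a)"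
  by (rule nonnegI[of _ "norm a"]) (simp_all add: star_diff)

text \<open>By \<open>nonneg_norm_le\<close> the witness for \<open>X i\<close> can be taken to be
  \<open>norm (X i)\<close>. This choice depends continuously on \<open>X i\<close>, so the
  inequality survives the limit.\<close>

lemma nonneg_tendsto:
  assumes "(X \<longlongrightarrow> a) F" "\<forall>\<^sub>F i in F. nonneg (X i)" "F \<noteq> bot"
  shows "nonneg a"
proof (rule nonnegI)
  have "((\<lambda>i. star (X i)) \<longlongrightarrow> star a) F" using assms(1) by (rule tendsto_star)
  moreover have "((\<lambda>i. star (X i)) \<longlongrightarrow> a) F"
    using assms(1) by (rule Lim_transform_eventually)
      (use assms(2) in \<open>eventually_elim, simp add: nonnegD\<close>)
  ultimately show "star a = a" using assms(3) tendsto_unique by blast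
  have "((\<lambda>i. norm (X i)) \<longlongrightarrow> norm a) F" by (intro tendsto_intros assms(1))
  moreover have "((\<lambda>i. norm (of_real (norm (X i)) - X i)) \<longlongrightarrow> norm (of_real (norm a) - a)) F"
    by (intro tendsto_intros assms(1))
  moreover have "\<forall>\<^sub>F i in F. norm (of_real (norm (X i)) - X i) \<le> norm (X i)"
    using assms(2) by eventually_elim (simp add: nonneg_norm_le)
  ultimately show "norm (of_real (norm a) - a) \<le> norm a"
    by (rule tendsto_le[OF assms(3)])
qed

text \<open>If \<open>norm a\<close> exceeded \<beta>, then for a suitable \<gamma> below
  \<open>norm a\<close> the element \<gamma> - a would be nonnegative of norm at most \<gamma>.
  Applying \<open>nonneg_norm_le\<close> to \<gamma> - a, again at \<gamma>, gives norm at most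
  \<gamma> for \<open>a\<close> itself.\<close>

lemma nonneg_norm_bound:
  assumes "nonneg a" "nonneg (of_real \<beta> - a)" "0 \<le> \<beta>"
  shows "norm (a::'a::cstar_algebra_1) \<le> \<beta>"
proof (rule ccontr)
  assume "\<not> norm a \<le> \<beta>"
  then have lt: "\<beta> < norm a" by simp
  \<comment> \<open>Three demands on \<gamma>: at least \<beta>, so that \<gamma> - a stays
    nonnegative; at least half of \<open>norm a\<close>, so that \<open>nonneg_norm_le\<close>
    applies to \<open>a\<close>; and still below \<open>norm a\<close>.\<close>
  define \<gamma> where "\<gamma> = max \<beta> (norm a / 2)"
  have \<gamma>: "\<beta> \<le> \<gamma>" "norm a / 2 \<le> \<gamma>" "\<gamma> < norm a"
    using lt assms(3) by (auto simp: \<gamma>_def max_def)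
  have "nonneg ((of_real \<beta> - a) + of_real (\<gamma> - \<beta>))"
    using assms \<gamma> by (intro nonneg_add nonneg_of_real) auto
  then have "nonneg (of_real \<gamma> - a)" by (simp add: algebra_simps)
  moreover have "norm (of_real \<gamma> - a) \<le> \<gamma>"
    using nonneg_norm_le[OF assms(1)] \<gamma> by blast
  ultimately have "norm (of_real \<gamma> - (of_real \<gamma> - a)) \<le> \<gamma>"
    using \<gamma> by (intro nonneg_norm_le) (auto simp: field_simps intro: order_trans[of _ \<gamma>])
  then show False using \<gamma> by simp
qed

lemma nonneg_norm_mono:
  assumes "nonneg a" "nonneg (b - a)"
  shows "norm (a::'a::cstar_algebra_1) \<le> norm b"
proof (rule nonneg_norm_bound)
  have "nonneg (a + (b - a))" using assms by (rule nonneg_add)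
  then have "star b = b" by (simp add: nonneg_def)
  then have "nonneg ((b - a) + (of_real (norm b) - b))"
    using assms(2) by (intro nonneg_add nonneg_norm_diff)
  then show "nonneg (of_real (norm b) - a)" by simp
qed (use assms in auto)

text \<open>If \<open>c\<^sup>* c \<le> 0 \<le> c c\<^sup>*\<close> then comparing the norms of \<open>(t + c c\<^sup>*) c = c (t + c\<^sup>* c)\<close> for
  \<open>t = \<parallel>c\<parallel>\<^sup>2 / 2\<close> gives \<open>c = 0\<close>.\<close>

lemma nonneg_minus_star_mult_eq_0:
  assumes neg: "nonneg (- (star c * c))"
  shows "(c::'a::cstar_algebra_1) = 0"
proof -
  \<comment> \<open>\<open>x\<close> and \<open>y\<close> are the real and imaginary parts of
    \<open>c\<close>, so that \<open>star c * c + c * star c\<close> is twice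
    \<open>x * x + y * y\<close>. Adding the nonnegative \<open>- (star c * c)\<close> shows that
    \<open>v\<close> is nonnegative.\<close>
  define x where "x = (1/2) *\<^sub>R (c + star c)"
  define d where "d = star c - c"
  define y where "y = (\<i> / 2) *\<^sub>C d"
  define v where "v = c * star c"
  define t where "t = (norm c)\<^sup>2 / 2"
  have "star d = - d" by (simp add: d_def star_diff star_star)
  then have sx: "star x = x" "star y = y"
    by (simp_all add: x_def y_def star_scaleR star_add star_star star_scaleC
        scaleC_minus_left scaleC_minus_right add.commute)
  have "y * y = - ((1/4) *\<^sub>R (d * d))"
    by (simp add: y_def mult_scaleC_left mult_scaleC_right scaleC_scaleC scaleR_scaleC scaleC_minus_left)
  then have "x * x + y * y = (1/4) *\<^sub>R ((c + star c) * (c + star c) - d * d)"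
    by (simp add: x_def scaleR_diff_right)
  also have "(c + star c) * (c + star c) - d * d = 2 *\<^sub>R (star c * c + v)"
    by (simp add: v_def d_def algebra_simps scaleR_2)
  finally have "v = 2 *\<^sub>R (x * x + y * y) + - (star c * c)"
    by (simp add: algebra_simps)
  moreover have "nonneg (2 *\<^sub>R (x * x + y * y) + - (star c * c))"
    using sx neg by (intro nonneg_add nonneg_scaleR nonneg_square) auto
  ultimately have v: "nonneg v" by simp
  have nv: "norm v = (norm c)\<^sup>2"
    using cstar_identity[of "star c"] by (simp add: v_def star_star)
  have "norm (of_real t - - (star c * c)) \<le> t"
    by (rule nonneg_norm_le[OF neg]) (simp add: cstar_identity t_def)
  \<comment> \<open>The factor \<open>star c\<close> on the right turns the product into
    \<open>v * v + t *\<^sub>R v\<close>, whose norm is at least that of \<open>v * v\<close>, the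
    fourth power of \<open>norm c\<close>. The bound \<open>norm c * t * norm c\<close> is only half
    of this.\<close>
  then have "norm (c * (of_real t + star c * c) * star c) \<le> norm c * t * norm c"
    by (intro order_trans[OF norm_mult_ineq] mult_mono) (auto intro: order_trans[OF norm_mult_ineq] mult_left_mono simp: t_def)
  moreover have "c * (of_real t + star c * c) * star c = v * v + t *\<^sub>R v"
    by (simp add: v_def algebra_simps of_real_def)
  moreover have "norm (v * v) \<le> norm (v * v + t *\<^sub>R v)"
  proof (rule nonneg_norm_mono)
    show "nonneg (v * v)" using v by (simp add: nonneg_square nonnegD)
    show "nonneg (v * v + t *\<^sub>R v - v * v)" using v by (simp add: nonneg_scaleR t_def)
  qed
  moreover have "norm (v * v) = (norm v)\<^sup>2"
    using v by (simp add: cstar_identity_selfadjoint nonnegD)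
  ultimately have "(norm c)\<^sup>2 * (norm c)\<^sup>2 \<le> ((norm c)\<^sup>2 * (norm c)\<^sup>2) / 2"
    unfolding nv t_def by (simp add: power2_eq_square mult.assoc mult.commute mult.left_commute)
  then have "(norm c)\<^sup>2 * (norm c)\<^sup>2 \<le> 0" by simp
  then show ?thesis by (simp add: mult_le_0_iff)
qed

text \<open>With \<open>a = b\<^sup>* b\<close> and \<open>k = \<bar>a\<bar> - a\<close>, the element \<open>c = b k\<close> satisfies
  \<open>c\<^sup>* c = - \<bar>a\<bar> k\<^sup>2 \<le> 0\<close>.\<close>

lemma nonneg_star_mult: "nonneg (star b * b :: 'a::cstar_algebra_1)"
proof -
  define a where "a = star b * b"
  have sa: "star a = a" by (simp add: a_def star_mult star_star)
  obtain m where m: "star m = m" "m * m = a * a" "nonneg m" "\<And>x. x * (a * a) = (a * a) * x \<Longrightarrow> x * m = m * x"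
    using nonneg_sqrt[OF nonneg_square[OF sa]] by metis
  have am: "a * m = m * a" using m(4)[of a] by (simp add: mult.assoc)
  obtain e where e: "star e = e" "e * e = m" "\<And>x. x * m = m * x \<Longrightarrow> x * e = e * x"
    using nonneg_sqrt[OF m(3)] by metis
  define k where "k = m - a"
  have sk: "star k = k" by (simp add: k_def star_diff m sa)
  have "k * m = m * k" by (simp add: k_def algebra_simps am)
  then have ke: "k * e = e * k" by (rule e(3))
  have ak: "a * k = - (m * k)" by (simp add: k_def algebra_simps am m(2))
  have "star (b * k) * (b * k) = k * (a * k)"
    by (simp add: star_mult sk a_def mult.assoc)
  also have "\<dots> = - ((e * k) * (e * k))"
    by (metis ak e(2) ke mult.assoc mult_minus_right)
  finally have "nonneg (- (star (b * k) * (b * k)))"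
    using nonneg_square[of "e * k"] by (simp add: star_mult e(1) sk ke)
  then have "b * k = 0" by (rule nonneg_minus_star_mult_eq_0)
  then have "a * k = 0" by (simp add: a_def mult.assoc)
  \<comment> \<open>\<open>m * k\<close> vanishes together with \<open>a * k\<close>, and
    \<open>k * k\<close> is their difference.\<close>
  then have "k * k = 0" using ak by (simp add: k_def left_diff_distrib)
  then have "k = 0" using cstar_identity_selfadjoint[OF sk] by simp
  then show ?thesis using m(3) by (simp add: k_def a_def)
qed

subsection \<open>Unitization\<close>

datatype 'a unitization = Unitization (elt: 'a) (scal: complex)

text \<open>Left multiplication by \<open>u\<close> on the original algebra, which is an ideal of
  the unitization.\<close>

definition mulop :: "'a::cstar_algebra unitization \<Rightarrow> 'a \<Rightarrow> 'a" where
  "mulop u y = elt u * y + scal u *\<^sub>C y"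

lemma bounded_linear_mulop: "bounded_linear (mulop u)"
  unfolding mulop_def
  by (intro bounded_linear_add bounded_linear_mult_right bounded_linear_scaleC)

text \<open>The multiplication operators alone do not give a norm when the algebra already has a unit.\<close>

instantiation unitization :: (cstar_algebra) "{scaleC, star, real_normed_algebra_1}"
begin

definition "0 = Unitization 0 0"
definition "1 = Unitization 0 1"
definition "u + v = Unitization (elt u + elt v) (scal u + scal v)"
definition "u - v = Unitization (elt u - elt v) (scal u - scal v)"
definition "- u = Unitization (- elt u) (- scal u)"
definition "u * v = Unitization (elt u * elt v + scal v *\<^sub>C elt u + scal u *\<^sub>C elt v) (scal u * scal v)"
definition "r *\<^sub>R u = Unitization (r *\<^sub>R elt u) (complex_of_real r * scal u)"
definition "c *\<^sub>C u = Unitization (c *\<^sub>C elt u) (c * scal u)"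
definition "star u = Unitization (star (elt u)) (cnj (scal u))"
definition "norm u = max (onorm (mulop u)) (cmod (scal u))"
definition "sgn (u::'a unitization) = inverse (norm u) *\<^sub>R u"
definition "dist (u::'a unitization) v = norm (u - v)"
definition [code del]:
  "(uniformity :: ('a unitization \<times> 'a unitization) filter) =
    (INF e\<in>{0<..}. principal {(x, y). dist x y < e})"
definition open_unitization_def [code del]:
  "open (U :: 'a unitization set) \<longleftrightarrow> (\<forall>x\<in>U. \<forall>\<^sub>F (x', y) in uniformity. x' = x \<longrightarrow> y \<in> U)"

lemmas unitization_defs = zero_unitization_def one_unitization_def plus_unitization_def
  minus_unitization_def uminus_unitization_def times_unitization_def scaleR_unitization_def
  scaleC_unitization_def star_unitization_def

lemma norm_unitization_le_iff:
  "0 \<le> C \<Longrightarrow> norm (u::'a unitization) \<le> C \<longleftrightarrow> (\<forall>y. norm (mulop u y) \<le> C * norm y) \<and> cmod (scal u) \<le> C"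
  using onorm[OF bounded_linear_mulop[of u]] onorm_bound[of C "mulop u"]
  unfolding norm_unitization_def
  by auto (meson mult_right_mono norm_ge_zero order_trans)

lemma norm_unitization_ge_0: "0 \<le> norm (u::'a unitization)"
  unfolding norm_unitization_def by (meson max.coboundedI2 norm_ge_zero)

lemma norm_mulop: "norm (mulop u y) \<le> norm (u::'a unitization) * norm y"
  using norm_unitization_le_iff[OF norm_unitization_ge_0, of u u] by blast

lemma cmod_scal: "cmod (scal u) \<le> norm (u::'a unitization)"
  using norm_unitization_le_iff[OF norm_unitization_ge_0, of u u] by blast

lemma mulop_simps:
  "mulop (u + v) y = mulop u y + mulop v y"
  "mulop (u * v) y = mulop u (mulop v y)"
  "mulop (c *\<^sub>C u) y = c *\<^sub>C mulop u y"
  "mulop (r *\<^sub>R u) y = r *\<^sub>R mulop u y"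
  by (simp_all add: mulop_def unitization_defs algebra_simps scaleC_add_left scaleC_add_right
      mult_scaleC_left mult_scaleC_right scaleC_scaleC scaleR_scaleC)

text \<open>For the algebra-valued inner product \<open>star y * z\<close>, multiplication by
  \<open>star u\<close> is the adjoint of multiplication by \<open>u\<close>. The C*-identity for
  the operator norm comes from this.\<close>

lemma star_mulop: "star y * mulop (star u) z = star (mulop u y) * z"
  by (simp add: mulop_def unitization_defs algebra_simps star_add star_mult star_scaleC
      mult_scaleC_left mult_scaleC_right)

lemma norm_mult_unitization: "norm (u * v) \<le> norm u * norm (v::'a unitization)"
proof (subst norm_unitization_le_iff)
  show "(\<forall>y. norm (mulop (u * v) y) \<le> norm u * norm v * norm y) \<and> cmod (scal (u * v)) \<le> norm u * norm v"
  proof (intro conjI allI)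
    fix y
    show "norm (mulop (u * v) y) \<le> norm u * norm v * norm y"
      unfolding mulop_simps mult.assoc
      by (intro order_trans[OF norm_mulop] mult_left_mono norm_mulop norm_unitization_ge_0)
    show "cmod (scal (u * v)) \<le> norm u * norm v"
      by (auto simp: unitization_defs norm_mult intro!: mult_mono cmod_scal norm_unitization_ge_0)
  qed
qed (simp add: norm_unitization_ge_0)

lemma norm_star_mult_unitization: "(norm u)\<^sup>2 \<le> norm (star u * u :: 'a unitization)"
proof -
  have "norm u \<le> sqrt (norm (star u * u))"
  proof (subst norm_unitization_le_iff, intro real_sqrt_ge_zero norm_unitization_ge_0, intro conjI allI)
    fix y
    have "(norm (mulop u y))\<^sup>2 = norm (star y * mulop (star u * u) y)"
      by (simp add: mulop_simps star_mulop cstar_identity)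
    also have "\<dots> \<le> norm y * (norm (star u * u) * norm y)"
      by (intro order_trans[OF norm_mult_ineq] mult_mono) (simp_all add: norm_mulop)
    also have "\<dots> = (sqrt (norm (star u * u)) * norm y)\<^sup>2"
      by (simp add: power_mult_distrib norm_unitization_ge_0 power2_eq_square)
    finally show "norm (mulop u y) \<le> sqrt (norm (star u * u)) * norm y"
      by (rule power2_le_imp_le) (simp add: norm_unitization_ge_0)
    have "(cmod (scal u))\<^sup>2 = cmod (scal (star u * u))"
      by (simp add: unitization_defs norm_mult power2_eq_square)
    also have "\<dots> \<le> norm (star u * u)" by (rule cmod_scal)
    finally show "cmod (scal u) \<le> sqrt (norm (star u * u))"
      by (rule real_le_rsqrt)
  qed
  then have "(norm u)\<^sup>2 \<le> (sqrt (norm (star u * u)))\<^sup>2"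
    by (intro power_mono norm_unitization_ge_0)
  then show ?thesis by (simp add: norm_unitization_ge_0)
qed

lemma norm_scaleC_unitization: "norm (c *\<^sub>C u) = cmod c * norm (u :: 'a unitization)"
proof -
  have le: "norm (c *\<^sub>C u) \<le> cmod c * norm u" for c and u :: "'a unitization"
  proof (subst norm_unitization_le_iff)
    show "(\<forall>y. norm (mulop (c *\<^sub>C u) y) \<le> cmod c * norm u * norm y) \<and> cmod (scal (c *\<^sub>C u)) \<le> cmod c * norm u"
      unfolding mulop_simps Defs.norm_scaleC mult.assoc
      by (auto simp: unitization_defs norm_mult intro!: mult_left_mono norm_mulop cmod_scal)
  qed (simp add: norm_unitization_ge_0)
  show ?thesis
  proof (cases "c = 0")
    case True
    then show ?thesis using le[of 0 u] norm_unitization_ge_0[of "0 *\<^sub>C u"] by simp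
  next
    case False
    have "norm (inverse c *\<^sub>C (c *\<^sub>C u)) \<le> cmod (inverse c) * norm (c *\<^sub>C u)" by (rule le)
    moreover have "inverse c *\<^sub>C (c *\<^sub>C u) = u"
      using False by (cases u) (simp add: unitization_defs scaleC_scaleC scaleC_one)
    ultimately have "cmod c * norm u \<le> cmod c * (inverse (cmod c) * norm (c *\<^sub>C u))"
      by (intro mult_left_mono) (simp_all add: norm_inverse)
    also have "\<dots> = norm (c *\<^sub>C u)" using False by simp
    finally show ?thesis using le[of c u] by (rule antisym[rotated])
  qed
qed

instance
proof
  fix u v w :: "'a unitization" and r s :: real
  show "u + v + w = u + (v + w)" "u + v = v + u" "0 + u = u" "- u + u = 0" "u - v = u + - v"
    "r *\<^sub>R (u + v) = r *\<^sub>R u + r *\<^sub>R v" "(r + s) *\<^sub>R u = r *\<^sub>R u + s *\<^sub>R u"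
    "r *\<^sub>R s *\<^sub>R u = (r * s) *\<^sub>R u" "1 *\<^sub>R u = u"
    by (simp_all add: unitization_defs algebra_simps)
  show "u * v * w = u * (v * w)" "(u + v) * w = u * w + v * w" "u * (v + w) = u * v + u * w"
    "r *\<^sub>R u * v = r *\<^sub>R (u * v)" "u * r *\<^sub>R v = r *\<^sub>R (u * v)" "1 * u = u" "u * 1 = u"
    by (simp_all add: unitization_defs algebra_simps scaleR_scaleC scaleC_add_right scaleC_add_left
        scaleC_scaleC scaleC_one mult_scaleC_left mult_scaleC_right star_star star_add star_scaleC
        star_mult scaleR_conv_of_real)
  show "(0::'a unitization) \<noteq> 1" by (simp add: unitization_defs)
  show "dist u v = norm (u - v)" "sgn u = inverse (norm u) *\<^sub>R u"
    "(uniformity :: ('a unitization \<times> 'a unitization) filter) = (INF e\<in>{0<..}. principal {(x, y). dist x y < e})"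
    by (simp_all add: dist_unitization_def sgn_unitization_def uniformity_unitization_def)
  show "open U \<longleftrightarrow> (\<forall>x\<in>U. \<forall>\<^sub>F (x', y) in uniformity. x' = x \<longrightarrow> y \<in> U)" for U :: "'a unitization set"
    by (rule open_unitization_def)
  show "norm u = 0 \<longleftrightarrow> u = 0"
  proof
    assume "norm u = 0"
    then have "scal u = 0" "mulop u (star (elt u)) = 0"
      using cmod_scal[of u] norm_mulop[of u "star (elt u)"] by auto
    then have "norm (elt u * star (elt u)) = 0" by (simp add: mulop_def)
    then have "elt u = 0" using cstar_identity[of "star (elt u)"] by (simp add: star_star)
    with \<open>scal u = 0\<close> show "u = 0" by (cases u) (simp add: unitization_defs)
  next
    assume "u = 0"
    then have "norm u \<le> 0"
      by (subst norm_unitization_le_iff) (simp_all add: unitization_defs mulop_def)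
    then show "norm u = 0" using norm_unitization_ge_0[of u] by simp
  qed
  show "norm (u + v) \<le> norm u + norm v"
  proof (subst norm_unitization_le_iff)
    show "(\<forall>y. norm (mulop (u + v) y) \<le> (norm u + norm v) * norm y) \<and> cmod (scal (u + v)) \<le> norm u + norm v"
      unfolding mulop_simps distrib_right
      by (auto simp: unitization_defs intro!: order_trans[OF norm_triangle_ineq] add_mono norm_mulop cmod_scal)
  qed (simp add: norm_unitization_ge_0)
  have "r *\<^sub>R u = complex_of_real r *\<^sub>C u" by (simp add: unitization_defs scaleR_scaleC scaleR_conv_of_real)
  then show "norm (r *\<^sub>R u) = \<bar>r\<bar> * norm u" by (simp add: norm_scaleC_unitization)
  show "norm (u * v) \<le> norm u * norm v" by (rule norm_mult_unitization)
  show "norm (1::'a unitization) = 1"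
  proof (rule antisym)
    show "norm (1::'a unitization) \<le> 1"
      by (subst norm_unitization_le_iff) (simp_all add: unitization_defs mulop_def scaleC_one)
    show "1 \<le> norm (1::'a unitization)"
      using cmod_scal[of "1::'a unitization"] by (simp add: unitization_defs)
  qed
qed

end

instance unitization :: (cstar_algebra) banach
proof
  fix X :: "nat \<Rightarrow> 'a unitization"
  assume X: "Cauchy X"
  \<comment> \<open>Completeness is inherited componentwise, so the norm has to control
    \<open>elt u\<close> as well. The factor 2 arises because \<open>elt u * y\<close> is
    \<open>mulop u y\<close> minus \<open>scal u *\<^sub>C y\<close>, each at most
    \<open>norm u * norm y\<close>; the test vector is \<open>star (elt u)\<close>.\<close>
  have elt_le: "norm (elt u) \<le> 2 * norm u" for u :: "'a unitization"
  proof (cases "elt u = 0")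
    case False
    have "norm (elt u) * norm (elt u) = norm (elt u * star (elt u))"
      using cstar_identity[of "star (elt u)"] by (simp add: star_star power2_eq_square)
    also have "\<dots> = norm (mulop u (star (elt u)) - scal u *\<^sub>C star (elt u))"
      by (simp add: mulop_def)
    also have "\<dots> \<le> norm u * norm (elt u) + norm u * norm (elt u)"
      using norm_mulop[of u "star (elt u)"] mult_right_mono[OF cmod_scal[of u], of "norm (elt u)"]
      by (intro order_trans[OF norm_triangle_ineq4] add_mono) (simp_all add: norm_scaleC)
    finally show ?thesis using False by simp
  qed (use norm_unitization_ge_0[of u] in simp)
  have dist: "dist u v = norm (u - v)" "elt (u - v) = elt u - elt v" "scal (u - v) = scal u - scal v"
    for u v :: "'a unitization"
    by (simp_all add: unitization_defs dist_unitization_def)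
  have "Cauchy (\<lambda>n. elt (X n))"
  proof (rule metric_CauchyI)
    fix e :: real assume "0 < e"
    then obtain M where M: "\<And>m n. m \<ge> M \<Longrightarrow> n \<ge> M \<Longrightarrow> dist (X m) (X n) < e / 2"
      using metric_CauchyD[OF X, of "e / 2"] by auto
    have "dist (elt (X m)) (elt (X n)) < e" if "m \<ge> M" "n \<ge> M" for m n
      using M[OF that] elt_le[of "X m - X n"] by (simp add: dist dist_norm)
    then show "\<exists>M. \<forall>m\<ge>M. \<forall>n\<ge>M. dist (elt (X m)) (elt (X n)) < e" by blast
  qed
  moreover have "Cauchy (\<lambda>n. scal (X n))"
  proof (rule metric_CauchyI)
    fix e :: real assume "0 < e"
    then obtain M where M: "\<And>m n. m \<ge> M \<Longrightarrow> n \<ge> M \<Longrightarrow> dist (X m) (X n) < e"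
      using metric_CauchyD[OF X] by blast
    have "dist (scal (X m)) (scal (X n)) < e" if "m \<ge> M" "n \<ge> M" for m n
      using M[OF that] cmod_scal[of "X m - X n"] by (simp add: dist dist_norm)
    then show "\<exists>M. \<forall>m\<ge>M. \<forall>n\<ge>M. dist (scal (X m)) (scal (X n)) < e" by blast
  qed
  ultimately obtain a l where lim: "(\<lambda>n. elt (X n)) \<longlonglongrightarrow> a" "(\<lambda>n. scal (X n)) \<longlonglongrightarrow> l"
    by (auto simp: Cauchy_convergent_iff convergent_def)
  have le: "norm u \<le> norm (elt u) + cmod (scal u)" for u :: "'a unitization"
    by (subst norm_unitization_le_iff)
      (auto simp: mulop_def distrib_right norm_scaleC
        intro!: order_trans[OF norm_triangle_ineq] add_mono norm_mult_ineq)
  have "(\<lambda>n. norm (elt (X n) - a) + cmod (scal (X n) - l)) \<longlonglongrightarrow> norm (a - a) + cmod (l - l)"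
    by (intro tendsto_intros lim)
  then have lim0: "(\<lambda>n. norm (elt (X n) - a) + cmod (scal (X n) - l)) \<longlonglongrightarrow> 0" by simp
  have "X \<longlonglongrightarrow> Unitization a l"
  proof (rule metric_tendsto_imp_tendsto[OF lim0], rule always_eventually, rule allI)
    fix n
    show "dist (X n) (Unitization a l) \<le> dist (norm (elt (X n) - a) + cmod (scal (X n) - l)) 0"
      using le[of "X n - Unitization a l"] by (simp add: dist)
  qed
  then show "convergent X" by (rule convergentI)
qed

instance unitization :: (cstar_algebra) cstar_algebra_1
proof
  fix u v w :: "'a unitization" and r :: real and c d :: complex
  show "r *\<^sub>R u = complex_of_real r *\<^sub>C u"
    "c *\<^sub>C (u + v) = c *\<^sub>C u + c *\<^sub>C v" "(c + d) *\<^sub>C u = c *\<^sub>C u + d *\<^sub>C u"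
    "c *\<^sub>C (d *\<^sub>C u) = (c * d) *\<^sub>C u" "1 *\<^sub>C u = u"
    "(c *\<^sub>C u) * v = c *\<^sub>C (u * v)" "u * (c *\<^sub>C v) = c *\<^sub>C (u * v)"
    "star (star u) = u" "star (u + v) = star u + star v" "star (c *\<^sub>C u) = cnj c *\<^sub>C star u"
    "star (u * v) = star v * star u"
    by (simp_all add: unitization_defs algebra_simps scaleR_scaleC scaleC_add_right scaleC_add_left
        scaleC_scaleC scaleC_one mult_scaleC_left mult_scaleC_right star_star star_add star_scaleC
        star_mult scaleR_conv_of_real)
  show "norm (c *\<^sub>C u) = cmod c * norm u" by (rule norm_scaleC_unitization)
  show "norm (star u * u) = (norm u)\<^sup>2"
  proof -
    have le: "norm u \<le> norm (star u)" for u :: "'a unitization"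
      using order_trans[OF norm_star_mult_unitization norm_mult_unitization, of u]
        norm_unitization_ge_0[of u] norm_unitization_ge_0[of "star u"]
      by (cases "norm u = 0") (auto simp: power2_eq_square)
    have "star (star u) = u" by (cases u) (simp add: unitization_defs star_star)
    then have "norm (star u) = norm u" using le[of u] le[of "star u"] by simp
    then show ?thesis
      using norm_star_mult_unitization[of u] norm_mult_unitization[of "star u" u]
      by (simp add: power2_eq_square)
  qed
qed

lemma embed_simps:
  "Unitization (a + b) 0 = Unitization a 0 + Unitization b 0"
  "Unitization (a - b) 0 = Unitization a 0 - Unitization b 0"
  "Unitization (a * b) 0 = Unitization a 0 * Unitization (b::'a::cstar_algebra) 0"
  "Unitization (r *\<^sub>R a) 0 = r *\<^sub>R Unitization a 0"
  "Unitization (star a) 0 = star (Unitization a 0)"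
  by (simp_all add: unitization_defs)

lemma norm_embed [simp]: "norm (Unitization a 0) = norm (a::'a::cstar_algebra)"
proof (rule antisym)
  show "norm (Unitization a 0) \<le> norm a"
    by (subst norm_unitization_le_iff) (simp_all add: mulop_def norm_mult_ineq)
  have "norm a * norm a = norm (mulop (Unitization a 0) (star a))"
    using cstar_identity[of "star a"] by (simp add: mulop_def star_star power2_eq_square)
  then have "norm a * norm a \<le> norm (Unitization a 0) * norm a"
    using norm_mulop[of "Unitization a 0" "star a"] by simp
  then show "norm a \<le> norm (Unitization a 0)"
    by (cases "a = 0") simp_all
qed

lemma tendsto_embed:
  "(X \<longlongrightarrow> (a::'a::cstar_algebra)) F \<Longrightarrow> ((\<lambda>i. Unitization (X i) 0) \<longlongrightarrow> Unitization a 0) F"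
  unfolding tendsto_iff dist_norm embed_simps(2)[symmetric] norm_embed .

text \<open>The scalar part is multiplicative, so a square root of an embedded element has scalar
  part 0 and already lies in the original algebra.\<close>

lemma cs_positive_iff_nonneg: "cs_positive a \<longleftrightarrow> nonneg (Unitization (a::'a::cstar_algebra) 0)"
proof
  assume "cs_positive a"
  then show "nonneg (Unitization a 0)"
    by (auto simp: cs_positive_def embed_simps nonneg_star_mult)
next
  assume "nonneg (Unitization a 0)"
  then obtain c where c: "star c = c" "c * c = Unitization a 0"
    using nonneg_sqrt by blast
  then have "scal c * scal c = 0" by (metis times_unitization_def unitization.sel(2))
  then have "scal c = 0" by simp
  then have "star (elt c) = elt c \<and> elt c * elt c = a"
    using c by (cases c) (simp add: unitization_defs)
  then show "cs_positive a" unfolding cs_positive_def by metis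
qed

subsection \<open>The positive cone\<close>

lemma cs_positive_star_mult [simp]: "cs_positive (star b * b)"
  by (auto simp: cs_positive_def)

lemma cs_positive_zero [simp]: "cs_positive (0::'a::cstar_algebra)"
  using cs_positive_star_mult[of "0::'a"] by simp

lemma cs_positive_add: "cs_positive a \<Longrightarrow> cs_positive b \<Longrightarrow> cs_positive (a + b)"
  by (simp add: cs_positive_iff_nonneg embed_simps nonneg_add)

lemma cs_positive_sum: "(\<And>i. i \<in> I \<Longrightarrow> cs_positive (f i)) \<Longrightarrow> cs_positive (\<Sum>i\<in>I. f i)"
  by (induction I rule: infinite_finite_induct) (simp_all add: cs_positive_add)

lemma cs_positive_scaleR: "cs_positive a \<Longrightarrow> 0 \<le> r \<Longrightarrow> cs_positive (r *\<^sub>R a)"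
  by (simp add: cs_positive_iff_nonneg embed_simps nonneg_scaleR)

lemma cs_positive_star: "cs_positive a \<Longrightarrow> star a = a"
  by (auto simp: cs_positive_def star_mult star_star)

lemma cs_positive_tendsto:
  assumes "(X \<longlongrightarrow> a) F" "\<forall>\<^sub>F i in F. cs_positive (X i)" "F \<noteq> bot"
  shows "cs_positive a"
  using nonneg_tendsto[OF tendsto_embed[OF assms(1)]] assms(2,3)
  by (simp add: cs_positive_iff_nonneg)

lemma cs_positive_norm_mono: "cs_positive a \<Longrightarrow> cs_positive (b - a) \<Longrightarrow> norm a \<le> norm b"
  using nonneg_norm_mono[of "Unitization a 0" "Unitization b 0"]
  by (simp add: cs_positive_iff_nonneg embed_simps)

text \<open>In the unitization \<open>1 - p\<close> has a self-adjoint square root \<open>d\<close>,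
  and the difference is \<open>star (d * w) * (d * w)\<close>. This operator inequality is the core
  of the Cauchy-Schwarz inequality for modules.\<close>

lemma cs_positive_conj_diff:
  assumes "cs_positive p" "norm p \<le> 1"
  shows "cs_positive (star w * w - star w * p * w)"
proof -
  have "nonneg (of_real (norm (Unitization p 0)) - Unitization p 0)"
    using assms by (intro nonneg_norm_diff) (simp add: cs_positive_iff_nonneg nonnegD)
  then have "nonneg ((of_real (norm p) - Unitization p 0) + of_real (1 - norm p))"
    using assms by (intro nonneg_add nonneg_of_real) auto
  then have "nonneg (1 - Unitization p 0)" by (simp add: algebra_simps)
  then obtain d where d: "star d = d" "d * d = 1 - Unitization p 0"
    using nonneg_sqrt by blast
  let ?w = "Unitization w 0"
  have "star (d * ?w) * (d * ?w) = star ?w * (d * d) * ?w"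
    by (simp add: star_mult d(1) mult.assoc)
  also have "\<dots> = Unitization (star w * w - star w * p * w) 0"
    by (simp add: d(2) embed_simps algebra_simps)
  finally show ?thesis
    unfolding cs_positive_iff_nonneg by (metis nonneg_star_mult)
qed

section \<open>Semi-inner product modules\<close>

text \<open>The axioms of a Hilbert module without definiteness and completeness.\<close>

locale sip_module =
  fixes E :: "('b::cstar_algebra, 'e) rmod"
  assumes zero_in [simp]: "mzero E \<in> mcar E"
    and add_in [simp]: "\<lbrakk>x \<in> mcar E; y \<in> mcar E\<rbrakk> \<Longrightarrow> madd E x y \<in> mcar E"
    and scale_in [simp]: "x \<in> mcar E \<Longrightarrow> mscale E c x \<in> mcar E"
    and act_in [simp]: "x \<in> mcar E \<Longrightarrow> mact E x b \<in> mcar E"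
    and madd_assoc: "\<lbrakk>x \<in> mcar E; y \<in> mcar E; z \<in> mcar E\<rbrakk>
      \<Longrightarrow> madd E (madd E x y) z = madd E x (madd E y z)"
    and madd_commute: "\<lbrakk>x \<in> mcar E; y \<in> mcar E\<rbrakk> \<Longrightarrow> madd E x y = madd E y x"
    and madd_zero: "x \<in> mcar E \<Longrightarrow> madd E x (mzero E) = x"
    and madd_neg: "x \<in> mcar E \<Longrightarrow> madd E x (mscale E (-1) x) = mzero E"
    and mscale_add_right: "\<lbrakk>x \<in> mcar E; y \<in> mcar E\<rbrakk>
      \<Longrightarrow> mscale E c (madd E x y) = madd E (mscale E c x) (mscale E c y)"
    and mscale_add_left: "x \<in> mcar E
      \<Longrightarrow> mscale E (c + d) x = madd E (mscale E c x) (mscale E d x)"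
    and mscale_scale: "x \<in> mcar E \<Longrightarrow> mscale E c (mscale E d x) = mscale E (c * d) x"
    and mscale_one: "x \<in> mcar E \<Longrightarrow> mscale E 1 x = x"
    and mact_add_left: "\<lbrakk>x \<in> mcar E; y \<in> mcar E\<rbrakk>
      \<Longrightarrow> mact E (madd E x y) b = madd E (mact E x b) (mact E y b)"
    and mact_add_right: "x \<in> mcar E \<Longrightarrow> mact E x (a + b) = madd E (mact E x a) (mact E x b)"
    and mact_mult: "x \<in> mcar E \<Longrightarrow> mact E x (a * b) = mact E (mact E x a) b"
    and mact_scale_left: "x \<in> mcar E \<Longrightarrow> mact E (mscale E c x) b = mscale E c (mact E x b)"
    and mact_scale_right: "x \<in> mcar E \<Longrightarrow> mact E x (c *\<^sub>C b) = mscale E c (mact E x b)"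
    and mip_add: "\<lbrakk>x \<in> mcar E; y \<in> mcar E; z \<in> mcar E\<rbrakk>
      \<Longrightarrow> mip E x (madd E y z) = mip E x y + mip E x z"
    and mip_scale: "\<lbrakk>x \<in> mcar E; y \<in> mcar E\<rbrakk> \<Longrightarrow> mip E x (mscale E c y) = c *\<^sub>C mip E x y"
    and mip_act: "\<lbrakk>x \<in> mcar E; y \<in> mcar E\<rbrakk> \<Longrightarrow> mip E x (mact E y b) = mip E x y * b"
    and mip_star: "\<lbrakk>x \<in> mcar E; y \<in> mcar E\<rbrakk> \<Longrightarrow> star (mip E x y) = mip E y x"
    and mip_positive: "x \<in> mcar E \<Longrightarrow> cs_positive (mip E x x)"
begin

lemma mip_add_left:
  "\<lbrakk>x \<in> mcar E; y \<in> mcar E; z \<in> mcar E\<rbrakk> \<Longrightarrow> mip E (madd E x y) z = mip E x z + mip E y z"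
  using mip_star[of z "madd E x y"] by (simp add: mip_add star_add mip_star)

lemma mip_scale_left:
  "\<lbrakk>x \<in> mcar E; y \<in> mcar E\<rbrakk> \<Longrightarrow> mip E (mscale E c x) y = cnj c *\<^sub>C mip E x y"
  using mip_star[of y "mscale E c x"] by (simp add: mip_scale star_scaleC mip_star)

lemma mip_act_left:
  "\<lbrakk>x \<in> mcar E; y \<in> mcar E\<rbrakk> \<Longrightarrow> mip E (mact E x b) y = star b * mip E x y"
  using mip_star[of y "mact E x b"] by (simp add: mip_act star_mult mip_star)

lemma mip_zero_right [simp]: "x \<in> mcar E \<Longrightarrow> mip E x (mzero E) = 0"
  using mip_add[of x "mzero E" "mzero E"] by (simp add: madd_zero)

lemma mip_zero_left [simp]: "x \<in> mcar E \<Longrightarrow> mip E (mzero E) x = 0"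
  using mip_star[of x "mzero E"] by simp

lemma mdiff_in [simp]: "\<lbrakk>x \<in> mcar E; y \<in> mcar E\<rbrakk> \<Longrightarrow> mdiff E x y \<in> mcar E"
  by (simp add: mdiff_def)

lemma mip_diff:
  "\<lbrakk>x \<in> mcar E; y \<in> mcar E; z \<in> mcar E\<rbrakk> \<Longrightarrow> mip E z (mdiff E x y) = mip E z x - mip E z y"
  by (simp add: mdiff_def mip_add mip_scale scaleC_minus_one)

lemma mip_diff_left:
  "\<lbrakk>x \<in> mcar E; y \<in> mcar E; z \<in> mcar E\<rbrakk> \<Longrightarrow> mip E (mdiff E x y) z = mip E x z - mip E y z"
  by (simp add: mdiff_def mip_add_left mip_scale_left scaleC_minus_one)

lemmas mip_simps = mip_add mip_add_left mip_scale mip_scale_left mip_act mip_act_left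
  mip_diff mip_diff_left

lemma mdiff_eq_zeroD:
  assumes "x \<in> mcar E" "y \<in> mcar E" "mdiff E x y = mzero E"
  shows "x = y"
proof -
  have "x = madd E x (madd E (mscale E (-1) y) y)"
    using assms by (simp add: madd_zero madd_neg madd_commute[of "mscale E (-1) y"])
  also have "\<dots> = madd E (mdiff E x y) y"
    unfolding mdiff_def using assms(1,2) by (simp add: madd_assoc)
  also have "\<dots> = y"
    using assms by (simp add: madd_zero madd_commute[of "mzero E"])
  finally show ?thesis .
qed

lemma mnorm_ge_0 [simp]: "0 \<le> mnorm E x"
  by (simp add: mnorm_def)

lemma mnorm_power2: "(mnorm E x)\<^sup>2 = norm (mip E x x)"
  by (simp add: mnorm_def)

lemma mnorm_cong: "mip E x x = mip E y y \<Longrightarrow> mnorm E x = mnorm E y"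
  by (simp add: mnorm_def)

text \<open>Positivity of \<open>\<langle>z, z\<rangle>\<close> for \<open>z = x w / s - y\<close> with \<open>w = \<langle>x, y\<rangle>\<close> and \<open>s \<ge> \<parallel>\<langle>x, x\<rangle>\<parallel>\<close>.\<close>

lemma norm_mip_power2_le:
  assumes x: "x \<in> mcar E" and y: "y \<in> mcar E" and s: "norm (mip E x x) \<le> s" "0 < s"
  shows "(norm (mip E x y))\<^sup>2 \<le> s * norm (mip E y y)"
proof -
  define p q w where "p = mip E x x" and "q = mip E y y" and "w = mip E x y"
  define z where "z = mdiff E (mscale E (complex_of_real (1/s)) (mact E x w)) y"
  have [simp]: "z \<in> mcar E" by (simp add: z_def x y)
  have yx: "mip E y x = star w" by (simp add: w_def mip_star x y)
  have sc: "complex_of_real r *\<^sub>C a = r *\<^sub>R a" for r and a :: 'b by (rule scaleC_real)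
  have "mip E z z = (1/s) *\<^sub>R (1/s) *\<^sub>R (star w * p * w) - (1/s) *\<^sub>R (star w * w)
      - (1/s) *\<^sub>R (star w * w) + q"
    unfolding z_def
    by (simp add: x y mip_simps sc yx algebra_simps complex_cnj_complex_of_real
        del: of_real_divide flip: p_def q_def w_def)
  then have 1: "cs_positive ((1/s) *\<^sub>R (1/s) *\<^sub>R (star w * p * w) - (1/s) *\<^sub>R (star w * w)
      - (1/s) *\<^sub>R (star w * w) + q)"
    using mip_positive[of z] by simp
  have "cs_positive ((1/s) *\<^sub>R p)"
    using s mip_positive[OF x] by (intro cs_positive_scaleR) (auto simp: p_def)
  moreover have "norm ((1/s) *\<^sub>R p) \<le> 1" using s by (simp add: p_def)
  ultimately have "cs_positive (star w * w - star w * ((1/s) *\<^sub>R p) * w)"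
    by (rule cs_positive_conj_diff)
  then have "cs_positive ((1/s) *\<^sub>R (star w * w - star w * ((1/s) *\<^sub>R p) * w))"
    using s by (intro cs_positive_scaleR) auto
  \<comment> \<open>The terms in \<open>star w * p * w\<close> cancel, and one of the two copies of
    \<open>(1/s) *\<^sub>R (star w * w)\<close> remains.\<close>
  from cs_positive_add[OF 1 this] have "cs_positive (q - (1/s) *\<^sub>R (star w * w))"
    by (simp add: algebra_simps)
  moreover have "cs_positive ((1/s) *\<^sub>R (star w * w))"
    using s by (intro cs_positive_scaleR) auto
  ultimately have "norm ((1/s) *\<^sub>R (star w * w)) \<le> norm q"
    by (intro cs_positive_norm_mono)
  then show ?thesis
    using s by (simp add: cstar_identity w_def q_def field_simps)
qed

text \<open>A null vector \<open>x\<close> leaves no positive \<open>s = norm (mip E x x)\<close> to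
  divide by. Hence \<open>s\<close> approaches this norm from above along 1/(n+1).\<close>

lemma norm_mip_le:
  assumes x: "x \<in> mcar E" and y: "y \<in> mcar E"
  shows "norm (mip E x y) \<le> mnorm E x * mnorm E y"
proof -
  have "(norm (mip E x y))\<^sup>2 \<le> norm (mip E x x) * norm (mip E y y)"
  proof -
    have "(\<lambda>n. (norm (mip E x x) + inverse (real (Suc n))) * norm (mip E y y))
        \<longlonglongrightarrow> (norm (mip E x x) + 0) * norm (mip E y y)"
      by (intro tendsto_intros LIMSEQ_inverse_real_of_nat)
    moreover have "(norm (mip E x y))\<^sup>2 \<le> (norm (mip E x x) + inverse (real (Suc n))) * norm (mip E y y)" for n
      by (rule norm_mip_power2_le[OF x y]) (simp_all add: add_nonneg_pos)
    ultimately show ?thesis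
      by (intro LIMSEQ_le_const[where X = "\<lambda>n. (norm (mip E x x) + inverse (real (Suc n))) * norm (mip E y y)"])
        simp_all
  qed
  then have "(norm (mip E x y))\<^sup>2 \<le> (mnorm E x * mnorm E y)\<^sup>2"
    by (simp add: power_mult_distrib mnorm_power2)
  then show ?thesis by (rule power2_le_imp_le) simp
qed

lemma mnorm_add_le:
  assumes x: "x \<in> mcar E" and y: "y \<in> mcar E"
  shows "mnorm E (madd E x y) \<le> mnorm E x + mnorm E y"
proof (rule power2_le_imp_le)
  have "norm (mip E (madd E x y) (madd E x y))
      = norm ((mip E x x + mip E x y) + (mip E y x + mip E y y))"
    by (simp add: x y mip_simps algebra_simps)
  also have "\<dots> \<le> (norm (mip E x x) + norm (mip E x y)) + (norm (mip E y x) + norm (mip E y y))"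
    by (intro order_trans[OF norm_triangle_ineq] add_mono norm_triangle_ineq)
  also have "\<dots> \<le> ((mnorm E x)\<^sup>2 + mnorm E x * mnorm E y) + (mnorm E y * mnorm E x + (mnorm E y)\<^sup>2)"
    by (intro add_mono norm_mip_le x y) (simp_all add: mnorm_power2)
  finally show "(mnorm E (madd E x y))\<^sup>2 \<le> (mnorm E x + mnorm E y)\<^sup>2"
    by (simp add: mnorm_power2[of "madd E x y"]) (simp add: power2_eq_square algebra_simps)
qed simp

lemma mnorm_scale:
  assumes "x \<in> mcar E"
  shows "mnorm E (mscale E c x) = cmod c * mnorm E x"
proof -
  have "norm (mip E (mscale E c x) (mscale E c x)) = (cmod c * mnorm E x)\<^sup>2"
    using assms by (simp add: mip_simps norm_scaleC power_mult_distrib mnorm_power2 power2_eq_square[of "cmod c"])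
  then show ?thesis by (simp add: mnorm_def)
qed

lemma mnorm_zero [simp]: "mnorm E (mzero E) = 0"
  by (simp add: mnorm_def)

lemma mnorm_diff_commute: "x \<in> mcar E \<Longrightarrow> y \<in> mcar E \<Longrightarrow> mnorm E (mdiff E x y) = mnorm E (mdiff E y x)"
  by (rule mnorm_cong) (simp add: mip_simps algebra_simps)

lemma mnorm_diff_self [simp]: "x \<in> mcar E \<Longrightarrow> mnorm E (mdiff E x x) = 0"
  by (simp add: mnorm_def mip_simps)

lemma mnorm_diff_triangle:
  assumes "x \<in> mcar E" "y \<in> mcar E" "z \<in> mcar E"
  shows "mnorm E (mdiff E x z) \<le> mnorm E (mdiff E x y) + mnorm E (mdiff E y z)"
proof -
  have "mnorm E (mdiff E x z) = mnorm E (madd E (mdiff E x y) (mdiff E y z))"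
    using assms by (intro mnorm_cong) (simp add: mip_simps)
  then show ?thesis using assms mnorm_add_le[of "mdiff E x y" "mdiff E y z"] by simp
qed

lemma mnorm_le_diff_add:
  assumes "x \<in> mcar E" "y \<in> mcar E"
  shows "mnorm E x \<le> mnorm E (mdiff E x y) + mnorm E y"
proof -
  have "mnorm E x = mnorm E (madd E (mdiff E x y) y)"
    using assms by (intro mnorm_cong) (simp add: mip_simps)
  then show ?thesis using assms mnorm_add_le[of "mdiff E x y" y] by simp
qed

lemma mnorm_add_diff_le:
  assumes "x \<in> mcar E" "y \<in> mcar E" "x' \<in> mcar E" "y' \<in> mcar E"
  shows "mnorm E (mdiff E (madd E x y) (madd E x' y')) \<le> mnorm E (mdiff E x x') + mnorm E (mdiff E y y')"
proof -
  have "mnorm E (mdiff E (madd E x y) (madd E x' y')) = mnorm E (madd E (mdiff E x x') (mdiff E y y'))"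
    using assms by (intro mnorm_cong) (simp add: mip_simps algebra_simps)
  then show ?thesis using assms mnorm_add_le[of "mdiff E x x'" "mdiff E y y'"] by simp
qed

lemma mnorm_scale_diff:
  assumes "x \<in> mcar E" "y \<in> mcar E"
  shows "mnorm E (mdiff E (mscale E c x) (mscale E c y)) = cmod c * mnorm E (mdiff E x y)"
proof -
  have "mnorm E (mdiff E (mscale E c x) (mscale E c y)) = mnorm E (mscale E c (mdiff E x y))"
    using assms by (intro mnorm_cong) (simp add: mip_simps scaleC_diff_right)
  then show ?thesis using assms by (simp add: mnorm_scale)
qed

lemma mnorm_act_le:
  assumes "x \<in> mcar E"
  shows "mnorm E (mact E x b) \<le> mnorm E x * norm b"
proof (rule power2_le_imp_le)
  have "norm (star b * mip E x x * b) \<le> norm b * norm (mip E x x) * norm b"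
    using norm_mult_ineq[of "star b" "mip E x x"]
    by (intro order_trans[OF norm_mult_ineq] mult_right_mono) simp_all
  then show "(mnorm E (mact E x b))\<^sup>2 \<le> (mnorm E x * norm b)\<^sup>2"
    using assms by (simp add: mnorm_power2 power_mult_distrib mip_simps power2_eq_square[of "norm b"]
        mult.assoc mult.left_commute)
qed simp

lemma mnorm_act_diff_le:
  assumes "x \<in> mcar E" "y \<in> mcar E"
  shows "mnorm E (mdiff E (mact E x b) (mact E y b)) \<le> mnorm E (mdiff E x y) * norm b"
proof -
  have "mnorm E (mdiff E (mact E x b) (mact E y b)) = mnorm E (mact E (mdiff E x y) b)"
    using assms by (intro mnorm_cong) (simp add: mip_simps algebra_simps)
  then show ?thesis using assms by (simp add: mnorm_act_le)
qed

lemma mip_diff_norm_le: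
  assumes "x \<in> mcar E" "y \<in> mcar E" "x' \<in> mcar E" "y' \<in> mcar E"
  shows "norm (mip E x y - mip E x' y')
    \<le> mnorm E (mdiff E x x') * mnorm E y + mnorm E x' * mnorm E (mdiff E y y')"
proof -
  have "mip E x y - mip E x' y' = mip E (mdiff E x x') y + mip E x' (mdiff E y y')"
    using assms by (simp add: mip_simps)
  also have "norm \<dots> \<le> mnorm E (mdiff E x x') * mnorm E y + mnorm E x' * mnorm E (mdiff E y y')"
    using assms by (intro order_trans[OF norm_triangle_ineq] add_mono norm_mip_le) auto
  finally show ?thesis .
qed

section \<open>Cauchy sequences and limits\<close>

lemma mcauchy_bound:
  assumes "mcauchy E s"
  obtains K where "K > 0" "\<And>n. mnorm E (s n) \<le> K"
proof -
  have s: "s n \<in> mcar E" for n using assms by (simp add: mcauchy_def)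
  obtain N where N: "\<And>m n. m \<ge> N \<Longrightarrow> n \<ge> N \<Longrightarrow> mnorm E (mdiff E (s m) (s n)) < 1"
    using assms unfolding mcauchy_def by (metis zero_less_one)
  define K where "K = 1 + (\<Sum>n\<le>N. mnorm E (s n))"
  have "mnorm E (s n) \<le> K" for n
  proof (cases "n \<le> N")
    case True
    then have "mnorm E (s n) \<le> (\<Sum>n\<le>N. mnorm E (s n))"
      by (intro member_le_sum) auto
    then show ?thesis by (simp add: K_def)
  next
    case False
    then have "mnorm E (s n) \<le> 1 + mnorm E (s N)"
      using N[of n N] mnorm_le_diff_add[OF s[of n] s[of N]] by simp
    also have "mnorm E (s N) \<le> (\<Sum>n\<le>N. mnorm E (s n))"
      by (intro member_le_sum) auto
    finally show ?thesis by (simp add: K_def)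
  qed
  moreover have "K > 0" unfolding K_def by (intro add_pos_nonneg sum_nonneg) auto
  ultimately show thesis using that by blast
qed

lemma mcauchyI:
  assumes "\<And>n. s n \<in> mcar E" "\<And>m n. mnorm E (mdiff E (s m) (s n)) \<le> a m + a n" "a \<longlonglongrightarrow> 0"
  shows "mcauchy E s"
  unfolding mcauchy_def
proof (intro conjI allI impI assms(1))
  fix \<epsilon> :: real assume "0 < \<epsilon>"
  then obtain N where N: "\<And>n. n \<ge> N \<Longrightarrow> norm (a n) < \<epsilon> / 2"
    using LIMSEQ_D[OF assms(3), of "\<epsilon> / 2"] by auto
  have "mnorm E (mdiff E (s m) (s n)) < \<epsilon>" if "m \<ge> N" "n \<ge> N" for m n
    using assms(2)[of m n] N[of m] N[of n] that by (simp add: abs_less_iff)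
  then show "\<exists>N. \<forall>m\<ge>N. \<forall>n\<ge>N. mnorm E (mdiff E (s m) (s n)) < \<epsilon>" by blast
qed

lemma mip_tendsto:
  assumes "\<And>n. s n \<in> mcar E" "x \<in> mcar E" "y \<in> mcar E"
    and "(\<lambda>n. mnorm E (mdiff E (s n) x)) \<longlonglongrightarrow> 0"
  shows "(\<lambda>n. mip E (s n) y) \<longlonglongrightarrow> mip E x y"
proof (rule LIM_zero_cancel, rule Lim_null_comparison)
  show "\<forall>\<^sub>F n in sequentially. norm (mip E (s n) y - mip E x y) \<le> mnorm E (mdiff E (s n) x) * mnorm E y"
    using assms norm_mip_le[of "mdiff E (s _) x" y] by (intro always_eventually) (simp add: mip_simps)
  show "(\<lambda>n. mnorm E (mdiff E (s n) x) * mnorm E y) \<longlonglongrightarrow> 0"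
    by (rule tendsto_mult_left_zero[OF assms(4)])
qed

lemma mnorm_tendsto:
  assumes "\<And>n. s n \<in> mcar E" "x \<in> mcar E" "(\<lambda>n. mnorm E (mdiff E (s n) x)) \<longlonglongrightarrow> 0"
  shows "(\<lambda>n. mnorm E (s n)) \<longlonglongrightarrow> mnorm E x"
proof (rule LIM_zero_cancel, rule Lim_null_comparison[OF _ assms(3)])
  have "\<bar>mnorm E (s n) - mnorm E x\<bar> \<le> mnorm E (mdiff E (s n) x)" for n
    using mnorm_le_diff_add[of "s n" x] mnorm_le_diff_add[of x "s n"] assms(1,2)
      mnorm_diff_commute[of x "s n"] by (simp add: abs_le_iff)
  then show "\<forall>\<^sub>F n in sequentially. norm (mnorm E (s n) - mnorm E x) \<le> mnorm E (mdiff E (s n) x)"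
    by simp
qed

end

text \<open>The operations live in a record on a carrier set, so sums over type classes do not
  apply. Lists allow repetitions, as the multisets of formal tensors do; \<open>emb_lsum\<close>
  links the two.\<close>

definition lsum :: "('b, 'e) rmod \<Rightarrow> ('i \<Rightarrow> 'e) \<Rightarrow> 'i list \<Rightarrow> 'e" where
  "lsum E f is = foldr (\<lambda>i. madd E (f i)) is (mzero E)"

lemma lsum_simps [simp]:
  "lsum E f [] = mzero E" "lsum E f (i # is) = madd E (f i) (lsum E f is)"
  by (simp_all add: lsum_def)

context sip_module
begin

lemma lsum_in [simp]: "(\<And>i. i \<in> set is \<Longrightarrow> f i \<in> mcar E) \<Longrightarrow> lsum E f is \<in> mcar E"
  by (induction "is") auto

lemma mip_lsum:
  "z \<in> mcar E \<Longrightarrow> (\<And>i. i \<in> set is \<Longrightarrow> f i \<in> mcar E)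
    \<Longrightarrow> mip E z (lsum E f is) = (\<Sum>i\<leftarrow>is. mip E z (f i))"
  by (induction "is") (auto simp: mip_simps)

lemma mip_lsum_left:
  "z \<in> mcar E \<Longrightarrow> (\<And>i. i \<in> set is \<Longrightarrow> f i \<in> mcar E)
    \<Longrightarrow> mip E (lsum E f is) z = (\<Sum>i\<leftarrow>is. mip E (f i) z)"
  by (induction "is") (auto simp: mip_simps)

text \<open>A symmetric operator \<open>M\<close> with \<open>\<parallel>\<langle>v, M\<^sup>n v\<rangle>\<parallel> \<le> C r\<^sup>n\<close> satisfies \<open>\<parallel>\<langle>v, M v\<rangle>\<parallel> \<le> r \<parallel>\<langle>v, v\<rangle>\<parallel>\<close>;
  here \<open>v n\<close> is \<open>M\<^sup>n v\<close>.\<close>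

lemma norm_mip_iterate_le:
  assumes v: "\<And>n. v n \<in> mcar E" and sym: "\<And>m n. mip E (v m) (v n) = mip E (v 0) (v (m + n))"
    and bound: "\<And>n. norm (mip E (v 0) (v n)) \<le> C * r ^ n" and r: "0 \<le> r"
  shows "norm (mip E (v 0) (v 1)) \<le> r * norm (mip E (v 0) (v 0))"
proof -
  define p where "p n = norm (mip E (v 0) (v n))" for n
  have p0: "0 \<le> p n" for n by (simp add: p_def)
  have step: "(p n)\<^sup>2 \<le> p 0 * p (n + n)" for n
  proof -
    have "(p n)\<^sup>2 \<le> (mnorm E (v 0) * mnorm E (v n))\<^sup>2"
      unfolding p_def by (intro power_mono norm_mip_le v) simp
    also have "\<dots> = p 0 * p (n + n)"
      by (simp add: power_mult_distrib mnorm_power2 p_def sym[of n n])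
    finally show ?thesis .
  qed
  \<comment> \<open>Repeated squaring of \<open>step\<close>. In quotients it reads (p 1 / p
    0)^(2^k) \<le> p (2^k) / p 0; the form without division also covers
    \<open>p 0 = 0\<close>.\<close>
  have iter: "p 0 * p 1 ^ (2 ^ k) \<le> p 0 ^ (2 ^ k) * p (2 ^ k)" for k
  proof (induction k)
    case (Suc k)
    have "p 0 * (p 0 * p 1 ^ (2 ^ Suc k)) = (p 0 * p 1 ^ (2 ^ k))\<^sup>2"
      by (simp add: power_mult_distrib power2_eq_square mult_2 power_add mult.assoc mult.left_commute)
    also have "\<dots> \<le> (p 0 ^ (2 ^ k) * p (2 ^ k))\<^sup>2"
      using Suc by (intro power_mono) (simp_all add: p0)
    also have "\<dots> = p 0 ^ (2 ^ Suc k) * (p (2 ^ k))\<^sup>2"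
      by (simp add: power_mult_distrib power2_eq_square mult_2 power_add)
    also have "\<dots> \<le> p 0 ^ (2 ^ Suc k) * (p 0 * p (2 ^ Suc k))"
      using step[of "2 ^ k"] by (intro mult_left_mono) (simp_all add: p0 mult_2)
    also have "\<dots> = p 0 * (p 0 ^ (2 ^ Suc k) * p (2 ^ Suc k))" by (simp add: mult.left_commute)
    finally have le: "p 0 * (p 0 * p 1 ^ (2 ^ Suc k)) \<le> p 0 * (p 0 ^ (2 ^ Suc k) * p (2 ^ Suc k))" .
    show ?case
    proof (cases "p 0 = 0")
      case False
      then have "p 0 > 0" using p0[of 0] by simp
      with le show ?thesis by (rule mult_left_le_imp_le)
    qed (simp add: p0)
  qed simp
  show ?thesis
  proof (cases "p 0 = 0")
    case True
    then show ?thesis using step[of 1] by (simp add: p_def)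
  next
    case False
    then have pos: "p 0 > 0" using p0[of 0] by simp
    show ?thesis
    proof (rule ccontr)
      assume "\<not> ?thesis"
      then have lt: "r * p 0 < p 1" by (simp add: p_def)
      have p1: "p 1 > 0" using lt r pos by (meson le_less_trans mult_nonneg_nonneg p0)
      have bd: "p 0 * p 1 ^ (2 ^ k) \<le> C * (r * p 0) ^ (2 ^ k)" for k
      proof -
        have "p 0 * p 1 ^ (2 ^ k) \<le> p 0 ^ (2 ^ k) * (C * r ^ (2 ^ k))"
          using bound[of "2 ^ k"] by (intro order_trans[OF iter] mult_left_mono) (simp_all add: p0 flip: p_def)
        then show ?thesis by (simp add: power_mult_distrib algebra_simps)
      qed
      have C: "0 < C"
      proof (rule ccontr)
        assume "\<not> 0 < C"
        then have "p 0 * p 1 ^ (2 ^ 0) \<le> 0"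
          using bd[of 0] r pos by (meson mult_nonpos_nonneg not_less order_trans mult_nonneg_nonneg p0 zero_le_power)
        then show False using pos p1 by (simp add: mult_le_0_iff)
      qed
      \<comment> \<open>The bound \<open>bd\<close> says that \<theta>^(2^k) never drops below
        \<open>p 0 / C\<close>, which is impossible for \<theta> < 1. The constant \<open>C\<close>
        has no influence on the ratio for this reason.\<close>
      define \<theta> where "\<theta> = r * p 0 / p 1"
      have \<theta>: "0 \<le> \<theta>" "\<theta> < 1" using lt r pos p1 by (simp_all add: \<theta>_def)
      obtain n where n: "\<theta> ^ n < p 0 / C"
        using real_arch_pow_inv[of "p 0 / C" \<theta>] \<theta> pos C by auto
      have "\<theta> ^ (2 ^ n) \<le> \<theta> ^ n" using \<theta> by (intro power_decreasing) (auto simp: less_imp_le)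
      then have "\<theta> ^ (2 ^ n) < p 0 / C" using n by simp
      then have "C * (r * p 0) ^ (2 ^ n) < p 0 * p 1 ^ (2 ^ n)"
        using C p1 by (simp add: \<theta>_def power_divide field_simps)
      then show False using bd[of n] by simp
    qed
  qed
qed

end

section \<open>Hilbert modules\<close>

sublocale hilbert_module \<subseteq> sip_module E
  by unfold_locales (fact zero_closed add_closed scale_closed act_closed add_assoc add_commute
    add_zero add_neg scale_add_right scale_add_left scale_scale scale_one act_add_left act_add_right
    act_mult act_scale_left act_scale_right ip_add ip_scale ip_act ip_star ip_positive)+

context hilbert_module
begin

lemma mnorm_diff_eq_0D: "x \<in> mcar E \<Longrightarrow> y \<in> mcar E \<Longrightarrow> mnorm E (mdiff E x y) = 0 \<Longrightarrow> x = y"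
  using mdiff_eq_zeroD[of x y] ip_definite[of "mdiff E x y"] by (simp add: mnorm_def)

lemma mip_eqI:
  assumes "x \<in> mcar E" "y \<in> mcar E" "\<And>z. z \<in> mcar E \<Longrightarrow> mip E z x = mip E z y"
  shows "x = y"
  using assms by (intro mnorm_diff_eq_0D) (simp_all add: mnorm_def mip_diff[of x y])

lemma mip_eqI_left:
  assumes "x \<in> mcar E" "y \<in> mcar E" "\<And>z. z \<in> mcar E \<Longrightarrow> mip E x z = mip E y z"
  shows "x = y"
  using assms by (intro mnorm_diff_eq_0D) (simp_all add: mnorm_def mip_diff_left[of x y])

end

lemma hilbert_moduleI:
  assumes "sip_module E"
    and "\<And>x. x \<in> mcar E \<Longrightarrow> mip E x x = 0 \<Longrightarrow> x = mzero E"
    and "\<And>s. mcauchy E s \<Longrightarrow> \<exists>x\<in>mcar E. (\<lambda>n. mnorm E (mdiff E (s n) x)) \<longlonglongrightarrow> 0"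
  shows "hilbert_module E"
proof -
  interpret sip_module E by fact
  show ?thesis
    by unfold_locales (fact zero_in add_in scale_in act_in madd_assoc madd_commute madd_zero madd_neg
      mscale_add_right mscale_add_left mscale_scale mscale_one mact_add_left mact_add_right mact_mult
      mact_scale_left mact_scale_right mip_add mip_scale mip_act mip_star mip_positive assms(2,3))+
qed

subsection \<open>Generating families\<close>

text \<open>The approximating sums carry no coefficients, because elementary tensors absorb scalars
  into their first factor. Differences of such sums therefore need generators that are closed under
  negation.\<close>

definition total_family :: "('b::cstar_algebra, 'e) rmod \<Rightarrow> ('i \<Rightarrow> 'e) \<Rightarrow> 'i set \<Rightarrow> bool" where
  "total_family E f I \<longleftrightarrow> f ` I \<subseteq> mcar E \<and>
     (\<forall>z\<in>mcar E. \<forall>\<epsilon>>0. \<exists>is. set is \<subseteq> I \<and> mnorm E (mdiff E z (lsum E f is)) < \<epsilon>)"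

lemma totalD:
  assumes "total_family E f I"
  shows "i \<in> I \<Longrightarrow> f i \<in> mcar E"
    and "z \<in> mcar E \<Longrightarrow> 0 < \<epsilon> \<Longrightarrow> \<exists>is. set is \<subseteq> I \<and> mnorm E (mdiff E z (lsum E f is)) < \<epsilon>"
  using assms unfolding total_family_def by blast+

lemma total_seq:
  assumes "total_family E f I" "hilbert_module E" "z \<in> mcar E"
  obtains js where "\<And>n. set (js n) \<subseteq> I"
    "\<And>n. mnorm E (mdiff E (lsum E f (js n)) z) \<le> inverse (real (Suc n))"
    "(\<lambda>n. mnorm E (mdiff E (lsum E f (js n)) z)) \<longlonglongrightarrow> 0"
proof -
  interpret hilbert_module E by fact
  have "\<exists>js. \<forall>n. set (js n) \<subseteq> I \<and> mnorm E (mdiff E z (lsum E f (js n))) < inverse (real (Suc n))"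
    by (rule choice) (use totalD(2)[OF assms(1,3)] in simp)
  then obtain js where js: "\<And>n. set (js n) \<subseteq> I"
    "\<And>n. mnorm E (mdiff E z (lsum E f (js n))) < inverse (real (Suc n))" by blast
  have in_car: "lsum E f (js n) \<in> mcar E" for n
    using js(1)[of n] totalD(1)[OF assms(1)] by (intro lsum_in) blast
  then have le: "mnorm E (mdiff E (lsum E f (js n)) z) \<le> inverse (real (Suc n))" for n
    using js(2)[of n] mnorm_diff_commute[OF assms(3) in_car[of n]] by simp
  have "(\<lambda>n. mnorm E (mdiff E (lsum E f (js n)) z)) \<longlonglongrightarrow> 0"
    by (rule Lim_null_comparison[OF _ LIMSEQ_inverse_real_of_nat])
      (use le in \<open>simp add: always_eventually\<close>)
  with js(1) le show thesis using that by blast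
qed

text \<open>The difference is orthogonal to all sums of generators, and these converge to it, so it
  is orthogonal to itself.\<close>

lemma total_eqI:
  assumes "total_family E f I" "hilbert_module E" "x \<in> mcar E" "y \<in> mcar E"
    and eq: "\<And>i. i \<in> I \<Longrightarrow> mip E (f i) x = mip E (f i) y"
  shows "x = y"
proof -
  interpret hilbert_module E by fact
  define w where "w = mdiff E x y"
  have w: "w \<in> mcar E" by (simp add: w_def assms)
  obtain js where js: "\<And>n. set (js n) \<subseteq> I"
    "(\<lambda>n. mnorm E (mdiff E (lsum E f (js n)) w)) \<longlonglongrightarrow> 0"
    using total_seq[OF assms(1,2) w] by metis
  have car: "f i \<in> mcar E" if "i \<in> I" for i using totalD(1)[OF assms(1) that] .
  have in_car: "lsum E f (js n) \<in> mcar E" for n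
    using js(1)[of n] car by (intro lsum_in) blast
  have "mip E (f i) w = 0" if "i \<in> I" for i
    using that car eq by (simp add: w_def mip_diff assms)
  then have "mip E (lsum E f (js n)) w = 0" for n
    using js(1)[of n] car by (subst mip_lsum_left[OF w]) (auto simp: subset_iff intro!: sum_list_0 cong: map_cong)
  then have "(\<lambda>n. 0) \<longlonglongrightarrow> mip E w w"
    using mip_tendsto[OF in_car w w js(2)] by simp
  then have "mip E w w = 0" by (simp add: LIMSEQ_const_iff)
  then have "w = mzero E" using w by (rule ip_definite[rotated])
  then show ?thesis using mdiff_eq_zeroD[OF assms(3,4)] by (simp add: w_def)
qed

subsection \<open>Adjointable maps\<close>

lemma madjoint:
  assumes "hilbert_module E" "hilbert_module F" "T \<in> adjointable E F"
  shows "madjoint E F T \<in> mcar F \<rightarrow>\<^sub>E mcar E"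
    and "x \<in> mcar E \<Longrightarrow> y \<in> mcar F \<Longrightarrow> mip F (T x) y = mip E x (madjoint E F T y)"
proof -
  interpret E: hilbert_module E by fact
  have ex: "\<exists>S. S \<in> mcar F \<rightarrow>\<^sub>E mcar E \<and> (\<forall>x\<in>mcar E. \<forall>y\<in>mcar F. mip F (T x) y = mip E x (S y))"
    using assms(3) unfolding adjointable_def by blast
  have "\<exists>!S. S \<in> mcar F \<rightarrow>\<^sub>E mcar E \<and> (\<forall>x\<in>mcar E. \<forall>y\<in>mcar F. mip F (T x) y = mip E x (S y))"
  proof (rule ex_ex1I[OF ex])
    fix S S'
    assume S: "S \<in> mcar F \<rightarrow>\<^sub>E mcar E \<and> (\<forall>x\<in>mcar E. \<forall>y\<in>mcar F. mip F (T x) y = mip E x (S y))"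
      and S': "S' \<in> mcar F \<rightarrow>\<^sub>E mcar E \<and> (\<forall>x\<in>mcar E. \<forall>y\<in>mcar F. mip F (T x) y = mip E x (S' y))"
    show "S = S'"
    proof (rule PiE_ext[where k = "mcar F" and s = "\<lambda>_. mcar E"])
      fix y assume "y \<in> mcar F"
      then show "S y = S' y" using S S' by (intro E.mip_eqI) (auto dest: PiE_mem)
    qed (use S S' in auto)
  qed
  from theI'[OF this]
  show "madjoint E F T \<in> mcar F \<rightarrow>\<^sub>E mcar E"
    "x \<in> mcar E \<Longrightarrow> y \<in> mcar F \<Longrightarrow> mip F (T x) y = mip E x (madjoint E F T y)"
    unfolding madjoint_def by blast+
qed

lemma adjointable_in: "T \<in> adjointable E F \<Longrightarrow> x \<in> mcar E \<Longrightarrow> T x \<in> mcar F"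
  by (auto simp: adjointable_def)

lemma adjointableI:
  assumes "T \<in> mcar E \<rightarrow>\<^sub>E mcar F" "\<And>y. y \<in> mcar F \<Longrightarrow> S y \<in> mcar E"
    "\<And>x y. x \<in> mcar E \<Longrightarrow> y \<in> mcar F \<Longrightarrow> mip F (T x) y = mip E x (S y)"
  shows "T \<in> adjointable E F"
  unfolding adjointable_def
  by (rule CollectI, rule conjI[OF assms(1)], rule bexI[of _ "restrict S (mcar F)"]) (use assms in auto)

lemma adjointable_ext:
  "T \<in> adjointable E F \<Longrightarrow> T' \<in> adjointable E F \<Longrightarrow> (\<And>x. x \<in> mcar E \<Longrightarrow> T x = T' x) \<Longrightarrow> T = T'"
  unfolding adjointable_def by (blast intro: PiE_ext)

lemma adjointable_restrict_id: "restrict id (mcar E) \<in> adjointable E E"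
  by (rule adjointableI[where S = id]) auto

lemma adjointable_compose:
  assumes "S \<in> adjointable F G" "T \<in> adjointable E F"
  shows "compose (mcar E) S T \<in> adjointable E G"
proof -
  obtain S' where S': "S' \<in> mcar G \<rightarrow>\<^sub>E mcar F" "\<forall>x\<in>mcar F. \<forall>y\<in>mcar G. mip G (S x) y = mip F x (S' y)"
    using assms(1) unfolding adjointable_def by blast
  obtain T' where T': "T' \<in> mcar F \<rightarrow>\<^sub>E mcar E" "\<forall>x\<in>mcar E. \<forall>y\<in>mcar F. mip F (T x) y = mip E x (T' y)"
    using assms(2) unfolding adjointable_def by blast
  have "S \<in> mcar F \<rightarrow>\<^sub>E mcar G" "T \<in> mcar E \<rightarrow>\<^sub>E mcar F"
    using assms by (auto simp: adjointable_def)
  then show ?thesis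
    using S' T' by (intro adjointableI[where S = "\<lambda>y. T' (S' y)"])
      (auto simp: compose_def PiE_def Pi_def extensional_def)
qed

locale adjointable_map =
  E: hilbert_module E + F: hilbert_module F
  for E :: "('b::cstar_algebra, 'e) rmod" and F :: "('b, 'f) rmod" +
  fixes T
  assumes adj: "T \<in> adjointable E F"
begin

abbreviation "S \<equiv> madjoint E F T"

lemma in_F [simp]: "x \<in> mcar E \<Longrightarrow> T x \<in> mcar F"
  using adj by (rule adjointable_in)

lemma S_ext: "S \<in> mcar F \<rightarrow>\<^sub>E mcar E"
  using madjoint(1)[OF E.hilbert_module_axioms F.hilbert_module_axioms adj] .

lemma S_in [simp]: "y \<in> mcar F \<Longrightarrow> S y \<in> mcar E"
  using S_ext by auto

lemma mip_T: "x \<in> mcar E \<Longrightarrow> y \<in> mcar F \<Longrightarrow> mip F (T x) y = mip E x (S y)"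
  using madjoint(2)[OF E.hilbert_module_axioms F.hilbert_module_axioms adj] .

lemma mip_S: "x \<in> mcar E \<Longrightarrow> y \<in> mcar F \<Longrightarrow> mip E (S y) x = mip F y (T x)"
  using arg_cong[OF mip_T[of x y], of star] by (simp add: F.mip_star E.mip_star)

lemma T_right: "x \<in> mcar E \<Longrightarrow> y \<in> mcar F \<Longrightarrow> mip F y (T x) = mip E (S y) x"
  by (simp add: mip_S)

lemma S_adjointable: "S \<in> adjointable F E"
  by (rule adjointableI[OF S_ext, where S = T]) (simp_all add: mip_S)

text \<open>Linearity is a consequence of having an adjoint: moved to the other side of the inner
  product, \<open>T\<close> leaves only the linearity of \<open>mip\<close>.\<close>

lemma T_add: "x \<in> mcar E \<Longrightarrow> y \<in> mcar E \<Longrightarrow> T (madd E x y) = madd F (T x) (T y)"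
  by (rule F.mip_eqI) (simp_all add: T_right E.mip_simps F.mip_simps)

lemma T_scale: "x \<in> mcar E \<Longrightarrow> T (mscale E c x) = mscale F c (T x)"
  by (rule F.mip_eqI) (simp_all add: T_right E.mip_simps F.mip_simps)

lemma T_act: "x \<in> mcar E \<Longrightarrow> T (mact E x b) = mact F (T x) b"
  by (rule F.mip_eqI) (simp_all add: T_right E.mip_simps F.mip_simps)

lemma T_zero: "T (mzero E) = mzero F"
  by (rule F.mip_eqI) (simp_all add: T_right E.mip_simps F.mip_simps)

lemma T_diff: "x \<in> mcar E \<Longrightarrow> y \<in> mcar E \<Longrightarrow> T (mdiff E x y) = mdiff F (T x) (T y)"
  by (rule F.mip_eqI) (simp_all add: T_right E.mip_simps F.mip_simps)

end

text \<open>Agreement on generators makes the adjoints agree by \<open>total_eqI\<close>, and the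
  adjoints determine the maps. The detour spares any appeal to continuity.\<close>

lemma adjointable_total_eqI:
  assumes "total_family E f I" "hilbert_module E" "hilbert_module F"
    "T \<in> adjointable E F" "T' \<in> adjointable E F" "\<And>i. i \<in> I \<Longrightarrow> T (f i) = T' (f i)"
  shows "T = T'"
proof (rule adjointable_ext[OF assms(4,5)])
  fix x assume x: "x \<in> mcar E"
  interpret T: adjointable_map E F T using assms by (simp add: adjointable_map_def adjointable_map_axioms_def)
  interpret T': adjointable_map E F T' using assms by (simp add: adjointable_map_def adjointable_map_axioms_def)
  have "T.S y = T'.S y" if "y \<in> mcar F" for y
  proof (rule total_eqI[OF assms(1,2)])
    fix i assume "i \<in> I"
    then show "mip E (f i) (T.S y) = mip E (f i) (T'.S y)"
      using that totalD(1)[OF assms(1)] assms(6) by (simp flip: T.mip_T T'.mip_T)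
  qed (use that in simp_all)
  then show "T x = T' x"
    using x by (intro T.F.mip_eqI_left) (simp_all add: T.mip_T T'.mip_T)
qed

context adjointable_map
begin

text \<open>The uniform boundedness principle for the functionals \<open>y \<mapsto> \<langle>T x, y\<rangle>\<close> with \<open>\<parallel>x\<parallel> = 1\<close>, by
  Sokal's argument: if \<open>\<parallel>T x\<^sub>n\<parallel> > 4\<^sup>n\<close> then signs can be chosen such that
  \<open>w = \<Sum> \<plusminus> 3\<^sup>-\<^sup>n T x\<^sub>n / \<parallel>T x\<^sub>n\<parallel>\<close> satisfies \<open>\<parallel>\<langle>T x\<^sub>n, w\<rangle>\<parallel> \<ge> (4/3)\<^sup>n / 2\<close> for all \<open>n\<close>.\<close>

lemma bounded: "\<exists>r\<ge>0. \<forall>x\<in>mcar E. mnorm F (T x) \<le> r * mnorm E x"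
proof (rule ccontr)
  assume neg: "\<not> ?thesis"
  have "\<exists>x\<in>mcar E. mnorm E x = 1 \<and> mnorm F (T x) > r" if "r \<ge> 0" for r
  proof -
    have "\<exists>x\<in>mcar E. \<not> mnorm F (T x) \<le> r * mnorm E x" using neg that by blast
    then obtain x where x: "x \<in> mcar E" "mnorm F (T x) > r * mnorm E x" by (auto simp: not_le)
    have "mnorm E x \<noteq> 0"
    proof
      assume "mnorm E x = 0"
      then have "x = mzero E" using x(1) by (intro E.ip_definite) (simp_all add: mnorm_def)
      then show False using x(2) by (simp add: T_zero)
    qed
    then have pos: "mnorm E x > 0" using E.mnorm_ge_0[of x] by linarith
    let ?y = "mscale E (complex_of_real (1 / mnorm E x)) x"
    have "mnorm E ?y = 1" "mnorm F (T ?y) > r"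
      using x pos by (simp_all add: E.mnorm_scale F.mnorm_scale T_scale norm_divide field_simps
          del: of_real_divide)
    then show ?thesis using x(1) by (intro bexI[of _ ?y]) simp_all
  qed
  then have "\<forall>n. \<exists>x. x \<in> mcar E \<and> mnorm E x = 1 \<and> mnorm F (T x) > 4 ^ n" by (simp add: Bex_def)
  then obtain x where x: "\<And>n::nat. x n \<in> mcar E" "\<And>n. mnorm E (x n) = 1" "\<And>n. mnorm F (T (x n)) > 4 ^ n"
    by metis
  define c where "c n = mnorm F (T (x n))" for n
  have c: "c n > 4 ^ n" "c n > 0" for n
    using x(3)[of n] by (auto simp: c_def intro: less_trans[of 0 "4 ^ n"])
  define v where "v n = mscale F (complex_of_real ((1/3) ^ n / c n)) (T (x n))" for n
  have v: "v n \<in> mcar F" "mnorm F (v n) = (1/3) ^ n" for n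
    using c(2)[of n] by (simp_all add: v_def x F.mnorm_scale norm_divide norm_power flip: c_def)
  \<comment> \<open>The n-th sign keeps the pairing of \<open>w (Suc n)\<close> with
    \<open>T (x n)\<close> large; the later terms are too small to cancel it.\<close>
  define w where "w = rec_nat (mzero F) (\<lambda>n y.
    if norm (mip F (T (x n)) (madd F y (v n))) \<ge> (1/3) ^ n * c n then madd F y (v n) else mdiff F y (v n))"
  have w0: "w 0 = mzero F" and wS: "w (Suc n) = (if norm (mip F (T (x n)) (madd F (w n) (v n))) \<ge> (1/3) ^ n * c n
      then madd F (w n) (v n) else mdiff F (w n) (v n))" for n
    by (simp_all add: w_def)
  have w: "w n \<in> mcar F" for n
    by (induction n) (simp_all add: w0 wS v)
  have big: "norm (mip F (T (x n)) (w (Suc n))) \<ge> (1/3) ^ n * c n" for n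
  proof -
    define a b where "a = mip F (T (x n)) (w n)" and "b = mip F (T (x n)) (v n)"
    have "b = ((1/3) ^ n / c n) *\<^sub>R mip F (T (x n)) (T (x n))"
      using x by (simp add: b_def v_def F.mip_simps scaleC_real del: of_real_divide)
    then have "norm b = (1/3) ^ n * c n"
      using c(2)[of n] by (simp add: F.mnorm_power2[symmetric] power2_eq_square flip: c_def)
    \<comment> \<open>\<open>2 b\<close> is the difference of \<open>a + b\<close> and
      \<open>a - b\<close>, so one of the two has norm at least \<open>norm b\<close>.\<close>
    moreover have "norm (2 *\<^sub>R b) \<le> norm (a + b) + norm (a - b)"
      using norm_triangle_ineq4[of "a + b" "a - b"] by (simp add: scaleR_2 algebra_simps)
    ultimately have "norm (a + b) \<ge> (1/3) ^ n * c n \<or> norm (a - b) \<ge> (1/3) ^ n * c n"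
      by simp linarith
    moreover have "mip F (T (x n)) (madd F (w n) (v n)) = a + b" "mip F (T (x n)) (mdiff F (w n) (v n)) = a - b"
      by (simp_all add: a_def b_def F.mip_simps x w v)
    ultimately show ?thesis by (auto simp: wS)
  qed
  have wdiff: "mnorm F (mdiff F (w (Suc n)) (w n)) \<le> (1/3) ^ n" for n
  proof -
    have "mnorm F (mdiff F (w (Suc n)) (w n)) = mnorm F (v n)"
      by (rule F.mnorm_cong) (simp add: wS F.mip_simps w v)
    then show ?thesis by (simp add: v)
  qed
  \<comment> \<open>Partial sums of the geometric series with ratio 1/3; the factor 3/2 is 1/(1 -
    1/3).\<close>
  have far: "mnorm F (mdiff F (w (n + k)) (w n)) \<le> 3/2 * ((1/3) ^ n - (1/3) ^ (n + k))" for n k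
  proof (induction k)
    case (Suc k)
    have "mnorm F (mdiff F (w (n + Suc k)) (w n))
        \<le> mnorm F (mdiff F (w (Suc (n + k))) (w (n + k))) + mnorm F (mdiff F (w (n + k)) (w n))"
      using F.mnorm_diff_triangle[OF w w w] by simp
    also have "\<dots> \<le> (1/3) ^ (n + k) + 3/2 * ((1/3) ^ n - (1/3) ^ (n + k))"
      by (intro add_mono Suc wdiff)
    finally show ?case by (simp add: field_simps)
  qed (simp add: w)
  have far': "mnorm F (mdiff F (w m) (w n)) \<le> 3/2 * (1/3) ^ n" if "n \<le> m" for m n
  proof -
    have "mnorm F (mdiff F (w m) (w n)) \<le> 3/2 * ((1/3) ^ n - (1/3) ^ m)"
      using far[of n "m - n"] that by simp
    also have "\<dots> \<le> 3/2 * (1/3) ^ n" by (rule mult_left_mono) simp_all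
    finally show ?thesis .
  qed
  have "mcauchy F w"
  proof (rule F.mcauchyI[OF w])
    fix m n
    show "mnorm F (mdiff F (w m) (w n)) \<le> 3/2 * (1/3) ^ m + 3/2 * (1/3) ^ n"
    proof (cases "n \<le> m")
      case True
      show ?thesis by (rule order_trans[OF far'[OF True]]) simp
    next
      case False
      then have "m \<le> n" by simp
      show ?thesis unfolding F.mnorm_diff_commute[OF w w, of m n]
        by (rule order_trans[OF far'[OF \<open>m \<le> n\<close>]]) simp
    qed
    show "(\<lambda>n. 3/2 * (1/3) ^ n :: real) \<longlonglongrightarrow> 0"
      by (intro tendsto_mult_right_zero LIMSEQ_realpow_zero) auto
  qed
  then obtain y where y: "y \<in> mcar F" "(\<lambda>n. mnorm F (mdiff F (w n) y)) \<longlonglongrightarrow> 0"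
    using F.complete by blast
  have close: "mnorm F (mdiff F (w n) y) \<le> 3/2 * (1/3) ^ n" for n
  proof (rule LIMSEQ_le_const)
    show "(\<lambda>m. mnorm F (mdiff F (w m) y) + 3/2 * (1/3) ^ n) \<longlonglongrightarrow> 3/2 * (1/3) ^ n"
      using tendsto_add[OF y(2) tendsto_const[of "3/2 * (1/3) ^ n"]] by simp
    have "mnorm F (mdiff F (w n) y) \<le> mnorm F (mdiff F (w m) y) + 3/2 * (1/3) ^ n" if "m \<ge> n" for m
      using F.mnorm_diff_triangle[OF w[of n] w[of m] y(1)] far'[OF that] F.mnorm_diff_commute[OF w w, of m n]
      by simp
    then show "\<exists>N. \<forall>m\<ge>N. mnorm F (mdiff F (w n) y) \<le> mnorm F (mdiff F (w m) y) + 3/2 * (1/3) ^ n"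
      by blast
  qed
  have lower: "(4/3) ^ n / 2 \<le> mnorm E (S y)" for n
  proof -
    have "(1/3) ^ n * c n \<le> norm (mip F (T (x n)) (w (Suc n)))" by (rule big)
    also have "mip F (T (x n)) (w (Suc n)) = mip F (T (x n)) y + mip F (T (x n)) (mdiff F (w (Suc n)) y)"
      by (simp add: F.mip_simps x w y)
    also have "norm \<dots> \<le> norm (mip F (T (x n)) y) + c n * mnorm F (mdiff F (w (Suc n)) y)"
      unfolding c_def by (intro order_trans[OF norm_triangle_ineq] add_mono F.norm_mip_le) (simp_all add: x w y)
    \<comment> \<open>The tail after index n is 3/2 * (1/3)^(n+1) = (1/3)^n / 2, so it consumes only
      half of the main term. What remains is bounded by \<open>mnorm E (S y)\<close> because
      \<open>x n\<close> has norm 1, although it grows like (4/3)^n.\<close>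
    also have "\<dots> \<le> mnorm E (S y) + c n * ((1/3) ^ n / 2)"
    proof (intro add_mono mult_left_mono)
      show "norm (mip F (T (x n)) y) \<le> mnorm E (S y)"
        using E.norm_mip_le[of "x n" "S y"] x y by (simp add: mip_T)
      show "mnorm F (mdiff F (w (Suc n)) y) \<le> (1/3) ^ n / 2" using close[of "Suc n"] by simp
    qed (use c(2)[of n] in simp)
    finally have "(1/3) ^ n * c n / 2 \<le> mnorm E (S y)" by (simp add: mult.commute)
    moreover have "(1/3) ^ n * 4 ^ n \<le> (1/3) ^ n * c n" using c(1)[of n] by (intro mult_left_mono) simp_all
    ultimately show ?thesis by (simp add: power_divide)
  qed
  obtain n where "2 * mnorm E (S y) < (4/3) ^ n"
    using real_arch_pow[of "4/3" "2 * mnorm E (S y)"] by auto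
  then show False using lower[of n] by simp
qed

end

subsection \<open>Extension from a generating family\<close>

text \<open>A difference of sums of generators is again such a sum, so a bound on sums becomes an
  estimate for differences, as needed for Cauchy sequences.\<close>

lemma lsum_append_neg:
  assumes H: "hilbert_module H" and f: "\<And>i. i \<in> I \<Longrightarrow> f i \<in> mcar H"
    and n: "\<And>i. i \<in> I \<Longrightarrow> n i \<in> I" "\<And>i. i \<in> I \<Longrightarrow> f (n i) = mscale H (-1) (f i)"
    and sub: "set is \<subseteq> I" "set js \<subseteq> I"
  shows "lsum H f (is @ map n js) = mdiff H (lsum H f is) (lsum H f js)"
proof -
  interpret H: hilbert_module H by fact
  have car: "f i \<in> mcar H" if "i \<in> set is \<union> set js \<union> n ` set js" for i
    using that f sub n(1) by blast
  show ?thesis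
  proof (rule H.mip_eqI)
    fix z assume z: "z \<in> mcar H"
    have "(\<Sum>i\<leftarrow>map n js. mip H z (f i)) = - (\<Sum>i\<leftarrow>js. mip H z (f i))"
      using sub(2) f n(2) by (induction js) (auto simp: H.mip_simps z scaleC_minus_one)
    moreover have "mip H z (lsum H f (is @ map n js)) = (\<Sum>i\<leftarrow>is @ map n js. mip H z (f i))"
      using car z by (intro H.mip_lsum) auto
    moreover have "mip H z (mdiff H (lsum H f is) (lsum H f js))
        = (\<Sum>i\<leftarrow>is. mip H z (f i)) - (\<Sum>i\<leftarrow>js. mip H z (f i))"
      using car z by (simp add: H.mip_diff H.mip_lsum)
    ultimately show "mip H z (lsum H f (is @ map n js)) = mip H z (mdiff H (lsum H f is) (lsum H f js))"
      by simp
  qed (use car in \<open>auto intro!: H.mdiff_in H.lsum_in\<close>)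
qed

text \<open>The bound makes images of approximating sums converge. The family \<open>h\<close>, the
  intended values of the adjoint, settles well-definedness: the image of \<open>z\<close> is
  recorded through its inner products with the total family \<open>s\<close>, and these do not
  depend on the approximation chosen.\<close>

lemma extend_adjointable:
  assumes F: "hilbert_module F" and G: "hilbert_module G"
    and t: "total_family F t I" and s: "total_family G s J"
    and g: "\<And>i. i \<in> I \<Longrightarrow> g i \<in> mcar G" and h: "\<And>j. j \<in> J \<Longrightarrow> h j \<in> mcar F"
    and adj: "\<And>i j. i \<in> I \<Longrightarrow> j \<in> J \<Longrightarrow> mip G (g i) (s j) = mip F (t i) (h j)"
    and bound: "\<And>is. set is \<subseteq> I \<Longrightarrow> mnorm G (lsum G g is) \<le> C * mnorm F (lsum F t is)"
    and C: "0 \<le> C"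
    and neg: "\<And>i. i \<in> I \<Longrightarrow> \<exists>j\<in>I. t j = mscale F (-1) (t i) \<and> g j = mscale G (-1) (g i)"
  obtains T where "T \<in> adjointable F G" "\<And>i. i \<in> I \<Longrightarrow> T (t i) = g i"
    "\<And>z. z \<in> mcar F \<Longrightarrow> mnorm G (T z) \<le> C * mnorm F z"
proof -
  interpret F: hilbert_module F by fact
  interpret G: hilbert_module G by fact
  have t_in: "t i \<in> mcar F" if "i \<in> I" for i using totalD(1)[OF t that] .
  have s_in: "s j \<in> mcar G" if "j \<in> J" for j using totalD(1)[OF s that] .
  have lt: "lsum F t is \<in> mcar F" and lg: "lsum G g is \<in> mcar G" if "set is \<subseteq> I" for "is"
    using that t_in g by (intro F.lsum_in G.lsum_in; blast)+
  have lh: "lsum F h js \<in> mcar F" and ls: "lsum G s js \<in> mcar G" if "set js \<subseteq> J" for js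
    using that s_in h by (intro F.lsum_in G.lsum_in; blast)+
  obtain n where n: "\<And>i. i \<in> I \<Longrightarrow> n i \<in> I" "\<And>i. i \<in> I \<Longrightarrow> t (n i) = mscale F (-1) (t i)"
    "\<And>i. i \<in> I \<Longrightarrow> g (n i) = mscale G (-1) (g i)"
    using neg by metis
  have bound': "mnorm G (mdiff G (lsum G g is) (lsum G g js)) \<le> C * mnorm F (mdiff F (lsum F t is) (lsum F t js))"
    if sub: "set is \<subseteq> I" "set js \<subseteq> I" for "is" js
  proof -
    have "set (is @ map n js) \<subseteq> I" using sub n(1) by auto
    from bound[OF this] show ?thesis
      using lsum_append_neg[OF F, of I t n "is" js] lsum_append_neg[OF G, of I g n "is" js]
        n t_in g sub by simp
  qed
  have adj_sum: "mip G (lsum G g is) (lsum G s js) = mip F (lsum F t is) (lsum F h js)"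
    if "set is \<subseteq> I" "set js \<subseteq> J" for "is" js
  proof -
    have "mip G (g i) (lsum G s js) = mip F (t i) (lsum F h js)" if "i \<in> I" for i
    proof -
      have "mip G (g i) (lsum G s js) = (\<Sum>j\<leftarrow>js. mip G (g i) (s j))"
        using that \<open>set js \<subseteq> J\<close> s_in g by (intro G.mip_lsum) auto
      also have "\<dots> = (\<Sum>j\<leftarrow>js. mip F (t i) (h j))"
        using that \<open>set js \<subseteq> J\<close> adj by (intro arg_cong[of _ _ sum_list] map_cong) auto
      also have "\<dots> = mip F (t i) (lsum F h js)"
        using that \<open>set js \<subseteq> J\<close> t_in h by (intro F.mip_lsum[symmetric]) auto
      finally show ?thesis .
    qed
    then have "(\<Sum>i\<leftarrow>is. mip G (g i) (lsum G s js)) = (\<Sum>i\<leftarrow>is. mip F (t i) (lsum F h js))"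
      using that(1) by (intro arg_cong[of _ _ sum_list] map_cong) auto
    then show ?thesis
      using that g t_in by (subst G.mip_lsum_left F.mip_lsum_left; auto intro: ls lh)+
  qed
  have "\<exists>v\<in>mcar G. (\<forall>js. set js \<subseteq> J \<longrightarrow> mip G v (lsum G s js) = mip F z (lsum F h js)) \<and> mnorm G v \<le> C * mnorm F z"
    if z: "z \<in> mcar F" for z
  proof -
    obtain "is" where "is": "\<And>n. set (is n) \<subseteq> I"
      "\<And>n. mnorm F (mdiff F (lsum F t (is n)) z) \<le> inverse (real (Suc n))"
      "(\<lambda>n. mnorm F (mdiff F (lsum F t (is n)) z)) \<longlonglongrightarrow> 0"
      using total_seq[OF t F z] by metis
    have "mcauchy G (\<lambda>n. lsum G g (is n))"
    proof (rule G.mcauchyI)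
      fix m n
      have "mnorm F (mdiff F (lsum F t (is m)) (lsum F t (is n))) \<le> inverse (real (Suc m)) + inverse (real (Suc n))"
        using F.mnorm_diff_triangle[OF lt[OF "is"(1)] z lt[OF "is"(1)], of m n] "is"(2)[of m] "is"(2)[of n]
          F.mnorm_diff_commute[OF z lt[OF "is"(1)], of n] by simp
      then show "mnorm G (mdiff G (lsum G g (is m)) (lsum G g (is n)))
          \<le> C * inverse (real (Suc m)) + C * inverse (real (Suc n))"
        using bound'[OF "is"(1) "is"(1), of m n] mult_left_mono[OF _ C]
        by (metis (no_types, lifting) distrib_left order_trans)
      show "(\<lambda>n. C * inverse (real (Suc n))) \<longlonglongrightarrow> 0"
        by (intro tendsto_mult_right_zero LIMSEQ_inverse_real_of_nat)
    qed (use lg "is"(1) in blast)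
    then obtain v where v: "v \<in> mcar G" "(\<lambda>n. mnorm G (mdiff G (lsum G g (is n)) v)) \<longlonglongrightarrow> 0"
      using G.complete by blast
    have "mip G v (lsum G s js) = mip F z (lsum F h js)" if "set js \<subseteq> J" for js
      using G.mip_tendsto[OF lg[OF "is"(1)] v(1) ls[OF that] v(2)]
        F.mip_tendsto[OF lt[OF "is"(1)] z lh[OF that] "is"(3)] adj_sum[OF "is"(1) that]
      by (simp add: LIMSEQ_unique)
    moreover have "mnorm G v \<le> C * mnorm F z"
      by (rule LIMSEQ_le[OF G.mnorm_tendsto[OF lg[OF "is"(1)] v]
            tendsto_mult_left[OF F.mnorm_tendsto[OF lt[OF "is"(1)] z "is"(3)]]])
        (use bound "is"(1) in blast)
    ultimately show ?thesis using v(1) by blast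
  qed
  then obtain T where T: "\<And>z. z \<in> mcar F \<Longrightarrow> T z \<in> mcar G"
    "\<And>z js. z \<in> mcar F \<Longrightarrow> set js \<subseteq> J \<Longrightarrow> mip G (T z) (lsum G s js) = mip F z (lsum F h js)"
    "\<And>z. z \<in> mcar F \<Longrightarrow> mnorm G (T z) \<le> C * mnorm F z"
    by metis
  have "\<exists>u\<in>mcar F. \<forall>z\<in>mcar F. mip G (T z) y = mip F z u" if y: "y \<in> mcar G" for y
  proof -
    obtain js where js: "\<And>n. set (js n) \<subseteq> J"
      "\<And>n. mnorm G (mdiff G (lsum G s (js n)) y) \<le> inverse (real (Suc n))"
      "(\<lambda>n. mnorm G (mdiff G (lsum G s (js n)) y)) \<longlonglongrightarrow> 0"
      using total_seq[OF s G y] by metis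
    have "mcauchy F (\<lambda>n. lsum F h (js n))"
    proof (rule F.mcauchyI)
      fix m n
      define d where "d = mdiff F (lsum F h (js m)) (lsum F h (js n))"
      define e where "e = mdiff G (lsum G s (js m)) (lsum G s (js n))"
      have d: "d \<in> mcar F" by (simp add: d_def lh js(1))
      have e: "e \<in> mcar G" by (simp add: e_def ls js(1))
      \<comment> \<open>The sums of \<open>h\<close> inherit their bound from \<open>T\<close>:
        \<open>(mnorm F d)\<^sup>2\<close> is at most \<open>C * mnorm F d * mnorm G e\<close>, and
        one factor cancels.\<close>
      have "mip F d d = mip G (T d) e"
        using T(1,2)[OF d] by (subst (2) d_def) (simp add: e_def F.mip_simps G.mip_simps d lh ls js(1))
      then have "(mnorm F d)\<^sup>2 \<le> mnorm G (T d) * mnorm G e"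
        using G.norm_mip_le[OF T(1)[OF d] e] by (simp add: F.mnorm_power2)
      also have "\<dots> \<le> (C * mnorm F d) * mnorm G e"
        by (intro mult_right_mono T(3) d) simp
      finally have "mnorm F d * mnorm F d \<le> mnorm F d * (C * mnorm G e)"
        by (simp add: power2_eq_square mult.assoc mult.left_commute)
      then have "mnorm F d \<le> C * mnorm G e"
        using C F.mnorm_ge_0[of d] G.mnorm_ge_0[of e]
        by (cases "mnorm F d = 0") (auto simp: mult_le_cancel_left)
      moreover have "mnorm G e \<le> inverse (real (Suc m)) + inverse (real (Suc n))"
        using G.mnorm_diff_triangle[OF ls[OF js(1)] y ls[OF js(1)], of m n] js(2)[of m] js(2)[of n]
          G.mnorm_diff_commute[OF y ls[OF js(1)], of n] by (simp add: e_def)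
      ultimately show "mnorm F (mdiff F (lsum F h (js m)) (lsum F h (js n)))
          \<le> C * inverse (real (Suc m)) + C * inverse (real (Suc n))"
        using mult_left_mono[OF _ C] unfolding d_def
        by (metis (no_types, lifting) distrib_left order_trans)
      show "(\<lambda>n. C * inverse (real (Suc n))) \<longlonglongrightarrow> 0"
        by (intro tendsto_mult_right_zero LIMSEQ_inverse_real_of_nat)
    qed (use lh js(1) in blast)
    then obtain u where u: "u \<in> mcar F" "(\<lambda>n. mnorm F (mdiff F (lsum F h (js n)) u)) \<longlonglongrightarrow> 0"
      using F.complete by blast
    have "mip G (T z) y = mip F z u" if z: "z \<in> mcar F" for z
    proof -
      have eq: "mip G (lsum G s (js n)) (T z) = mip F (lsum F h (js n)) z" for n
        using arg_cong[OF T(2)[OF z js(1)[of n]], of star] T(1)[OF z]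
        by (simp add: G.mip_star F.mip_star ls lh js(1) z)
      have "mip G y (T z) = mip F u z"
        using G.mip_tendsto[OF ls[OF js(1)] y T(1)[OF z] js(3)]
          F.mip_tendsto[OF lh[OF js(1)] u(1) z u(2)]
        unfolding eq by (rule LIMSEQ_unique)
      from arg_cong[OF this, of star] show ?thesis
        by (simp add: G.mip_star F.mip_star T(1) z y u(1))
    qed
    then show ?thesis using u(1) by blast
  qed
  then obtain R where R: "\<And>y. y \<in> mcar G \<Longrightarrow> R y \<in> mcar F"
    "\<And>y z. y \<in> mcar G \<Longrightarrow> z \<in> mcar F \<Longrightarrow> mip G (T z) y = mip F z (R y)"
    by metis
  show thesis
  proof
    show "restrict T (mcar F) \<in> adjointable F G"
      by (rule adjointableI[where S = R]) (auto simp: T R)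
    show "restrict T (mcar F) (t i) = g i" if i: "i \<in> I" for i
    proof -
      have "T (t i) = g i"
      proof (rule total_eqI[OF s G T(1)[OF t_in[OF i]] g[OF i]])
        fix j assume j: "j \<in> J"
        have "mip G (T (t i)) (s j) = mip F (t i) (h j)"
          using T(2)[OF t_in[OF i], of "[j]"] j s_in h by (simp add: G.madd_zero F.madd_zero)
        also have "\<dots> = mip G (g i) (s j)" using adj[OF i j] by simp
        finally have "star (mip G (T (t i)) (s j)) = star (mip G (g i) (s j))" by simp
        then show "mip G (s j) (T (t i)) = mip G (s j) (g i)"
          using T(1) t_in[OF i] s_in[OF j] g[OF i] by (simp add: G.mip_star)
      qed
      then show ?thesis using t_in[OF i] by simp
    qed
    show "mnorm G (restrict T (mcar F) z) \<le> C * mnorm F z" if "z \<in> mcar F" for z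
      using T(3)[OF that] that by simp
  qed
qed

section \<open>Quotients and completions\<close>

text \<open>The common shape of all stages of the construction: both quotients, the completion and
  the recoding by \<open>encode\<close>. Such maps compose, so operations and inner products are
  traced through the whole chain at once. The source is only assumed to be closed under its
  operations, as formal tensors are not a module.\<close>

definition rmod_onto :: "('x \<Rightarrow> 'y) \<Rightarrow> ('b, 'x) rmod \<Rightarrow> ('b, 'y) rmod \<Rightarrow> bool" where
  "rmod_onto p E Q \<longleftrightarrow>
     mcar Q = p ` mcar E \<and> mzero E \<in> mcar E \<and> mzero Q = p (mzero E) \<and>
     (\<forall>x\<in>mcar E. \<forall>y\<in>mcar E. madd E x y \<in> mcar E \<and> madd Q (p x) (p y) = p (madd E x y)) \<and>
     (\<forall>x\<in>mcar E. \<forall>c. mscale E c x \<in> mcar E \<and> mscale Q c (p x) = p (mscale E c x)) \<and>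
     (\<forall>x\<in>mcar E. \<forall>b. mact E x b \<in> mcar E \<and> mact Q (p x) b = p (mact E x b)) \<and>
     (\<forall>x\<in>mcar E. \<forall>y\<in>mcar E. mip Q (p x) (p y) = mip E x y)"

lemma rmod_ontoD:
  assumes "rmod_onto p E Q"
  shows "mcar Q = p ` mcar E" "mzero E \<in> mcar E" "mzero Q = p (mzero E)"
    "x \<in> mcar E \<Longrightarrow> y \<in> mcar E \<Longrightarrow> madd E x y \<in> mcar E"
    "x \<in> mcar E \<Longrightarrow> y \<in> mcar E \<Longrightarrow> madd Q (p x) (p y) = p (madd E x y)"
    "x \<in> mcar E \<Longrightarrow> mscale E c x \<in> mcar E" "x \<in> mcar E \<Longrightarrow> mscale Q c (p x) = p (mscale E c x)"
    "x \<in> mcar E \<Longrightarrow> mact E x b \<in> mcar E" "x \<in> mcar E \<Longrightarrow> mact Q (p x) b = p (mact E x b)"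
    "x \<in> mcar E \<Longrightarrow> y \<in> mcar E \<Longrightarrow> mip Q (p x) (p y) = mip E x y"
    "x \<in> mcar E \<Longrightarrow> y \<in> mcar E \<Longrightarrow> mdiff Q (p x) (p y) = p (mdiff E x y)"
  using assms unfolding rmod_onto_def mdiff_def by auto

text \<open>The axioms are only required modulo \<open>p\<close>, because formal tensors satisfy them only up to
  \<open>tensor_eq\<close>.\<close>

lemma sip_module_ontoI:
  assumes onto: "rmod_onto p E Q"
    and "\<And>x y z. \<lbrakk>x \<in> mcar E; y \<in> mcar E; z \<in> mcar E\<rbrakk> \<Longrightarrow> p (madd E (madd E x y) z) = p (madd E x (madd E y z))"
    and "\<And>x y. \<lbrakk>x \<in> mcar E; y \<in> mcar E\<rbrakk> \<Longrightarrow> p (madd E x y) = p (madd E y x)"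
    and "\<And>x. x \<in> mcar E \<Longrightarrow> p (madd E x (mzero E)) = p x"
    and "\<And>x. x \<in> mcar E \<Longrightarrow> p (madd E x (mscale E (-1) x)) = p (mzero E)"
    and "\<And>c x y. \<lbrakk>x \<in> mcar E; y \<in> mcar E\<rbrakk> \<Longrightarrow> p (mscale E c (madd E x y)) = p (madd E (mscale E c x) (mscale E c y))"
    and "\<And>c d x. x \<in> mcar E \<Longrightarrow> p (mscale E (c + d) x) = p (madd E (mscale E c x) (mscale E d x))"
    and "\<And>c d x. x \<in> mcar E \<Longrightarrow> p (mscale E c (mscale E d x)) = p (mscale E (c * d) x)"
    and "\<And>x. x \<in> mcar E \<Longrightarrow> p (mscale E 1 x) = p x"
    and "\<And>x y b. \<lbrakk>x \<in> mcar E; y \<in> mcar E\<rbrakk> \<Longrightarrow> p (mact E (madd E x y) b) = p (madd E (mact E x b) (mact E y b))"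
    and "\<And>x a b. x \<in> mcar E \<Longrightarrow> p (mact E x (a + b)) = p (madd E (mact E x a) (mact E x b))"
    and "\<And>x a b. x \<in> mcar E \<Longrightarrow> p (mact E x (a * b)) = p (mact E (mact E x a) b)"
    and "\<And>c x b. x \<in> mcar E \<Longrightarrow> p (mact E (mscale E c x) b) = p (mscale E c (mact E x b))"
    and "\<And>c x b. x \<in> mcar E \<Longrightarrow> p (mact E x (c *\<^sub>C b)) = p (mscale E c (mact E x b))"
    and "\<And>x y z. \<lbrakk>x \<in> mcar E; y \<in> mcar E; z \<in> mcar E\<rbrakk> \<Longrightarrow> mip E x (madd E y z) = mip E x y + mip E x z"
    and "\<And>c x y. \<lbrakk>x \<in> mcar E; y \<in> mcar E\<rbrakk> \<Longrightarrow> mip E x (mscale E c y) = c *\<^sub>C mip E x y"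
    and "\<And>x y b. \<lbrakk>x \<in> mcar E; y \<in> mcar E\<rbrakk> \<Longrightarrow> mip E x (mact E y b) = mip E x y * b"
    and "\<And>x y. \<lbrakk>x \<in> mcar E; y \<in> mcar E\<rbrakk> \<Longrightarrow> star (mip E x y) = mip E y x"
    and "\<And>x. x \<in> mcar E \<Longrightarrow> cs_positive (mip E x x)"
  shows "sip_module Q"
proof -
  note D = rmod_ontoD[OF onto]
  have comm: "madd Q x y = madd Q y x" if "x \<in> p ` mcar E" "y \<in> p ` mcar E" for x y
    using that by (auto simp: D(5) assms(3))
  show ?thesis
    by (unfold_locales; (unfold D(1,3))?;
      ((rule comm; assumption) | ((elim imageE)?, simp add: D(2,4-10) assms(2,4-19))))
qed

lemma sip_module_onto:
  assumes "sip_module E" "rmod_onto p E Q"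
  shows "sip_module Q"
proof -
  interpret sip_module E by fact
  show ?thesis
    by (rule sip_module_ontoI[OF assms(2)];
      (rule arg_cong[of _ _ p], rule madd_commute; assumption | simp add: madd_assoc madd_zero madd_neg mscale_add_right mscale_add_left mscale_scale
        mscale_one mact_add_left mact_add_right mact_mult mact_scale_left mact_scale_right mip_add
        mip_scale mip_act mip_star mip_positive))
qed

lemma rmod_onto_mnorm:
  "rmod_onto p E Q \<Longrightarrow> x \<in> mcar E \<Longrightarrow> mnorm Q (p x) = mnorm E x"
  by (simp add: mnorm_def rmod_ontoD)

lemma rep_in_class:
  assumes "equiv A R" "X \<in> A // R"
  shows "rep X \<in> A" "R `` {rep X} = X"
proof -
  obtain x where x: "x \<in> A" "X = R `` {x}" using assms(2) by (rule quotientE)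
  then have "x \<in> X" using equiv_class_self[OF assms(1)] by simp
  then have "rep X \<in> X" unfolding rep_def by (rule someI)
  then have r: "(x, rep X) \<in> R" using x(2) by simp
  then show "rep X \<in> A" using equiv_type[OF assms(1)] by blast
  show "R `` {rep X} = X" using equiv_class_eq[OF assms(1) r] x(2) by simp
qed

lemma rep_class:
  assumes "equiv A R" "x \<in> A"
  shows "(x, rep (R `` {x})) \<in> R"
  using rep_in_class[OF assms(1) quotientI[OF assms(2)]]
  by (intro eq_equiv_class[OF _ assms(1)]) simp_all

lemma rmod_onto_quotient:
  assumes eq: "equiv (mcar E) R"
    and car: "mzero E \<in> mcar E" "\<And>x y. x \<in> mcar E \<Longrightarrow> y \<in> mcar E \<Longrightarrow> madd E x y \<in> mcar E"
      "\<And>c x. x \<in> mcar E \<Longrightarrow> mscale E c x \<in> mcar E" "\<And>x b. x \<in> mcar E \<Longrightarrow> mact E x b \<in> mcar E"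
    and cong: "\<And>x x' y y'. (x, x') \<in> R \<Longrightarrow> (y, y') \<in> R \<Longrightarrow> (madd E x y, madd E x' y') \<in> R"
      "\<And>c x x'. (x, x') \<in> R \<Longrightarrow> (mscale E c x, mscale E c x') \<in> R"
      "\<And>x x' b. (x, x') \<in> R \<Longrightarrow> (mact E x b, mact E x' b) \<in> R"
      "\<And>x x' y y'. (x, x') \<in> R \<Longrightarrow> (y, y') \<in> R \<Longrightarrow> mip E x y = mip E x' y'"
  shows "rmod_onto (\<lambda>x. R `` {x}) E (quotient_rmod R E)"
proof -
  have [simp]: "(x, rep (R `` {x})) \<in> R" if "x \<in> mcar E" for x
    by (rule rep_class[OF eq that])
  have cl: "R `` {x} = R `` {y}" if "(y, x) \<in> R" for x y
    using equiv_class_eq[OF eq that] by simp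
  have "mcar (quotient_rmod R E) = (\<lambda>x. R `` {x}) ` mcar E"
    by (auto simp: quotient_rmod_def quotient_def)
  moreover have "madd (quotient_rmod R E) (R `` {x}) (R `` {y}) = R `` {madd E x y}"
    if "x \<in> mcar E" "y \<in> mcar E" for x y
    unfolding quotient_rmod_def rmod.simps by (rule cl, rule cong(1)) (use that in simp_all)
  moreover have "mscale (quotient_rmod R E) c (R `` {x}) = R `` {mscale E c x}" if "x \<in> mcar E" for x c
    unfolding quotient_rmod_def rmod.simps by (rule cl, rule cong(2)) (use that in simp_all)
  moreover have "mact (quotient_rmod R E) (R `` {x}) b = R `` {mact E x b}" if "x \<in> mcar E" for x b
    unfolding quotient_rmod_def rmod.simps by (rule cl, rule cong(3)) (use that in simp_all)
  moreover have "mip (quotient_rmod R E) (R `` {x}) (R `` {y}) = mip E x y"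
    if "x \<in> mcar E" "y \<in> mcar E" for x y
    unfolding quotient_rmod_def rmod.simps by (rule cong(4)[symmetric]) (use that in simp_all)
  moreover have "mzero (quotient_rmod R E) = R `` {mzero E}" by (simp add: quotient_rmod_def)
  ultimately show ?thesis
    unfolding rmod_onto_def by (simp add: car)
qed

lemma rmod_onto_transport:
  assumes "sip_module E" "inj_on f (mcar E)"
  shows "rmod_onto f E (transport f E)"
proof -
  interpret sip_module E by fact
  show ?thesis
    using assms(2) by (auto simp: rmod_onto_def transport_def Let_def inv_into_f_f)
qed

lemma hilbert_module_transport:
  assumes "hilbert_module E" "inj_on f (mcar E)"
  shows "hilbert_module (transport f E)"
proof -
  interpret hilbert_module E by fact
  have onto: "rmod_onto f E (transport f E)"
    by (rule rmod_onto_transport[OF sip_module_axioms assms(2)])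
  note D = rmod_ontoD[OF onto]
  show ?thesis
  proof (rule hilbert_moduleI)
    show "sip_module (transport f E)" by (rule sip_module_onto[OF sip_module_axioms onto])
    show "x = mzero (transport f E)" if "x \<in> mcar (transport f E)" "mip (transport f E) x x = 0" for x
      using that unfolding D(1,3) by (auto simp: D(10) dest: ip_definite)
    fix s assume s: "mcauchy (transport f E) s"
    then have "\<forall>n. \<exists>y. y \<in> mcar E \<and> s n = f y" unfolding mcauchy_def D(1) by blast
    then obtain t where t: "\<And>n. t n \<in> mcar E" "\<And>n. s n = f (t n)" by metis
    have norm: "mnorm (transport f E) (mdiff (transport f E) (f x) (f y)) = mnorm E (mdiff E x y)"
      if "x \<in> mcar E" "y \<in> mcar E" for x y
      using that by (simp add: D(11) rmod_onto_mnorm[OF onto])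
    have "mcauchy E t" using s by (simp add: mcauchy_def t norm)
    then obtain x where "x \<in> mcar E" "(\<lambda>n. mnorm E (mdiff E (t n) x)) \<longlonglongrightarrow> 0"
      using complete by blast
    then show "\<exists>x\<in>mcar (transport f E).
        (\<lambda>n. mnorm (transport f E) (mdiff (transport f E) (s n) x)) \<longlonglongrightarrow> 0"
      by (intro bexI[of _ "f x"]) (simp_all add: t norm D(1))
  qed
qed

section \<open>The quotient by null vectors\<close>

context sip_module
begin

lemma null_rel_iff: "(x, y) \<in> null_rel E \<longleftrightarrow> x \<in> mcar E \<and> y \<in> mcar E \<and> mnorm E (mdiff E x y) = 0"
  by (auto simp: null_rel_def mnorm_def)

lemma equiv_null_rel: "equiv (mcar E) (null_rel E)"
proof (rule equivI)
  show "null_rel E \<subseteq> mcar E \<times> mcar E" by (auto simp: null_rel_def)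
  show "refl_on (mcar E) (null_rel E)"
    by (auto simp: refl_on_def null_rel_iff)
  show "sym (null_rel E)"
    by (auto simp: sym_def null_rel_iff mnorm_diff_commute)
  show "trans (null_rel E)"
  proof (rule transI)
    fix x y z assume "(x, y) \<in> null_rel E" "(y, z) \<in> null_rel E"
    then show "(x, z) \<in> null_rel E"
      using mnorm_diff_triangle[of x y z] mnorm_ge_0[of "mdiff E x z"] by (simp add: null_rel_iff)
  qed
qed

lemma null_quotient_onto: "rmod_onto (\<lambda>x. null_rel E `` {x}) E (null_quotient E)"
  unfolding null_quotient_def
proof (rule rmod_onto_quotient[OF equiv_null_rel])
  show "(madd E x y, madd E x' y') \<in> null_rel E" if "(x, x') \<in> null_rel E" "(y, y') \<in> null_rel E"
    for x x' y y'
    using that mnorm_add_diff_le[of x y x' y'] mnorm_ge_0[of "mdiff E (madd E x y) (madd E x' y')"]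
    by (simp add: null_rel_iff)
  show "(mscale E c x, mscale E c x') \<in> null_rel E" if "(x, x') \<in> null_rel E" for c x x'
    using that by (simp add: null_rel_iff mnorm_scale_diff)
  show "(mact E x b, mact E x' b) \<in> null_rel E" if "(x, x') \<in> null_rel E" for x x' b
    using that mnorm_act_diff_le[of x x' b] mnorm_ge_0[of "mdiff E (mact E x b) (mact E x' b)"]
    by (simp add: null_rel_iff)
  show "mip E x y = mip E x' y'" if "(x, x') \<in> null_rel E" "(y, y') \<in> null_rel E" for x x' y y'
    using that mip_diff_norm_le[of x y x' y'] by (simp add: null_rel_iff)
qed simp_all

lemma null_quotient_sip: "sip_module (null_quotient E)"
  by (rule sip_module_onto[OF sip_module_axioms null_quotient_onto])

lemma null_quotient_definite:
  assumes "X \<in> mcar (null_quotient E)" "mip (null_quotient E) X X = 0"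
  shows "X = mzero (null_quotient E)"
proof -
  note D = rmod_ontoD[OF null_quotient_onto]
  obtain x where x: "x \<in> mcar E" "X = null_rel E `` {x}" using assms(1) D(1) by auto
  then have "mip E x x = 0" using assms(2) D(10) by simp
  then have "(x, mzero E) \<in> null_rel E" using x(1) by (simp add: null_rel_def mip_simps)
  then show ?thesis using equiv_class_eq[OF equiv_null_rel] x(2) D(3) by simp
qed

section \<open>Cauchy sequences as a semi-inner product module\<close>

lemma mcauchy_in: "mcauchy E s \<Longrightarrow> s n \<in> mcar E"
  by (simp add: mcauchy_def)

text \<open>Ensures that the \<open>lim\<close> in the inner product of
  \<open>cauchy_sequences\<close> is a genuine limit; completeness of the coefficient algebra enters
  here.\<close>

lemma mip_convergent:
  assumes s: "mcauchy E s" and t: "mcauchy E t"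
  shows "(\<lambda>n. mip E (s n) (t n)) \<longlonglongrightarrow> mip (cauchy_sequences E) s t"
proof -
  obtain K where K: "K > 0" "\<And>n. mnorm E (s n) \<le> K" using mcauchy_bound[OF s] by blast
  obtain L where L: "L > 0" "\<And>n. mnorm E (t n) \<le> L" using mcauchy_bound[OF t] by blast
  have "Cauchy (\<lambda>n. mip E (s n) (t n))"
  proof (rule CauchyI)
    fix e :: real assume e: "0 < e"
    obtain M where M: "\<And>m n. m \<ge> M \<Longrightarrow> n \<ge> M \<Longrightarrow> mnorm E (mdiff E (s m) (s n)) < e / (2 * L)"
      using s e L(1) unfolding mcauchy_def by (meson divide_pos_pos mult_pos_pos zero_less_numeral)
    obtain N where N: "\<And>m n. m \<ge> N \<Longrightarrow> n \<ge> N \<Longrightarrow> mnorm E (mdiff E (t m) (t n)) < e / (2 * K)"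
      using t e K(1) unfolding mcauchy_def by (meson divide_pos_pos mult_pos_pos zero_less_numeral)
    have "norm (mip E (s m) (t m) - mip E (s n) (t n)) < e" if "m \<ge> max M N" "n \<ge> max M N" for m n
    proof -
      have "norm (mip E (s m) (t m) - mip E (s n) (t n))
          \<le> mnorm E (mdiff E (s m) (s n)) * mnorm E (t m) + mnorm E (s n) * mnorm E (mdiff E (t m) (t n))"
        by (intro mip_diff_norm_le mcauchy_in s t)
      also have "\<dots> \<le> mnorm E (mdiff E (s m) (s n)) * L + K * mnorm E (mdiff E (t m) (t n))"
        by (intro add_mono mult_left_mono mult_right_mono K L) simp_all
      also have "\<dots> < e / (2 * L) * L + K * (e / (2 * K))"
        using M[of m n] N[of m n] that K L
        by (intro add_strict_mono mult_strict_right_mono mult_strict_left_mono) auto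
      also have "\<dots> = e" using K(1) L(1) by simp
      finally show ?thesis .
    qed
    then show "\<exists>M. \<forall>m\<ge>M. \<forall>n\<ge>M. norm (mip E (s m) (t m) - mip E (s n) (t n)) < e" by blast
  qed
  then show ?thesis
    by (simp add: cauchy_sequences_def Cauchy_convergent_iff convergent_LIMSEQ_iff)
qed

lemma mcauchy_cong_bound:
  assumes "mcauchy E s" "\<And>n. f n \<in> mcar E" "0 \<le> K"
    "\<And>m n. mnorm E (mdiff E (f m) (f n)) \<le> K * mnorm E (mdiff E (s m) (s n))"
  shows "mcauchy E f"
  unfolding mcauchy_def
proof (intro conjI allI impI assms(2))
  fix \<epsilon> :: real assume "0 < \<epsilon>"
  then have "0 < \<epsilon> / (K + 1)" using assms(3) by simp
  then obtain N where N: "\<And>m n. m \<ge> N \<Longrightarrow> n \<ge> N \<Longrightarrow> mnorm E (mdiff E (s m) (s n)) < \<epsilon> / (K + 1)"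
    using assms(1) unfolding mcauchy_def by meson
  have "mnorm E (mdiff E (f m) (f n)) < \<epsilon>" if "m \<ge> N" "n \<ge> N" for m n
  proof -
    have "mnorm E (mdiff E (f m) (f n)) \<le> (K + 1) * mnorm E (mdiff E (s m) (s n))"
      using assms(4)[of m n] by (simp add: distrib_right add_increasing2)
    also have "\<dots> < (K + 1) * (\<epsilon> / (K + 1))"
      using N[OF that] assms(3) by (intro mult_strict_left_mono) auto
    finally show ?thesis using assms(3) by simp
  qed
  then show "\<exists>N. \<forall>m\<ge>N. \<forall>n\<ge>N. mnorm E (mdiff E (f m) (f n)) < \<epsilon>" by blast
qed

lemma mcauchy_add:
  assumes s: "mcauchy E s" and t: "mcauchy E t"
  shows "mcauchy E (\<lambda>n. madd E (s n) (t n))"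
  unfolding mcauchy_def
proof (intro conjI allI impI)
  fix \<epsilon> :: real assume "0 < \<epsilon>"
  then have "0 < \<epsilon> / 2" by simp
  then obtain M N where M: "\<And>m n. m \<ge> M \<Longrightarrow> n \<ge> M \<Longrightarrow> mnorm E (mdiff E (s m) (s n)) < \<epsilon> / 2"
    and N: "\<And>m n. m \<ge> N \<Longrightarrow> n \<ge> N \<Longrightarrow> mnorm E (mdiff E (t m) (t n)) < \<epsilon> / 2"
    using s t unfolding mcauchy_def by meson
  have "mnorm E (mdiff E (madd E (s m) (t m)) (madd E (s n) (t n))) < \<epsilon>"
    if "m \<ge> max M N" "n \<ge> max M N" for m n
    using mnorm_add_diff_le[of "s m" "t m" "s n" "t n"] M[of m n] N[of m n] that s t
    by (simp add: mcauchy_in)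
  then show "\<exists>N. \<forall>m\<ge>N. \<forall>n\<ge>N. mnorm E (mdiff E (madd E (s m) (t m)) (madd E (s n) (t n))) < \<epsilon>" by blast
qed (simp add: mcauchy_in s t)

lemma mcauchy_scale: "mcauchy E s \<Longrightarrow> mcauchy E (\<lambda>n. mscale E c (s n))"
  by (rule mcauchy_cong_bound[where K = "cmod c" and s = s]) (simp_all add: mcauchy_in mnorm_scale_diff)

lemma mcauchy_act: "mcauchy E s \<Longrightarrow> mcauchy E (\<lambda>n. mact E (s n) b)"
  by (rule mcauchy_cong_bound[where K = "norm b" and s = s])
    (simp_all add: mcauchy_in mnorm_act_diff_le mult.commute[of "norm b"])

lemma mcauchy_const: "x \<in> mcar E \<Longrightarrow> mcauchy E (\<lambda>n. x)"
  by (simp add: mcauchy_def)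

lemma cauchy_sequences_sel:
  "s \<in> mcar (cauchy_sequences E) \<longleftrightarrow> mcauchy E s"
  "mzero (cauchy_sequences E) = (\<lambda>n. mzero E)"
  "madd (cauchy_sequences E) s t = (\<lambda>n. madd E (s n) (t n))"
  "mscale (cauchy_sequences E) c s = (\<lambda>n. mscale E c (s n))"
  "mact (cauchy_sequences E) s b = (\<lambda>n. mact E (s n) b)"
  "mdiff (cauchy_sequences E) s t = (\<lambda>n. mdiff E (s n) (t n))"
  by (simp_all add: cauchy_sequences_def mdiff_def)

lemma cauchy_sequences_mip_eqI:
  assumes "mcauchy E s" "mcauchy E t" "(\<lambda>n. mip E (s n) (t n)) \<longlonglongrightarrow> l"
  shows "mip (cauchy_sequences E) s t = l"
  using mip_convergent[OF assms(1,2)] assms(3) by (rule LIMSEQ_unique)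

lemma madd_left_commute:
  "x \<in> mcar E \<Longrightarrow> y \<in> mcar E \<Longrightarrow> z \<in> mcar E \<Longrightarrow> madd E x (madd E y z) = madd E y (madd E x z)"
  by (simp add: madd_assoc[symmetric] madd_commute[of x y])

lemma cauchy_sequences_sip: "sip_module (cauchy_sequences E)"
proof unfold_locales
  fix x y z :: "nat \<Rightarrow> 'e" and c and b :: 'b
  assume x: "x \<in> mcar (cauchy_sequences E)"
  note x' = x[unfolded cauchy_sequences_sel]
  show "cs_positive (mip (cauchy_sequences E) x x)"
    using x' by (intro cs_positive_tendsto[OF mip_convergent[OF x' x']])
      (simp_all add: mip_positive mcauchy_in)
  assume y: "y \<in> mcar (cauchy_sequences E)"
  note y' = y[unfolded cauchy_sequences_sel]
  show "mip (cauchy_sequences E) x (mscale (cauchy_sequences E) c y) = c *\<^sub>C mip (cauchy_sequences E) x y"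
    unfolding cauchy_sequences_sel
    by (rule cauchy_sequences_mip_eqI[OF x' mcauchy_scale[OF y']])
      (use bounded_linear.tendsto[OF bounded_linear_scaleC mip_convergent[OF x' y']] in
        \<open>simp add: mip_simps mcauchy_in x' y'\<close>)
  show "mip (cauchy_sequences E) x (mact (cauchy_sequences E) y b) = mip (cauchy_sequences E) x y * b"
    unfolding cauchy_sequences_sel
    by (rule cauchy_sequences_mip_eqI[OF x' mcauchy_act[OF y']])
      (use tendsto_mult_right[OF mip_convergent[OF x' y'], of b] in
        \<open>simp add: mip_simps mcauchy_in x' y'\<close>)
  show "star (mip (cauchy_sequences E) x y) = mip (cauchy_sequences E) y x"
    by (rule cauchy_sequences_mip_eqI[OF y' x', symmetric])
      (use tendsto_star[OF mip_convergent[OF x' y']] in \<open>simp add: mip_star mcauchy_in x' y'\<close>)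
  assume z: "z \<in> mcar (cauchy_sequences E)"
  note z' = z[unfolded cauchy_sequences_sel]
  show "mip (cauchy_sequences E) x (madd (cauchy_sequences E) y z)
      = mip (cauchy_sequences E) x y + mip (cauchy_sequences E) x z"
    unfolding cauchy_sequences_sel
    by (rule cauchy_sequences_mip_eqI[OF x' mcauchy_add[OF y' z']])
      (use tendsto_add[OF mip_convergent[OF x' y'] mip_convergent[OF x' z']] in
        \<open>simp add: mip_simps mcauchy_in x' y' z'\<close>)
qed (auto simp: cauchy_sequences_sel mcauchy_in mcauchy_const mcauchy_add mcauchy_scale mcauchy_act
  madd_assoc madd_zero madd_neg mscale_add_right mscale_add_left mscale_scale mscale_one
  mact_add_left mact_add_right mact_mult mact_scale_left mact_scale_right madd_commute madd_left_commute)

lemma cauchy_sequences_mnorm: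
  assumes "mcauchy E s"
  shows "(\<lambda>n. mnorm E (s n)) \<longlonglongrightarrow> mnorm (cauchy_sequences E) s"
  unfolding mnorm_def by (intro tendsto_intros mip_convergent assms)

text \<open>The seminorm of the limit inner product is the limit of the norms. The completion is
  therefore another null quotient, and what is known about null quotients carries over to
  it.\<close>

lemma completion_rel_eq: "completion_rel E = null_rel (cauchy_sequences E)"
proof -
  interpret C: sip_module "cauchy_sequences E" by (rule cauchy_sequences_sip)
  have "(\<lambda>n. mnorm E (mdiff E (s n) (t n))) \<longlonglongrightarrow> 0 \<longleftrightarrow> mnorm (cauchy_sequences E) (mdiff (cauchy_sequences E) s t) = 0"
    if "mcauchy E s" "mcauchy E t" for s t
    using cauchy_sequences_mnorm[of "mdiff (cauchy_sequences E) s t"] C.mdiff_in[of s t] that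
    by (auto simp: cauchy_sequences_sel intro: LIMSEQ_unique)
  then show ?thesis
    by (auto simp: completion_rel_def C.null_rel_iff cauchy_sequences_sel)
qed

lemma completion_eq: "completion E = null_quotient (cauchy_sequences E)"
  by (simp add: completion_def null_quotient_def completion_rel_eq)

text \<open>Density of the constant sequences. It serves twice: for the completeness of the
  completion and for the totality of elementary tensors.\<close>

lemma mcauchy_approx:
  assumes "mcauchy E s"
  shows "(\<lambda>n. mnorm (cauchy_sequences E) (mdiff (cauchy_sequences E) (\<lambda>_. s n) s)) \<longlonglongrightarrow> 0"
proof (rule LIMSEQ_I)
  interpret C: sip_module "cauchy_sequences E" by (rule cauchy_sequences_sip)
  fix r :: real assume "0 < r"
  then obtain N where N: "\<And>m n. m \<ge> N \<Longrightarrow> n \<ge> N \<Longrightarrow> mnorm E (mdiff E (s m) (s n)) < r / 2"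
    using assms unfolding mcauchy_def by (meson half_gt_zero)
  have "norm (mnorm (cauchy_sequences E) (mdiff (cauchy_sequences E) (\<lambda>_. s n) s) - 0) < r" if "n \<ge> N" for n
  proof -
    have "mcauchy E (mdiff (cauchy_sequences E) (\<lambda>_. s n) s)"
      using C.mdiff_in[of "\<lambda>_. s n" s] assms by (simp add: cauchy_sequences_sel mcauchy_const mcauchy_in)
    then have "(\<lambda>m. mnorm E (mdiff E (s n) (s m))) \<longlonglongrightarrow>
        mnorm (cauchy_sequences E) (mdiff (cauchy_sequences E) (\<lambda>_. s n) s)"
      using cauchy_sequences_mnorm by (fastforce simp: cauchy_sequences_sel)
    then have "mnorm (cauchy_sequences E) (mdiff (cauchy_sequences E) (\<lambda>_. s n) s) \<le> r / 2"
      by (rule LIMSEQ_le_const2) (use N[OF that] in \<open>auto intro: less_imp_le\<close>)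
    then show ?thesis using \<open>0 < r\<close> by simp
  qed
  then show "\<exists>no. \<forall>n\<ge>no. norm (mnorm (cauchy_sequences E) (mdiff (cauchy_sequences E) (\<lambda>_. s n) s) - 0) < r"
    by blast
qed

text \<open>The k-th member of a Cauchy sequence of classes is replaced by a constant sequence
  \<open>y k\<close> at distance less than 1/(k+1). The resulting sequence \<open>y\<close> is
  Cauchy in \<open>E\<close>, and its own class is the limit.\<close>

lemma completion_hilbert: "hilbert_module (completion E)"
proof -
  interpret C: sip_module "cauchy_sequences E" by (rule cauchy_sequences_sip)
  let ?C = "cauchy_sequences E" and ?Q = "completion E"
  define p where "p = (\<lambda>s. null_rel ?C `` {s})"
  have onto: "rmod_onto p ?C ?Q"
    using C.null_quotient_onto by (simp add: p_def completion_eq)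
  interpret Q: sip_module ?Q by (rule sip_module_onto[OF C.sip_module_axioms onto])
  note D = rmod_ontoD[OF onto]
  have norm: "mnorm ?Q (mdiff ?Q (p x) (p y)) = mnorm ?C (mdiff ?C x y)"
    if "x \<in> mcar ?C" "y \<in> mcar ?C" for x y
    using that by (simp add: D(11) rmod_onto_mnorm[OF onto])
  show ?thesis
  proof (rule hilbert_moduleI[OF Q.sip_module_axioms])
    show "X = mzero ?Q" if "X \<in> mcar ?Q" "mip ?Q X X = 0" for X
      using C.null_quotient_definite that by (simp add: completion_eq)
    fix z assume z: "mcauchy ?Q z"
    then have "\<forall>n. \<exists>s. s \<in> mcar ?C \<and> z n = p s" unfolding mcauchy_def D(1) by blast
    then obtain s where s: "\<And>n. s n \<in> mcar ?C" "\<And>n. z n = p (s n)" by metis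
    have "\<exists>y\<in>mcar E. mnorm ?C (mdiff ?C (\<lambda>_. y) (s k)) < inverse (real (Suc k))" for k
    proof -
      have sk: "mcauchy E (s k)" using s(1) by (simp add: cauchy_sequences_sel)
      obtain n where "mnorm ?C (mdiff ?C (\<lambda>_. s k n) (s k)) < inverse (real (Suc k))"
        using LIMSEQ_D[OF mcauchy_approx[OF sk], of "inverse (real (Suc k))"] by auto
      then show ?thesis using mcauchy_in[OF sk] by blast
    qed
    then obtain y where y: "\<And>k. y k \<in> mcar E" "\<And>k. mnorm ?C (mdiff ?C (\<lambda>_. y k) (s k)) < inverse (real (Suc k))"
      by metis
    have yC: "(\<lambda>_. y k) \<in> mcar ?C" for k by (simp add: cauchy_sequences_sel mcauchy_const y)
    have const: "mnorm ?C (\<lambda>_. x) = mnorm E x" if "x \<in> mcar E" for x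
      using LIMSEQ_unique[OF cauchy_sequences_mnorm[OF mcauchy_const[OF that]] tendsto_const] .
    have yd: "mnorm E (mdiff E (y j) (y k)) = mnorm ?C (mdiff ?C (\<lambda>_. y j) (\<lambda>_. y k))" for j k
      using const[of "mdiff E (y j) (y k)"] y by (simp add: cauchy_sequences_sel)
    have "mcauchy E y"
      unfolding mcauchy_def
    proof (intro conjI allI impI y)
      fix \<epsilon> :: real assume "0 < \<epsilon>"
      then have "0 < \<epsilon> / 3" by simp
      then obtain M where M: "\<And>m n. m \<ge> M \<Longrightarrow> n \<ge> M \<Longrightarrow> mnorm ?Q (mdiff ?Q (z m) (z n)) < \<epsilon> / 3"
        using z unfolding mcauchy_def by meson
      obtain K where K: "\<And>k. k \<ge> K \<Longrightarrow> inverse (real (Suc k)) < \<epsilon> / 3"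
        using LIMSEQ_D[OF LIMSEQ_inverse_real_of_nat \<open>0 < \<epsilon> / 3\<close>] by auto
      have "mnorm E (mdiff E (y m) (y n)) < \<epsilon>" if "m \<ge> max M K" "n \<ge> max M K" for m n
      proof -
        have "mnorm E (mdiff E (y m) (y n)) \<le> mnorm ?C (mdiff ?C (\<lambda>_. y m) (s m))
            + (mnorm ?C (mdiff ?C (s m) (s n)) + mnorm ?C (mdiff ?C (s n) (\<lambda>_. y n)))"
          unfolding yd
          using C.mnorm_diff_triangle[OF yC[of m] s(1)[of m] yC[of n]]
            C.mnorm_diff_triangle[OF s(1)[of m] s(1)[of n] yC[of n]]
          by linarith
        moreover have "mnorm ?C (mdiff ?C (\<lambda>_. y m) (s m)) < \<epsilon> / 3"
          using y(2)[of m] K[of m] that by (intro less_trans[OF y(2)]) auto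
        moreover have "mnorm ?C (mdiff ?C (s n) (\<lambda>_. y n)) < \<epsilon> / 3"
          unfolding C.mnorm_diff_commute[OF s(1) yC]
          using K[of n] that by (intro less_trans[OF y(2)]) auto
        moreover have "mnorm ?C (mdiff ?C (s m) (s n)) < \<epsilon> / 3"
          using M[of m n] that by (simp add: s norm)
        ultimately show ?thesis by linarith
      qed
      then show "\<exists>N. \<forall>m\<ge>N. \<forall>n\<ge>N. mnorm E (mdiff E (y m) (y n)) < \<epsilon>" by blast
    qed
    then have yin: "y \<in> mcar ?C" by (simp add: cauchy_sequences_sel)
    show "\<exists>x\<in>mcar ?Q. (\<lambda>n. mnorm ?Q (mdiff ?Q (z n) x)) \<longlonglongrightarrow> 0"
    proof (rule bexI[of _ "p y"])
      show "p y \<in> mcar ?Q" using yin by (simp add: D(1))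
      have lim: "(\<lambda>n. inverse (real (Suc n)) + mnorm ?C (mdiff ?C (\<lambda>_. y n) y)) \<longlonglongrightarrow> 0"
        using tendsto_add[OF LIMSEQ_inverse_real_of_nat mcauchy_approx[OF \<open>mcauchy E y\<close>]] by simp
      have "mnorm ?Q (mdiff ?Q (z n) (p y)) \<le> inverse (real (Suc n)) + mnorm ?C (mdiff ?C (\<lambda>_. y n) y)" for n
        using C.mnorm_diff_triangle[OF s(1)[of n] yC[of n] yin] y(2)[of n]
          C.mnorm_diff_commute[OF s(1)[of n] yC[of n]]
        by (simp add: s norm yin)
      then show "(\<lambda>n. mnorm ?Q (mdiff ?Q (z n) (p y))) \<longlonglongrightarrow> 0"
        by (intro Lim_null_comparison[OF _ lim]) (simp add: always_eventually)
    qed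
  qed
qed

end

section \<open>The tensor product\<close>

lemma (in sip_module) msum_in: "(\<And>k. k < n \<Longrightarrow> f k \<in> mcar E) \<Longrightarrow> msum E f n \<in> mcar E"
  by (induction n) auto

lemma (in sip_module) mip_msum:
  "z \<in> mcar E \<Longrightarrow> (\<And>k. k < n \<Longrightarrow> f k \<in> mcar E) \<Longrightarrow> mip E z (msum E f n) = (\<Sum>k<n. mip E z (f k))"
  by (induction n) (auto simp: mip_add msum_in)

lemma (in sip_module) mip_msum_left:
  "z \<in> mcar E \<Longrightarrow> (\<And>k. k < n \<Longrightarrow> f k \<in> mcar E) \<Longrightarrow> mip E (msum E f n) z = (\<Sum>k<n. mip E (f k) z)"
  by (induction n) (auto simp: mip_add_left msum_in)

locale poscor = hilbert_module E
  for E :: "('b::cstar_algebra, 'e) rmod" +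
  fixes \<phi> :: "'a::cstar_algebra \<Rightarrow> 'e \<Rightarrow> 'e"
  assumes cp: "completely_positive E \<phi>" and strict: "strict_map E \<phi>"
begin

abbreviation "X \<equiv> (E, \<phi>)"
abbreviation "formal \<equiv> formal_tensors X"

lemma \<phi>_adjointable: "\<phi> a \<in> adjointable E E"
  using cp by (simp add: completely_positive_def)

lemma adjointable_map_\<phi>: "adjointable_map E E (\<phi> a)"
  by unfold_locales (rule \<phi>_adjointable)

lemma \<phi>_in [simp]: "x \<in> mcar E \<Longrightarrow> \<phi> a x \<in> mcar E"
  using \<phi>_adjointable by (rule adjointable_in)

lemma \<phi>_add: "x \<in> mcar E \<Longrightarrow> \<phi> (a + b) x = madd E (\<phi> a x) (\<phi> b x)"
  and \<phi>_scale: "x \<in> mcar E \<Longrightarrow> \<phi> (c *\<^sub>C a) x = mscale E c (\<phi> a x)"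
  using cp by (auto simp: completely_positive_def)

lemma mip_\<phi>:
  assumes "x \<in> mcar E" "y \<in> mcar E"
  shows "mip E y (\<phi> (a + b) x) = mip E y (\<phi> a x) + mip E y (\<phi> b x)"
    and "mip E y (\<phi> (c *\<^sub>C a) x) = c *\<^sub>C mip E y (\<phi> a x)"
    and "z \<in> mcar E \<Longrightarrow> mip E y (\<phi> a (madd E x z)) = mip E y (\<phi> a x) + mip E y (\<phi> a z)"
    and "mip E y (\<phi> a (mscale E c x)) = c *\<^sub>C mip E y (\<phi> a x)"
    and "mip E y (\<phi> a (mact E x d)) = mip E y (\<phi> a x) * d"
  using assms by (simp_all add: \<phi>_add \<phi>_scale mip_simps adjointable_map.T_add[OF adjointable_map_\<phi>]
      adjointable_map.T_scale[OF adjointable_map_\<phi>] adjointable_map.T_act[OF adjointable_map_\<phi>])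

lemma mip_\<phi>_zero: "x \<in> mcar E \<Longrightarrow> y \<in> mcar E \<Longrightarrow> mip E y (\<phi> 0 x) = 0"
  using mip_\<phi>(1)[of x y 0 0] by simp

text \<open>Complete positivity in weak form: the matrix of all \<phi>(star (a i) * a j) becomes a
  Gram matrix under the inner product. Symmetry and positivity of the tensor inner product are both
  read off from it.\<close>

lemma cp_factor:
  fixes n :: nat and a :: "nat \<Rightarrow> 'a"
  shows "\<exists>S. (\<forall>k<n. \<forall>j<n. \<forall>x\<in>mcar E. S k j x \<in> mcar E) \<and>
    (\<forall>i<n. \<forall>j<n. \<forall>x\<in>mcar E. \<forall>y\<in>mcar E.
      mip E y (\<phi> (star (a i) * a j) x) = (\<Sum>k<n. mip E (S k i y) (S k j x)))"
proof -
  have "matrix_positive n (\<lambda>i j. star (a i) * a j)"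
    unfolding matrix_positive_def
  proof (intro exI allI impI)
    fix i j assume "i < n" "j < n"
    \<comment> \<open>\<open>C\<close> has the row \<open>a\<close> at index 0 and zeros elsewhere.
      Index 0 is below \<open>n\<close> because \<open>i\<close> is.\<close>
    have "(\<Sum>k<n. star (if k = 0 then a i else 0) * (if k = 0 then a j else 0))
        = (\<Sum>k<n. if k = 0 then star (a i) * a j else 0)"
      by (intro sum.cong) auto
    also have "\<dots> = star (a i) * a j" using \<open>i < n\<close> by simp
    finally show "star (a i) * a j
        = (\<Sum>k<n. star (if k = 0 then a i else 0) * (if k = 0 then a j else 0))" by simp
  qed
  then have "operator_matrix_positive E n (\<lambda>i j. \<phi> (star (a i) * a j))"
    using cp by (auto simp: completely_positive_def)
  then obtain S where S: "\<And>i j. i < n \<Longrightarrow> j < n \<Longrightarrow> S i j \<in> adjointable E E"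
    "\<And>i j x. i < n \<Longrightarrow> j < n \<Longrightarrow> x \<in> mcar E
      \<Longrightarrow> \<phi> (star (a i) * a j) x = msum E (\<lambda>k. madjoint E E (S k i) (S k j x)) n"
    unfolding operator_matrix_positive_def by blast
  have am: "adjointable_map E E (S i j)" if "i < n" "j < n" for i j
    by unfold_locales (rule S(1)[OF that])
  have "mip E y (\<phi> (star (a i) * a j) x) = (\<Sum>k<n. mip E (S k i y) (S k j x))"
    if *: "i < n" "j < n" "x \<in> mcar E" "y \<in> mcar E" for i j x y
  proof -
    have "mip E y (\<phi> (star (a i) * a j) x) = (\<Sum>k<n. mip E y (madjoint E E (S k i) (S k j x)))"
      using * by (simp add: S(2) mip_msum adjointable_map.S_in[OF am] adjointable_map.in_F[OF am])
    also have "\<dots> = (\<Sum>k<n. mip E (S k i y) (S k j x))"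
      using * by (intro sum.cong) (simp_all add: adjointable_map.mip_T[OF am] adjointable_map.in_F[OF am])
    finally show ?thesis .
  qed
  then show ?thesis
    using adjointable_map.in_F[OF am] by (intro exI[of _ S]) blast
qed

text \<open>The Gram form for the two entries \<open>a\<close> and \<open>b\<close> is Hermitian.
  Products \<open>star a * b\<close> are exactly the arguments of \<phi> that occur in the tensor
  inner product.\<close>

lemma \<phi>_star:
  assumes x: "x \<in> mcar E" and y: "y \<in> mcar E"
  shows "star (mip E x (\<phi> (star a * b) y)) = mip E y (\<phi> (star b * a) x)"
proof -
  define f where "f i = (if i = 0 then a else b)" for i :: nat
  obtain S where S: "\<forall>k<2::nat. \<forall>j<2::nat. \<forall>x\<in>mcar E. S k j x \<in> mcar E"
    "\<forall>i<2. \<forall>j<2. \<forall>x\<in>mcar E. \<forall>y\<in>mcar E.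
      mip E y (\<phi> (star (f i) * f j) x) = (\<Sum>k<2. mip E (S k i y) (S k j x))"
    using cp_factor[of 2 f] by (elim exE conjE) (rule that)
  have "star (mip E x (\<phi> (star a * b) y)) = (\<Sum>k<2. star (mip E (S k 0 x) (S k 1 y)))"
    using S(2)[rule_format, of 0 1 y x] x y by (simp add: star_sum f_def)
  also have "\<dots> = (\<Sum>k<2. mip E (S k 1 y) (S k 0 x))"
    using x y by (intro sum.cong) (simp_all add: mip_star S(1))
  also have "\<dots> = mip E y (\<phi> (star b * a) x)"
    using S(2)[rule_format, of 1 0 x y] x y by (simp add: f_def)
  finally show ?thesis .
qed

lemma \<phi>_mip_left:
  assumes x: "x \<in> mcar E" and y: "y \<in> mcar E"
  shows "mip E (\<phi> (star a * b) x) y = mip E x (\<phi> (star b * a) y)"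
  using \<phi>_star[OF y x, of a b] x y by (simp add: mip_star)

section \<open>The inner product of formal tensors\<close>

definition pair_ip :: "'a \<times> 'e \<Rightarrow> 'a \<times> 'e \<Rightarrow> 'b" where
  "pair_ip p q = mip E (snd p) (\<phi> (star (fst p) * fst q) (snd q))"

lemma formal_sel:
  "mcar formal = {z. set_mset z \<subseteq> UNIV \<times> mcar E}" "mzero formal = {#}" "madd formal z w = z + w"
  "mscale formal c z = image_mset (\<lambda>(a, x). (c *\<^sub>C a, x)) z"
  "mact formal z b = image_mset (\<lambda>(a, x). (a, mact E x b)) z"
  "mip formal z w = (\<Sum>p\<in>#z. \<Sum>q\<in>#w. pair_ip p q)"
  by (simp_all add: formal_tensors_def pair_ip_def case_prod_unfold)

lemma pair_ip_simps:
  assumes "snd p \<in> mcar E" "x \<in> mcar E"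
  shows "pair_ip p (0, x) = 0" "pair_ip p (a + b, x) = pair_ip p (a, x) + pair_ip p (b, x)"
    "y \<in> mcar E \<Longrightarrow> pair_ip p (a, madd E x y) = pair_ip p (a, x) + pair_ip p (a, y)"
    "pair_ip p (c *\<^sub>C a, x) = c *\<^sub>C pair_ip p (a, x)"
    "pair_ip p (a, mscale E c x) = c *\<^sub>C pair_ip p (a, x)"
    "pair_ip p (a, mact E x d) = pair_ip p (a, x) * d"
  using assms by (simp_all add: pair_ip_def mip_\<phi> mip_\<phi>_zero distrib_left mult_scaleC_right)

lemma pair_ip_star: "snd p \<in> mcar E \<Longrightarrow> snd q \<in> mcar E \<Longrightarrow> star (pair_ip p q) = pair_ip q p"
  by (simp add: pair_ip_def \<phi>_star)

lemma tensor_eq_pair_ip: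
  "tensor_eq E z w \<Longrightarrow> snd p \<in> mcar E \<Longrightarrow> (\<Sum>q\<in>#z. pair_ip p q) = (\<Sum>q\<in>#w. pair_ip p q)"
  by (induction rule: tensor_eq.induct) (simp_all add: pair_ip_simps)

lemma tensor_eq_in: "tensor_eq E z w \<Longrightarrow> z \<in> mcar formal \<and> w \<in> mcar formal"
  by (induction rule: tensor_eq.induct) (auto simp: formal_sel)

lemma formal_mip_cong_right:
  assumes "tensor_eq E w w'" "z \<in> mcar formal"
  shows "mip formal z w = mip formal z w'"
  unfolding formal_sel using assms
  by (intro arg_cong[of _ _ sum_mset] image_mset_cong tensor_eq_pair_ip) (auto simp: formal_sel)

lemma star_sum_mset: "star (\<Sum>p\<in>#z. f p) = (\<Sum>p\<in>#z. star (f p :: 'b))"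
  by (induction z) (simp_all add: star_add)

lemma sum_mset_swap: "(\<Sum>p\<in>#z. \<Sum>q\<in>#w. f p q) = (\<Sum>q\<in>#w. \<Sum>p\<in>#z. f p q :: 'b)"
  by (induction z) (simp_all add: sum_mset.distrib)

lemma formal_mip_star:
  assumes "z \<in> mcar formal" "w \<in> mcar formal"
  shows "star (mip formal z w) = mip formal w z"
proof -
  have "star (mip formal z w) = (\<Sum>p\<in>#z. \<Sum>q\<in>#w. pair_ip q p)"
    unfolding formal_sel star_sum_mset using assms
    by (intro arg_cong[of _ _ sum_mset] image_mset_cong pair_ip_star) (auto simp: formal_sel)
  also have "\<dots> = mip formal w z" unfolding formal_sel(6) by (rule sum_mset_swap)
  finally show ?thesis .
qed

lemma formal_mip_cong:
  assumes "tensor_eq E z z'" "tensor_eq E w w'"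
  shows "mip formal z w = mip formal z' w'"
proof -
  note in_car = tensor_eq_in[OF assms(1)] tensor_eq_in[OF assms(2)]
  have "mip formal z w = mip formal z w'" using formal_mip_cong_right[OF assms(2)] in_car by simp
  also have "\<dots> = star (mip formal w' z)" using in_car by (simp add: formal_mip_star)
  also have "mip formal w' z = mip formal w' z'" using formal_mip_cong_right[OF assms(1)] in_car by simp
  also have "star \<dots> = mip formal z' w'" using in_car by (simp add: formal_mip_star)
  finally show ?thesis .
qed

text \<open>Inserting the factorization \<open>S\<close> and collecting the terms by row turns the
  double sum into the sum over k of \<langle>y k, y k\<rangle>, where \<open>y k\<close> is the k-th
  row of \<open>S\<close> applied to the vectors \<open>x j\<close>.\<close>

lemma formal_mip_positive:
  assumes "z \<in> mcar formal"
  shows "cs_positive (mip formal z z)"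
proof -
  obtain xs where xs: "mset xs = z" using ex_mset by blast
  define n where "n = length xs"
  define a where "a i = fst (xs ! i)" for i
  define x where "x i = snd (xs ! i)" for i
  have x: "x i \<in> mcar E" if "i < n" for i
  proof -
    have "xs ! i \<in> set xs" using that by (simp add: n_def)
    moreover have "set xs \<subseteq> UNIV \<times> mcar E" using assms by (simp add: formal_sel flip: xs)
    ultimately show ?thesis by (auto simp: x_def mem_Times_iff)
  qed
  obtain S where S': "\<forall>k<n. \<forall>j<n. \<forall>x\<in>mcar E. S k j x \<in> mcar E"
    "\<forall>i<n. \<forall>j<n. \<forall>x\<in>mcar E. \<forall>y\<in>mcar E.
      mip E y (\<phi> (star (a i) * a j) x) = (\<Sum>k<n. mip E (S k i y) (S k j x))"
    using cp_factor[of n a] by (elim exE conjE) (rule that)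
  note S = S'[rule_format]
  define y where "y k = msum E (\<lambda>j. S k j (x j)) n" for k
  have y: "y k \<in> mcar E" if "k < n" for k
    using that by (auto simp: y_def intro!: msum_in S x)
  have "mip formal z z = (\<Sum>i<n. \<Sum>j<n. mip E (x i) (\<phi> (star (a i) * a j) (x j)))"
    unfolding formal_sel xs[symmetric] pair_ip_def a_def x_def n_def
    by (simp add: sum_list_sum_nth atLeast0LessThan sum_mset_sum_list flip: mset_map)
  also have "\<dots> = (\<Sum>i<n. \<Sum>j<n. \<Sum>k<n. mip E (S k i (x i)) (S k j (x j)))"
    by (intro sum.cong HOL.refl S(2) x) auto
  also have "\<dots> = (\<Sum>i<n. \<Sum>k<n. \<Sum>j<n. mip E (S k i (x i)) (S k j (x j)))"
    by (rule sum.cong[OF HOL.refl]) (rule sum.swap)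
  also have "\<dots> = (\<Sum>k<n. \<Sum>i<n. \<Sum>j<n. mip E (S k i (x i)) (S k j (x j)))"
    by (rule sum.swap)
  also have "\<dots> = (\<Sum>k<n. mip E (y k) (y k))"
  proof (rule sum.cong[OF HOL.refl])
    fix k assume "k \<in> {..<n}"
    then have k: "k < n" by simp
    have "mip E (y k) (y k) = (\<Sum>i<n. mip E (S k i (x i)) (y k))"
      by (subst (1) y_def, rule mip_msum_left) (auto intro: y k S x)
    also have "\<dots> = (\<Sum>i<n. \<Sum>j<n. mip E (S k i (x i)) (S k j (x j)))"
      unfolding y_def by (intro sum.cong HOL.refl mip_msum) (auto intro: k S x)
    finally show "(\<Sum>i<n. \<Sum>j<n. mip E (S k i (x i)) (S k j (x j))) = mip E (y k) (y k)" by simp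
  qed
  also have "cs_positive \<dots>" by (intro cs_positive_sum mip_positive y) simp
  finally show ?thesis .
qed

section \<open>The algebraic tensor product as a quotient\<close>

lemma equiv_tensor_rel: "equiv (mcar formal) (tensor_rel X)"
proof (rule equivI)
  show "tensor_rel X \<subseteq> mcar formal \<times> mcar formal" using tensor_eq_in by (auto simp: tensor_rel_def)
  show "refl_on (mcar formal) (tensor_rel X)"
    by (auto simp: refl_on_def tensor_rel_def formal_sel intro: tensor_eq.refl)
  show "sym (tensor_rel X)" by (auto simp: sym_def tensor_rel_def intro: tensor_eq.sym)
  show "trans (tensor_rel X)" by (auto simp: trans_def tensor_rel_def intro: tensor_eq.trans)
qed

lemma tensor_eq_scale:
  "tensor_eq E z w \<Longrightarrow> tensor_eq E (mscale formal c z) (mscale formal c w)"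
proof (induction rule: tensor_eq.induct)
  case (scale x d a)
  have "tensor_eq E {#(d *\<^sub>C (c *\<^sub>C a), x)#} {#(c *\<^sub>C a, mscale E d x)#}"
    by (rule tensor_eq.scale[OF scale])
  then show ?case by (simp add: formal_sel scaleC_scaleC mult.commute)
next
  case (refl z)
  then show ?case by (intro tensor_eq.refl) (auto simp: formal_sel)
qed (auto simp: formal_sel scaleC_add_right intro: tensor_eq.intros)

lemma tensor_eq_act:
  "tensor_eq E z w \<Longrightarrow> tensor_eq E (mact formal z b) (mact formal w b)"
proof (induction rule: tensor_eq.induct)
  case (scale x d a)
  then show ?case
    using tensor_eq.scale[of "mact E x b" E d a] by (simp add: formal_sel mact_scale_left)
next
  case (refl z)
  then show ?case by (intro tensor_eq.refl) (auto simp: formal_sel)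
qed (auto simp: formal_sel mact_add_left intro: tensor_eq.intros)

lemma formal_closed:
  "{#} \<in> mcar formal" "z \<in> mcar formal \<Longrightarrow> w \<in> mcar formal \<Longrightarrow> z + w \<in> mcar formal"
  "z \<in> mcar formal \<Longrightarrow> mscale formal c z \<in> mcar formal" "z \<in> mcar formal \<Longrightarrow> mact formal z b \<in> mcar formal"
  by (auto simp: formal_sel)

lemma alg_tensor_onto: "rmod_onto (\<lambda>z. tensor_rel X `` {z}) formal (alg_tensor X)"
  unfolding alg_tensor_def
proof (rule rmod_onto_quotient[OF equiv_tensor_rel])
  show "mip formal x y = mip formal x' y'"
    if "(x, x') \<in> tensor_rel X" "(y, y') \<in> tensor_rel X" for x x' y y'
    using that by (intro formal_mip_cong) (auto simp: tensor_rel_def)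
  show "(mscale formal c x, mscale formal c x') \<in> tensor_rel X" if "(x, x') \<in> tensor_rel X" for c x x'
    using that by (auto simp: tensor_rel_def intro: tensor_eq_scale)
  show "(mact formal x b, mact formal x' b) \<in> tensor_rel X" if "(x, x') \<in> tensor_rel X" for b x x'
    using that by (auto simp: tensor_rel_def intro: tensor_eq_act)
  show "(madd formal x y, madd formal x' y') \<in> tensor_rel X"
    if "(x, x') \<in> tensor_rel X" "(y, y') \<in> tensor_rel X" for x x' y y'
    using that by (auto simp: tensor_rel_def formal_sel(3) intro: tensor_eq.plus)
qed (simp_all add: formal_closed formal_sel(2,3))

lemma tensor_eq_neg:
  "set_mset z \<subseteq> UNIV \<times> mcar E \<Longrightarrow> tensor_eq E (z + mscale formal (-1) z) {#}"
proof (induction z)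
  case empty
  show ?case by (simp add: formal_sel tensor_eq.refl)
next
  case (add p z)
  obtain a x where p: "p = (a, x)" by (cases p)
  have x: "x \<in> mcar E" using add.prems p by auto
  have "tensor_eq E {#(a, x), ((-1) *\<^sub>C a, x)#} {#(a + (-1) *\<^sub>C a, x)#}"
    by (rule tensor_eq.sym[OF tensor_eq.add_left[OF x]])
  also have "a + (-1) *\<^sub>C a = 0" by (simp add: scaleC_minus_one)
  finally have "tensor_eq E {#(a, x), ((-1) *\<^sub>C a, x)#} {#}"
    using tensor_eq.zero[OF x] tensor_eq.trans by metis
  moreover have "tensor_eq E (z + mscale formal (-1) z) {#}" using add by simp
  ultimately have "tensor_eq E ({#(a, x), ((-1) *\<^sub>C a, x)#} + (z + mscale formal (-1) z)) ({#} + {#})"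
    by (rule tensor_eq.plus)
  then show ?case by (simp add: p formal_sel add_mset_commute)
qed

lemma tensor_eq_scale_add:
  "set_mset z \<subseteq> UNIV \<times> mcar E
    \<Longrightarrow> tensor_eq E (mscale formal (c + d) z) (mscale formal c z + mscale formal d z)"
proof (induction z)
  case empty
  show ?case by (simp add: formal_sel tensor_eq.refl)
next
  case (add p z)
  obtain a x where p: "p = (a, x)" by (cases p)
  have x: "x \<in> mcar E" using add.prems p by auto
  have "tensor_eq E ({#(c *\<^sub>C a + d *\<^sub>C a, x)#} + mscale formal (c + d) z)
      ({#(c *\<^sub>C a, x), (d *\<^sub>C a, x)#} + (mscale formal c z + mscale formal d z))"
    using add by (intro tensor_eq.plus tensor_eq.add_left[OF x]) auto
  then show ?case by (simp add: p formal_sel scaleC_add_left add_mset_commute)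
qed

lemma tensor_eq_act_add:
  "set_mset z \<subseteq> UNIV \<times> mcar E
    \<Longrightarrow> tensor_eq E (mact formal z (b + d)) (mact formal z b + mact formal z d)"
proof (induction z)
  case empty
  show ?case by (simp add: formal_sel tensor_eq.refl)
next
  case (add p z)
  obtain a x where p: "p = (a, x)" by (cases p)
  have x: "x \<in> mcar E" using add.prems p by auto
  have "tensor_eq E ({#(a, madd E (mact E x b) (mact E x d))#} + mact formal z (b + d))
      ({#(a, mact E x b), (a, mact E x d)#} + (mact formal z b + mact formal z d))"
    using add x by (intro tensor_eq.plus tensor_eq.add_right) auto
  then show ?case by (simp add: p formal_sel mact_add_right x add_mset_commute)
qed

lemma tensor_eq_act_scale:
  "set_mset z \<subseteq> UNIV \<times> mcar E
    \<Longrightarrow> tensor_eq E (mact formal z (c *\<^sub>C b)) (mscale formal c (mact formal z b))"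
proof (induction z)
  case empty
  show ?case by (simp add: formal_sel tensor_eq.refl)
next
  case (add p z)
  obtain a x where p: "p = (a, x)" by (cases p)
  have x: "x \<in> mcar E" using add.prems p by auto
  have "tensor_eq E ({#(a, mscale E c (mact E x b))#} + mact formal z (c *\<^sub>C b))
      ({#(c *\<^sub>C a, mact E x b)#} + mscale formal c (mact formal z b))"
    using add x by (intro tensor_eq.plus tensor_eq.sym[OF tensor_eq.scale]) auto
  then show ?case by (simp add: p formal_sel mact_scale_right x)
qed

lemma alg_tensor_sip: "sip_module (alg_tensor X)"
proof (rule sip_module_ontoI[OF alg_tensor_onto])
  let ?c = "\<lambda>z. tensor_rel X `` {z}"
  have eq: "?c (z) = ?c (w)" if "tensor_eq E z w" for z w
    using equiv_class_eq[OF equiv_tensor_rel] that by (simp add: tensor_rel_def)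
  have id: "image_mset f z = z" if "z \<in> mcar formal" "\<And>a x. x \<in> mcar E \<Longrightarrow> f (a, x) = (a, x)" for f z
    using that image_mset_cong[of z f id] by (auto simp: formal_sel)
  fix x y z :: "('a \<times> 'e) multiset" and c d and a b :: 'b
  assume x: "x \<in> mcar formal"
  have x': "set_mset x \<subseteq> UNIV \<times> mcar E" using x by (simp add: formal_sel)
  show "?c (madd formal x (mzero formal)) = ?c (x)"
    by (simp add: formal_sel)
  show "?c (madd formal x (mscale formal (-1) x)) = ?c (mzero formal)"
    using eq[OF tensor_eq_neg[OF x']] by (simp add: formal_sel)
  show "?c (mscale formal (c + d) x) = ?c (madd formal (mscale formal c x) (mscale formal d x))"
    using eq[OF tensor_eq_scale_add[OF x']] by (simp add: formal_sel)
  show "?c (mscale formal c (mscale formal d x)) = ?c (mscale formal (c * d) x)"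
    by (simp add: formal_sel image_mset.compositionality comp_def case_prod_unfold scaleC_scaleC)
  show "?c (mscale formal 1 x) = ?c (x)"
    by (simp add: formal_sel(4) id[OF x] scaleC_one)
  show "?c (mact formal x (a + b)) = ?c (madd formal (mact formal x a) (mact formal x b))"
    using eq[OF tensor_eq_act_add[OF x']] by (simp add: formal_sel)
  have "mact formal x (a * b) = mact formal (mact formal x a) b"
    using x' unfolding formal_sel image_mset.compositionality
    by (intro image_mset_cong) (auto simp: mact_mult)
  then show "?c (mact formal x (a * b)) = ?c (mact formal (mact formal x a) b)"
    by simp
  show "?c (mact formal (mscale formal c x) b) = ?c (mscale formal c (mact formal x b))"
    by (simp add: formal_sel image_mset.compositionality comp_def case_prod_unfold)
  show "?c (mact formal x (c *\<^sub>C b)) = ?c (mscale formal c (mact formal x b))"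
    by (rule eq[OF tensor_eq_act_scale[OF x']])
  show "cs_positive (mip formal x x)" by (rule formal_mip_positive[OF x])
  assume y: "y \<in> mcar formal"
  show "?c (madd formal x y) = ?c (madd formal y x)"
    by (simp add: formal_sel add.commute)
  show "?c (mscale formal c (madd formal x y)) = ?c (madd formal (mscale formal c x) (mscale formal c y))"
    by (simp add: formal_sel)
  show "?c (mact formal (madd formal x y) b) = ?c (madd formal (mact formal x b) (mact formal y b))"
    by (simp add: formal_sel)
  show "star (mip formal x y) = mip formal y x" by (rule formal_mip_star[OF x y])
  have "(\<Sum>q\<in>#mscale formal c y. pair_ip p q) = c *\<^sub>C (\<Sum>q\<in>#y. pair_ip p q)" if "snd p \<in> mcar E" for p
    using y that unfolding formal_sel
    by (induction y) (auto simp: pair_ip_simps scaleC_add_right)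
  then have "mip formal x (mscale formal c y) = (\<Sum>p\<in>#x. c *\<^sub>C (\<Sum>q\<in>#y. pair_ip p q))"
    unfolding formal_sel(6) using x' by (intro arg_cong[of _ _ sum_mset] image_mset_cong) auto
  also have "\<dots> = c *\<^sub>C mip formal x y"
    unfolding formal_sel(6) by (induction x) (simp_all add: scaleC_add_right)
  finally show "mip formal x (mscale formal c y) = c *\<^sub>C mip formal x y" .
  have "(\<Sum>q\<in>#mact formal y b. pair_ip p q) = (\<Sum>q\<in>#y. pair_ip p q) * b" if "snd p \<in> mcar E" for p
    using y that unfolding formal_sel
    by (induction y) (auto simp: pair_ip_simps distrib_right)
  then have "mip formal x (mact formal y b) = (\<Sum>p\<in>#x. (\<Sum>q\<in>#y. pair_ip p q) * b)"
    unfolding formal_sel(6) using x' by (intro arg_cong[of _ _ sum_mset] image_mset_cong) auto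
  also have "\<dots> = mip formal x y * b"
    unfolding formal_sel(6) by (induction x) (simp_all add: distrib_right)
  finally show "mip formal x (mact formal y b) = mip formal x y * b" .
  show "?c (madd formal (madd formal x y) z) = ?c (madd formal x (madd formal y z))"
    by (simp add: formal_sel add.assoc)
  show "mip formal x (madd formal y z) = mip formal x y + mip formal x z"
    by (simp add: formal_sel sum_mset.distrib)
qed

end

section \<open>The KSGNS module\<close>

lemma rmod_onto_comp:
  assumes p: "rmod_onto p E Q" and r: "rmod_onto r Q S"
  shows "rmod_onto (\<lambda>x. r (p x)) E S"
proof -
  note P = rmod_ontoD[OF p] and D = rmod_ontoD[OF r]
  have in_Q: "p x \<in> mcar Q" if "x \<in> mcar E" for x using that by (simp add: P(1))
  show ?thesis
    unfolding rmod_onto_def using in_Q by (auto simp: D P image_image)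
qed

lemma sip_module_of_hilbert:
  assumes "hilbert_module E"
  shows "sip_module E"
proof -
  interpret hilbert_module E by fact
  show ?thesis by (rule sip_module_axioms)
qed

lemma mcar_null_quotient: "mcar (null_quotient E) = mcar E // null_rel E"
  by (simp add: null_quotient_def quotient_rmod_def)

lemma inj_on_rep: "equiv A R \<Longrightarrow> inj_on rep (A // R)"
  by (rule inj_onI) (metis rep_in_class(2))

locale ksgns_poscor = poscor E \<phi>
  for E :: "('b::cstar_algebra, ('a::cstar_algebra, 'k) univ) rmod"
    and \<phi> :: "'a \<Rightarrow> ('a, 'k) univ \<Rightarrow> ('a, 'k) univ"
begin

abbreviation "N \<equiv> null_quotient (alg_tensor X)"
abbreviation "CN \<equiv> cauchy_sequences N"
abbreviation "F \<equiv> ksgns_module X"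
abbreviation "\<tau> \<equiv> elementary_tensor X"

sublocale AT: sip_module "alg_tensor X" by (rule alg_tensor_sip)
sublocale N: sip_module N by (rule AT.null_quotient_sip)
sublocale CN: sip_module CN by (rule N.cauchy_sequences_sip)

section \<open>Formal tensors inside the completed module\<close>

definition nclass :: "('a \<times> ('a, 'k) univ) multiset \<Rightarrow> ('a \<times> ('a, 'k) univ) multiset set set" where
  "nclass z = null_rel (alg_tensor X) `` {tensor_rel X `` {z}}"

lemma nclass_onto: "rmod_onto nclass formal N"
  unfolding nclass_def by (rule rmod_onto_comp[OF alg_tensor_onto AT.null_quotient_onto])

lemma completion_N: "hilbert_module (completion N)"
  by (rule N.completion_hilbert)

text \<open>A class is determined by its chosen representative. Equality of codes is therefore
  lifted through the three nested quotients, from the tensor classes outwards to the classes of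
  Cauchy sequences.\<close>

lemma inj_on_encode: "inj_on encode (mcar (completion N))"
proof (rule inj_onI)
  fix c d assume c: "c \<in> mcar (completion N)" and d: "d \<in> mcar (completion N)" and eq: "encode c = encode d"
  have car: "mcar (completion N) = mcar CN // null_rel CN"
    by (simp add: N.completion_eq mcar_null_quotient)
  have inN: "rep e n \<in> mcar (alg_tensor X) // null_rel (alg_tensor X)" if "e \<in> mcar (completion N)" for e n
  proof -
    have "rep e \<in> mcar CN" using rep_in_class(1)[OF CN.equiv_null_rel] that by (simp add: car)
    then have "rep e n \<in> mcar N" by (simp add: N.cauchy_sequences_sel N.mcauchy_in)
    then show ?thesis by (simp add: mcar_null_quotient)
  qed
  have inT: "rep (rep e n) \<in> mcar formal // tensor_rel X" if "e \<in> mcar (completion N)" for e n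
    using rep_in_class(1)[OF AT.equiv_null_rel inN[OF that]] by (simp add: alg_tensor_def quotient_rmod_def)
  have "rep (rep (rep c n)) = rep (rep (rep d n))" for n
    using eq by (simp add: encode_def fun_eq_iff)
  then have "rep (rep c n) = rep (rep d n)" for n
    using inj_onD[OF inj_on_rep[OF equiv_tensor_rel] _ inT[OF c] inT[OF d]] by blast
  then have "rep c n = rep d n" for n
    using inj_onD[OF inj_on_rep[OF AT.equiv_null_rel] _ inN[OF c] inN[OF d]] by blast
  then have "rep c = rep d" by blast
  then show "c = d"
    using inj_onD[OF inj_on_rep[OF CN.equiv_null_rel]] c d by (simp add: car)
qed

lemma ksgns_hilbert: "hilbert_module F"
  unfolding ksgns_module_def by (rule hilbert_module_transport[OF completion_N inj_on_encode])

sublocale F: hilbert_module F by (rule ksgns_hilbert)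

definition limit :: "(nat \<Rightarrow> ('a \<times> ('a, 'k) univ) multiset set set) \<Rightarrow> ('a, 'k) univ" where
  "limit s = encode (null_rel CN `` {s})"

lemma limit_onto: "rmod_onto limit CN F"
proof -
  have "rmod_onto encode (completion N) F"
    unfolding ksgns_module_def
    by (rule rmod_onto_transport[OF _ inj_on_encode])
      (intro sip_module_of_hilbert completion_N)
  then show ?thesis
    unfolding limit_def
    by (rule rmod_onto_comp[OF CN.null_quotient_onto[folded N.completion_eq]])
qed

definition emb :: "('a \<times> ('a, 'k) univ) multiset \<Rightarrow> ('a, 'k) univ" where
  "emb z = limit (\<lambda>_. nclass z)"

lemma elementary_tensor_emb: "\<tau> a x = emb {#(a, x)#}"
  by (simp add: elementary_tensor_def emb_def limit_def nclass_def N.completion_rel_eq)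

lemma nclass_in: "z \<in> mcar formal \<Longrightarrow> nclass z \<in> mcar N"
  using rmod_ontoD(1)[OF nclass_onto] by blast

lemma const_in: "z \<in> mcar formal \<Longrightarrow> (\<lambda>_. nclass z) \<in> mcar CN"
  by (simp add: N.cauchy_sequences_sel N.mcauchy_const nclass_in)

lemma emb_in: "z \<in> mcar formal \<Longrightarrow> emb z \<in> mcar F"
  using rmod_ontoD(1)[OF limit_onto] const_in by (auto simp: emb_def)

lemma emb_mip:
  assumes "z \<in> mcar formal" "w \<in> mcar formal"
  shows "mip F (emb z) (emb w) = mip formal z w"
proof -
  have "mip F (emb z) (emb w) = mip CN (\<lambda>_. nclass z) (\<lambda>_. nclass w)"
    unfolding emb_def by (rule rmod_ontoD(10)[OF limit_onto]) (simp_all add: const_in assms)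
  also have "\<dots> = mip N (nclass z) (nclass w)"
    by (intro N.cauchy_sequences_mip_eqI N.mcauchy_const nclass_in assms) simp
  also have "\<dots> = mip formal z w" by (rule rmod_ontoD(10)[OF nclass_onto assms])
  finally show ?thesis .
qed

lemma emb_add:
  assumes "z \<in> mcar formal" "w \<in> mcar formal"
  shows "emb (z + w) = madd F (emb z) (emb w)"
  using rmod_ontoD(5)[OF limit_onto, of "\<lambda>_. nclass z" "\<lambda>_. nclass w"]
    rmod_ontoD(5)[OF nclass_onto assms] assms
  by (simp add: emb_def const_in N.cauchy_sequences_sel(3) formal_sel(3))

lemma emb_zero: "emb {#} = mzero F"
  using rmod_ontoD(3)[OF limit_onto] rmod_ontoD(3)[OF nclass_onto]
  by (simp add: emb_def N.cauchy_sequences_sel(2) formal_sel(2))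

abbreviation "gens \<equiv> UNIV \<times> mcar E"
abbreviation "\<tau>\<^sub>p \<equiv> \<lambda>p. \<tau> (fst p) (snd p)"

lemma single_in: "x \<in> mcar E \<Longrightarrow> {#(a, x)#} \<in> mcar formal"
  by (simp add: formal_sel)

lemma emb_lsum: "set ps \<subseteq> gens \<Longrightarrow> emb (mset ps) = lsum F \<tau>\<^sub>p ps"
proof (induction ps)
  case Nil
  then show ?case by (simp add: emb_zero)
next
  case (Cons p ps)
  have "emb ({#p#} + mset ps) = madd F (emb {#p#}) (emb (mset ps))"
    using Cons.prems by (intro emb_add) (auto simp: formal_sel)
  then show ?case using Cons by (simp add: elementary_tensor_emb)
qed

lemma \<tau>_in [simp]: "x \<in> mcar E \<Longrightarrow> \<tau> a x \<in> mcar F"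
  by (simp add: elementary_tensor_emb emb_in single_in)

lemma \<tau>_mip:
  "x \<in> mcar E \<Longrightarrow> y \<in> mcar E \<Longrightarrow> mip F (\<tau> a x) (\<tau> b y) = mip E x (\<phi> (star a * b) y)"
  by (simp add: elementary_tensor_emb emb_mip single_in formal_sel(6) pair_ip_def)

text \<open>Constant sequences approximate every Cauchy sequence, and the constant at the class of a
  formal tensor is a finite sum of elementary tensors.\<close>

lemma \<tau>_total: "total_family F \<tau>\<^sub>p gens"
  unfolding total_family_def
proof (intro conjI ballI allI impI)
  show "\<tau>\<^sub>p ` gens \<subseteq> mcar F" by auto
  fix z and \<epsilon> :: real assume z: "z \<in> mcar F" and \<epsilon>: "0 < \<epsilon>"
  note D = rmod_ontoD[OF limit_onto]
  obtain s where s: "s \<in> mcar CN" "z = limit s" using z D(1) by blast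
  have s': "mcauchy N s" using s(1) by (simp add: N.cauchy_sequences_sel)
  obtain n where n: "mnorm CN (mdiff CN (\<lambda>_. s n) s) < \<epsilon>"
    using LIMSEQ_D[OF N.mcauchy_approx[OF s'] \<epsilon>] by auto
  obtain w where w: "w \<in> mcar formal" "s n = nclass w"
    using N.mcauchy_in[OF s', of n] rmod_ontoD(1)[OF nclass_onto] by blast
  obtain ps where ps: "mset ps = w" using ex_mset by blast
  have "mnorm F (mdiff F z (emb w)) = mnorm CN (mdiff CN s (\<lambda>_. nclass w))"
    using s const_in[OF w(1)] rmod_onto_mnorm[OF limit_onto] D(11) by (simp add: emb_def)
  also have "\<dots> < \<epsilon>"
    using n CN.mnorm_diff_commute[OF s(1) const_in[OF w(1)]] w(2) by simp
  finally have "mnorm F (mdiff F z (lsum F \<tau>\<^sub>p ps)) < \<epsilon>"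
    using emb_lsum[of ps] w(1) by (simp add: ps[symmetric] formal_sel)
  then show "\<exists>is. set is \<subseteq> gens \<and> mnorm F (mdiff F z (lsum F \<tau>\<^sub>p is)) < \<epsilon>"
    using w(1) by (intro exI[of _ ps]) (simp add: ps[symmetric] formal_sel)
qed

lemma \<tau>_eqI:
  assumes "z \<in> mcar F" "w \<in> mcar F" "\<And>a x. x \<in> mcar E \<Longrightarrow> mip F (\<tau> a x) z = mip F (\<tau> a x) w"
  shows "z = w"
  using total_eqI[OF \<tau>_total ksgns_hilbert assms(1,2)] assms(3) by auto

lemma \<tau>_add: "x \<in> mcar E \<Longrightarrow> \<tau> (a + b) x = madd F (\<tau> a x) (\<tau> b x)"
  by (rule \<tau>_eqI) (simp_all add: F.mip_simps \<tau>_mip mip_\<phi> distrib_left)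

lemma \<tau>_scale: "x \<in> mcar E \<Longrightarrow> \<tau> (c *\<^sub>C a) x = mscale F c (\<tau> a x)"
  by (rule \<tau>_eqI) (simp_all add: F.mip_simps \<tau>_mip mip_\<phi> mult_scaleC_right)

lemma \<tau>_diff: "x \<in> mcar E \<Longrightarrow> \<tau> (a - b) x = mdiff F (\<tau> a x) (\<tau> b x)"
  using \<tau>_add[of x a "- b"] \<tau>_scale[of x "-1" b] by (simp add: mdiff_def scaleC_minus_one)

lemma \<tau>_neg: "p \<in> gens \<Longrightarrow> \<tau>\<^sub>p (- fst p, snd p) = mscale F (-1) (\<tau>\<^sub>p p)"
  using \<tau>_scale[of "snd p" "-1" "fst p"] by (auto simp: scaleC_minus_one)

lemma \<tau>_mnorm: "x \<in> mcar E \<Longrightarrow> (mnorm F (\<tau> a x))\<^sup>2 = norm (mip E x (\<phi> (star a * a) x))"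
  by (simp add: F.mnorm_power2 \<tau>_mip)

text \<open>Positive maps are bounded: if \<open>\<parallel>\<langle>x, \<phi>(a\<^sub>n\<^sup>* a\<^sub>n) x\<rangle>\<parallel> > 4\<^sup>n\<close> for contractions \<open>a\<^sub>n\<close>, then the
  element \<open>\<Sum> 2\<^sup>-\<^sup>n a\<^sub>n\<^sup>* a\<^sub>n\<close> dominates each of its terms.\<close>

lemma \<tau>_bounded:
  assumes x: "x \<in> mcar E"
  shows "\<exists>K\<ge>0. \<forall>a. mnorm F (\<tau> a x) \<le> K * norm a"
proof (rule ccontr)
  assume neg: "\<not> ?thesis"
  define f where "f c = mip E x (\<phi> c x)" for c
  have f_add: "f (c + d) = f c + f d" and f_scale: "f (r *\<^sub>R c) = r *\<^sub>R f c" for c d r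
    using x by (simp_all add: f_def mip_\<phi> scaleR_scaleC)
  have f_pos: "cs_positive (f c)" if pos: "cs_positive c" for c
  proof -
    obtain b where b: "c = star b * b" using pos by (auto simp: cs_positive_def)
    have "f c = mip F (\<tau> b x) (\<tau> b x)" using x by (simp add: f_def b \<tau>_mip)
    then show ?thesis using x by (simp add: F.mip_positive)
  qed
  have "\<exists>a. norm a \<le> 1 \<and> norm (f (star a * a)) > 4 ^ n" for n :: nat
  proof -
    have "\<not> (\<forall>a. mnorm F (\<tau> a x) \<le> 2 ^ n * norm a)" using neg by (meson zero_le_power zero_le_numeral)
    then obtain a where a: "mnorm F (\<tau> a x) > 2 ^ n * norm a" by (auto simp: not_le)
    have "a \<noteq> 0" using a x by (auto simp: mnorm_def \<tau>_mip mip_\<phi>_zero)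
    define b where "b = (1 / norm a) *\<^sub>R a"
    have "norm b = 1" using \<open>a \<noteq> 0\<close> by (simp add: b_def)
    have "mnorm F (\<tau> b x) = mnorm F (\<tau> a x) / norm a"
      using x \<open>a \<noteq> 0\<close> by (simp add: b_def scaleR_scaleC \<tau>_scale F.mnorm_scale norm_divide)
    then have "mnorm F (\<tau> b x) > 2 ^ n" using a \<open>a \<noteq> 0\<close> by (simp add: pos_less_divide_eq)
    then have "(2 ^ n)\<^sup>2 < (mnorm F (\<tau> b x))\<^sup>2" by (intro power_strict_mono) auto
    then have "4 ^ n < norm (f (star b * b))"
      unfolding \<tau>_mnorm[OF x] f_def by (simp add: power2_eq_square flip: power_mult_distrib)
    with \<open>norm b = 1\<close> show ?thesis by (intro exI[of _ b]) simp
  qed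
  then obtain a where a: "\<And>n::nat. norm (a n) \<le> 1" "\<And>n. norm (f (star (a n) * a n)) > 4 ^ n" by metis
  define c where "c n = (1/2) ^ n *\<^sub>R (star (a n) * a n)" for n
  have c_pos: "cs_positive (c n)" for n by (simp add: c_def cs_positive_scaleR)
  have c_le: "norm (c n) \<le> (1/2) ^ n" for n
    using a(1)[of n] by (simp add: c_def cstar_identity power_le_one mult_left_le)
  have "summable (\<lambda>n. (1/2 :: real) ^ n)" by (rule summable_geometric) simp
  then have "summable c"
    by (rule summable_comparison_test'[where N = 0]) (rule c_le)
  then have sums: "(\<lambda>m. \<Sum>k<m. c k) \<longlonglongrightarrow> suminf c" by (rule summable_LIMSEQ)
  have large: "2 ^ n \<le> norm (f (suminf c))" for n
  proof -
    have "cs_positive (suminf c - c n)"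
    proof (rule cs_positive_tendsto[where X = "\<lambda>m. (\<Sum>k<m. c k) - c n" and F = sequentially])
      show "(\<lambda>m. (\<Sum>k<m. c k) - c n) \<longlonglongrightarrow> suminf c - c n"
        by (intro tendsto_diff sums tendsto_const)
      show "\<forall>\<^sub>F m in sequentially. cs_positive ((\<Sum>k<m. c k) - c n)"
        using eventually_gt_at_top[of n]
      proof eventually_elim
        case (elim m)
        then have "(\<Sum>k<m. c k) - c n = (\<Sum>k\<in>{..<m} - {n}. c k)"
          by (subst sum.remove[of "{..<m}" n]) simp_all
        then show ?case by (simp add: cs_positive_sum c_pos)
      qed
    qed simp
    \<comment> \<open>Additivity and positivity of \<open>f\<close> suffice for the comparison with
      a single term, so \<open>f\<close> is never exchanged with the infinite sum.\<close>
    then have "cs_positive (f (suminf c) - f (c n))"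
      using f_add[of "suminf c - c n" "c n"] f_pos[of "suminf c - c n"] by simp
    then have "norm (f (c n)) \<le> norm (f (suminf c))"
      by (intro cs_positive_norm_mono f_pos c_pos)
    moreover have "norm (f (c n)) = (1/2) ^ n * norm (f (star (a n) * a n))"
      by (simp add: c_def f_scale)
    moreover have "(1/2) ^ n * 4 ^ n \<le> (1/2) ^ n * norm (f (star (a n) * a n))"
      using a(2)[of n] by (intro mult_left_mono) auto
    moreover have "(1/2) ^ n * 4 ^ n = (2::real) ^ n" by (simp flip: power_mult_distrib)
    ultimately show ?thesis by simp
  qed
  obtain n where "norm (f (suminf c)) < 2 ^ n" using real_arch_pow[of 2 "norm (f (suminf c))"] by auto
  then show False using large[of n] by simp
qed

end

lemma (in sip_module) mip_lsum_lsum: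
  assumes "\<And>p. p \<in> set ps \<Longrightarrow> f p \<in> mcar E" "\<And>q. q \<in> set qs \<Longrightarrow> g q \<in> mcar E"
  shows "mip E (lsum E f ps) (lsum E g qs) = (\<Sum>p\<leftarrow>ps. \<Sum>q\<leftarrow>qs. mip E (f p) (g q))"
proof -
  have "mip E (lsum E f ps) (lsum E g qs) = (\<Sum>p\<leftarrow>ps. mip E (f p) (lsum E g qs))"
    using assms by (intro mip_lsum_left) auto
  also have "\<dots> = (\<Sum>p\<leftarrow>ps. \<Sum>q\<leftarrow>qs. mip E (f p) (g q))"
    using assms by (intro arg_cong[of _ _ sum_list] map_cong mip_lsum) auto
  finally show ?thesis .
qed

lemma norm_sum_list_le: "norm (\<Sum>x\<leftarrow>xs. f x) \<le> (\<Sum>x\<leftarrow>xs. norm (f x :: 'a::real_normed_vector))"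
  by (induction xs) (auto intro: order_trans[OF norm_triangle_ineq])

text \<open>\<open>t n p\<close> plays the n-th iterate of an operator at the generator
  \<open>p\<close>. The operator itself need not exist on the module yet; this is essential, since
  the estimate is what will allow it to be defined. Finite sums change only the constant in the
  growth bound, which \<open>norm_mip_iterate_le\<close> removes.\<close>

lemma (in sip_module) norm_mip_lsum_iterate_le:
  assumes t: "\<And>n p. p \<in> set ps \<Longrightarrow> t n p \<in> mcar E"
    and sym: "\<And>m n p q. p \<in> set ps \<Longrightarrow> q \<in> set ps \<Longrightarrow> mip E (t m p) (t n q) = mip E (t 0 p) (t (m + n) q)"
    and growth: "\<And>p. p \<in> set ps \<Longrightarrow> \<exists>K. \<forall>n. mnorm E (t n p) \<le> K * r ^ n" and r: "0 \<le> r"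
  shows "norm (mip E (lsum E (t 0) ps) (lsum E (t 1) ps)) \<le> r * norm (mip E (lsum E (t 0) ps) (lsum E (t 0) ps))"
proof -
  obtain K where K: "\<And>p n. p \<in> set ps \<Longrightarrow> mnorm E (t n p) \<le> K p * r ^ n"
    using growth by metis
  define v where "v n = lsum E (t n) ps" for n
  have mip_v: "mip E (v m) (v n) = (\<Sum>p\<leftarrow>ps. \<Sum>q\<leftarrow>ps. mip E (t m p) (t n q))" for m n
    unfolding v_def by (intro mip_lsum_lsum t)
  have "norm (mip E (v 0) (v 1)) \<le> r * norm (mip E (v 0) (v 0))"
  proof (rule norm_mip_iterate_le)
    show "v n \<in> mcar E" for n unfolding v_def by (intro lsum_in t)
    show "mip E (v m) (v n) = mip E (v 0) (v (m + n))" for m n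
      unfolding mip_v by (intro arg_cong[of _ _ sum_list] map_cong HOL.refl sym)
    fix n
    have "norm (mip E (v 0) (v n)) \<le> (\<Sum>p\<leftarrow>ps. \<Sum>q\<leftarrow>ps. norm (mip E (t 0 p) (t n q)))"
      unfolding mip_v by (intro order_trans[OF norm_sum_list_le] sum_list_mono norm_sum_list_le)
    also have "\<dots> \<le> (\<Sum>p\<leftarrow>ps. \<Sum>q\<leftarrow>ps. mnorm E (t 0 p) * K q * r ^ n)"
    proof (intro sum_list_mono)
      fix p q assume p: "p \<in> set ps" and q: "q \<in> set ps"
      have "norm (mip E (t 0 p) (t n q)) \<le> mnorm E (t 0 p) * mnorm E (t n q)"
        by (intro norm_mip_le t p q)
      also have "\<dots> \<le> mnorm E (t 0 p) * (K q * r ^ n)" by (intro mult_left_mono K q) simp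
      finally show "norm (mip E (t 0 p) (t n q)) \<le> mnorm E (t 0 p) * K q * r ^ n" by (simp add: mult.assoc)
    qed
    also have "\<dots> = (\<Sum>p\<leftarrow>ps. \<Sum>q\<leftarrow>ps. mnorm E (t 0 p) * K q) * r ^ n"
      by (simp add: sum_list_mult_const)
    finally show "norm (mip E (v 0) (v n)) \<le> (\<Sum>p\<leftarrow>ps. \<Sum>q\<leftarrow>ps. mnorm E (t 0 p) * K q) * r ^ n" .
  qed (rule r)
  then show ?thesis by (simp add: v_def)
qed

subsection \<open>The representation\<close>

context ksgns_poscor
begin

abbreviation "\<pi> \<equiv> ksgns_rep X"

lemma star_funpow_mult:
  "star h = h \<Longrightarrow> star (((*) h ^^ m) a) * b = star a * ((*) h ^^ m) (b :: 'a)"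
proof (induction m arbitrary: b)
  case (Suc m)
  have "star (((*) h ^^ Suc m) a) * b = star (((*) h ^^ m) a) * (h * b)"
    by (simp add: star_mult mult.assoc Suc.prems)
  also have "\<dots> = star a * ((*) h ^^ m) (h * b)" by (rule Suc.IH[OF Suc.prems])
  also have "((*) h ^^ m) (h * b) = ((*) h ^^ Suc m) b" by (simp only: funpow_Suc_right comp_apply)
  finally show ?case .
qed simp

lemma norm_funpow_mult: "norm (((*) h ^^ n) (a :: 'a)) \<le> norm h ^ n * norm a"
proof (induction n)
  case (Suc n)
  have "norm (h * ((*) h ^^ n) a) \<le> norm h * (norm h ^ n * norm a)"
    by (intro order_trans[OF norm_mult_ineq] mult_left_mono Suc) simp
  then show ?case by (simp add: mult.assoc)
qed simp

text \<open>The iterated operator multiplies the first factor by \<open>h = star a * a\<close>.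
  \<open>\<tau>_bounded\<close> gives growth of order \<open>norm h ^ n\<close> on each generator,
  and \<open>norm h\<close> is the square of the desired constant.\<close>

lemma rep_bound_sum:
  assumes ps: "set ps \<subseteq> gens"
  shows "mnorm F (lsum F (\<lambda>p. \<tau> (a * fst p) (snd p)) ps) \<le> norm a * mnorm F (lsum F \<tau>\<^sub>p ps)"
proof (rule power2_le_imp_le)
  define h where "h = star a * a"
  have sh: "star h = h" by (simp add: h_def star_mult star_star)
  define t where "t = (\<lambda>n p. \<tau> (((*) h ^^ n) (fst p)) (snd p))"
  have snd: "snd p \<in> mcar E" if "p \<in> set ps" for p using that ps by auto
  have "norm (mip F (lsum F (t 0) ps) (lsum F (t 1) ps)) \<le> norm h * norm (mip F (lsum F (t 0) ps) (lsum F (t 0) ps))"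
  proof (rule F.norm_mip_lsum_iterate_le)
    show "t n p \<in> mcar F" if "p \<in> set ps" for n p using snd[OF that] by (simp add: t_def)
    show "mip F (t m p) (t n q) = mip F (t 0 p) (t (m + n) q)" if "p \<in> set ps" "q \<in> set ps" for m n p q
      using that snd by (simp add: t_def \<tau>_mip star_funpow_mult[OF sh] funpow_add)
    show "\<exists>K. \<forall>n. mnorm F (t n p) \<le> K * norm h ^ n" if p: "p \<in> set ps" for p
    proof -
      obtain K where K: "K \<ge> 0" "\<And>b. mnorm F (\<tau> b (snd p)) \<le> K * norm b"
        using \<tau>_bounded[OF snd[OF p]] by blast
      have "mnorm F (t n p) \<le> (K * norm (fst p)) * norm h ^ n" for n
      proof -
        have "mnorm F (t n p) \<le> K * norm (((*) h ^^ n) (fst p))" unfolding t_def by (rule K)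
        also have "\<dots> \<le> K * (norm h ^ n * norm (fst p))"
          by (intro mult_left_mono norm_funpow_mult K)
        finally show ?thesis by (simp add: ac_simps)
      qed
      then show ?thesis by blast
    qed
  qed simp
  moreover have "lsum F (t 0) ps = lsum F \<tau>\<^sub>p ps" by (simp add: t_def)
  moreover have "mip F (lsum F (t 0) ps) (lsum F (t 1) ps)
      = mip F (lsum F (\<lambda>p. \<tau> (a * fst p) (snd p)) ps) (lsum F (\<lambda>p. \<tau> (a * fst p) (snd p)) ps)"
    using snd by (subst (1 2) F.mip_lsum_lsum)
      (auto simp: t_def \<tau>_mip h_def star_mult mult.assoc intro!: arg_cong[of _ _ sum_list] map_cong)
  ultimately show "(mnorm F (lsum F (\<lambda>p. \<tau> (a * fst p) (snd p)) ps))\<^sup>2 \<le> (norm a * mnorm F (lsum F \<tau>\<^sub>p ps))\<^sup>2"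
    by (simp add: F.mnorm_power2 power_mult_distrib h_def cstar_identity)
qed simp

lemma rep_ex:
  "\<exists>T. T \<in> adjointable F F \<and> (\<forall>b. \<forall>x\<in>mcar E. T (\<tau> b x) = \<tau> (a * b) x) \<and> (\<forall>z\<in>mcar F. mnorm F (T z) \<le> norm a * mnorm F z)"
proof -
  obtain T where T: "T \<in> adjointable F F" "\<And>p. p \<in> gens \<Longrightarrow> T (\<tau>\<^sub>p p) = \<tau> (a * fst p) (snd p)"
    "\<And>z. z \<in> mcar F \<Longrightarrow> mnorm F (T z) \<le> norm a * mnorm F z"
  proof (rule extend_adjointable[OF ksgns_hilbert ksgns_hilbert \<tau>_total \<tau>_total,
        where g = "\<lambda>p. \<tau> (a * fst p) (snd p)" and h = "\<lambda>p. \<tau> (star a * fst p) (snd p)" and C = "norm a"])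
    show "mip F (\<tau> (a * fst p) (snd p)) (\<tau>\<^sub>p q) = mip F (\<tau>\<^sub>p p) (\<tau> (star a * fst q) (snd q))"
      if "p \<in> gens" "q \<in> gens" for p q
      using that by (auto simp: \<tau>_mip star_mult mult.assoc)
    show "\<exists>q\<in>gens. \<tau>\<^sub>p q = mscale F (-1) (\<tau>\<^sub>p p) \<and> \<tau> (a * fst q) (snd q) = mscale F (-1) (\<tau> (a * fst p) (snd p))"
      if "p \<in> gens" for p
      using that \<tau>_neg[of p] \<tau>_neg[of "(a * fst p, snd p)"] by (intro bexI[of _ "(- fst p, snd p)"]) auto
  qed (auto intro: rep_bound_sum)
  then show ?thesis by (intro exI[of _ T]) auto
qed

lemma rep_unique:
  assumes "T \<in> adjointable F F" "\<And>b x. x \<in> mcar E \<Longrightarrow> T (\<tau> b x) = \<tau> (a * b) x"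
    "T' \<in> adjointable F F" "\<And>b x. x \<in> mcar E \<Longrightarrow> T' (\<tau> b x) = \<tau> (a * b) x"
  shows "T = T'"
  by (rule adjointable_total_eqI[OF \<tau>_total ksgns_hilbert ksgns_hilbert assms(1,3)]) (auto simp: assms(2,4))

lemma ksgns_rep_eqI:
  assumes "T \<in> adjointable F F" "\<And>b x. x \<in> mcar E \<Longrightarrow> T (\<tau> b x) = \<tau> (a * b) x"
  shows "\<pi> a = T"
  unfolding ksgns_rep_def fst_conv
  by (rule the_equality) (use assms rep_unique in auto)

lemma rep_adjointable: "\<pi> a \<in> adjointable F F"
  and rep_\<tau>: "x \<in> mcar E \<Longrightarrow> \<pi> a (\<tau> b x) = \<tau> (a * b) x"
  and rep_bound: "z \<in> mcar F \<Longrightarrow> mnorm F (\<pi> a z) \<le> norm a * mnorm F z"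
proof -
  obtain T where T: "T \<in> adjointable F F" "\<forall>b. \<forall>x\<in>mcar E. T (\<tau> b x) = \<tau> (a * b) x"
    "\<forall>z\<in>mcar F. mnorm F (T z) \<le> norm a * mnorm F z"
    using rep_ex by blast
  have "\<pi> a = T" using T by (intro ksgns_rep_eqI) auto
  then show "\<pi> a \<in> adjointable F F" "x \<in> mcar E \<Longrightarrow> \<pi> a (\<tau> b x) = \<tau> (a * b) x"
    "z \<in> mcar F \<Longrightarrow> mnorm F (\<pi> a z) \<le> norm a * mnorm F z"
    using T by auto
qed

lemma adjointable_map_rep: "adjointable_map F F (\<pi> a)"
  by unfold_locales (rule rep_adjointable)

lemma rep_in [simp]: "z \<in> mcar F \<Longrightarrow> \<pi> a z \<in> mcar F"
  using rep_adjointable by (rule adjointable_in)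

lemma madjoint_rep: "madjoint F F (\<pi> a) = \<pi> (star a)"
proof (rule ksgns_rep_eqI[symmetric])
  interpret adjointable_map F F "\<pi> a" by (rule adjointable_map_rep)
  show "madjoint F F (\<pi> a) \<in> adjointable F F" by (rule S_adjointable)
  show "madjoint F F (\<pi> a) (\<tau> b x) = \<tau> (star a * b) x" if "x \<in> mcar E" for b x
    by (rule \<tau>_eqI) (simp_all add: that \<tau>_mip rep_\<tau> star_mult mult.assoc flip: mip_T)
qed

lemma rep_left: "z \<in> mcar F \<Longrightarrow> w \<in> mcar F \<Longrightarrow> mip F (\<pi> a z) w = mip F z (\<pi> (star a) w)"
  using adjointable_map.mip_T[OF adjointable_map_rep] by (simp add: madjoint_rep)

lemma rep_right: "z \<in> mcar F \<Longrightarrow> w \<in> mcar F \<Longrightarrow> mip F z (\<pi> a w) = mip F (\<pi> (star a) z) w"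
  by (simp add: rep_left star_star)

lemma rep_mult: "z \<in> mcar F \<Longrightarrow> \<pi> a (\<pi> b z) = \<pi> (a * b) z"
  by (rule \<tau>_eqI) (simp_all add: rep_right rep_\<tau> star_mult mult.assoc)

lemma rep_add: "z \<in> mcar F \<Longrightarrow> \<pi> (a + b) z = madd F (\<pi> a z) (\<pi> b z)"
  by (rule \<tau>_eqI) (simp_all add: F.mip_add rep_right rep_\<tau> star_add distrib_right \<tau>_add F.mip_add_left)

lemma rep_scale: "z \<in> mcar F \<Longrightarrow> \<pi> (c *\<^sub>C a) z = mscale F c (\<pi> a z)"
  by (rule \<tau>_eqI) (simp_all add: F.mip_scale rep_right rep_\<tau> star_scaleC mult_scaleC_left \<tau>_scale F.mip_scale_left)

lemma \<tau>_zero: "x \<in> mcar E \<Longrightarrow> \<tau> 0 x = mzero F"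
  by (rule \<tau>_eqI) (simp_all add: \<tau>_mip mip_\<phi>_zero)

lemma rep_zero: "z \<in> mcar F \<Longrightarrow> \<pi> 0 z = mzero F"
  by (rule \<tau>_eqI) (simp_all add: rep_right rep_\<tau> \<tau>_zero)

lemma rep_neg: "z \<in> mcar F \<Longrightarrow> \<pi> (- a) z = mscale F (-1) (\<pi> a z)"
  using rep_scale[of z "-1" a] by (simp add: scaleC_minus_one)

lemma rep_sum: "z \<in> mcar F \<Longrightarrow> \<pi> (\<Sum>k<n. f k) z = msum F (\<lambda>k. \<pi> (f k) z) n"
  by (induction n) (simp_all add: rep_zero rep_add)

text \<open>A *-homomorphism applied entrywise carries a factorization of \<open>M\<close> to a
  factorization of its image.\<close>

lemma rep_completely_positive: "completely_positive F \<pi>"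
  unfolding completely_positive_def
proof (intro conjI allI ballI impI)
  fix n and M :: "nat \<Rightarrow> nat \<Rightarrow> 'a"
  assume "matrix_positive n M"
  then obtain C where C: "\<And>i j. i < n \<Longrightarrow> j < n \<Longrightarrow> M i j = (\<Sum>k<n. star (C k i) * C k j)"
    unfolding matrix_positive_def by blast
  show "operator_matrix_positive F n (\<lambda>i j. \<pi> (M i j))"
    unfolding operator_matrix_positive_def
    by (intro exI[of _ "\<lambda>i j. \<pi> (C i j)"]) (simp add: rep_adjointable madjoint_rep rep_mult C rep_sum)
qed (simp_all add: rep_adjointable rep_add rep_scale)

text \<open>On an elementary tensor \<open>\<tau>_bounded\<close> turns the convergence of
  \<open>u * a\<close> to \<open>a\<close> into norm convergence. The uniform bound by
  \<open>norm u \<le> 1\<close> extends this from finite sums to all of \<open>F\<close>.\<close>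

lemma rep_approx:
  assumes U: "approximate_unit U" and z: "z \<in> mcar F"
  shows "((\<lambda>u. mnorm F (mdiff F (\<pi> u z) z)) \<longlongrightarrow> 0) U"
proof (rule tendstoI)
  fix \<epsilon> :: real assume "0 < \<epsilon>"
  then obtain ps where ps: "set ps \<subseteq> gens" "mnorm F (mdiff F z (lsum F \<tau>\<^sub>p ps)) < \<epsilon> / 3"
    using totalD(2)[OF \<tau>_total z, of "\<epsilon> / 3"] by auto
  have "((\<lambda>u. mnorm F (mdiff F (\<pi> u (lsum F \<tau>\<^sub>p ps)) (lsum F \<tau>\<^sub>p ps))) \<longlongrightarrow> 0) U"
    using ps(1)
  proof (induction ps)
    case Nil
    then show ?case by (simp add: adjointable_map.T_zero[OF adjointable_map_rep])
  next
    case (Cons p ps)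
    obtain a x where p: "p = (a, x)" and x: "x \<in> mcar E" using Cons.prems by auto
    obtain K where K: "K \<ge> 0" "\<And>b. mnorm F (\<tau> b x) \<le> K * norm b"
      using \<tau>_bounded[OF x] by blast
    define w where "w = lsum F \<tau>\<^sub>p ps"
    have w: "w \<in> mcar F" unfolding w_def using Cons.prems by (intro F.lsum_in) auto
    have "((\<lambda>u. u * a) \<longlongrightarrow> a) U" using U by (simp add: approximate_unit_def)
    then have "((\<lambda>u. K * norm (u * a - a)) \<longlongrightarrow> K * 0) U"
      by (intro tendsto_mult_left tendsto_norm_zero) (simp add: LIM_zero)
    then have "((\<lambda>u. K * norm (u * a - a) + mnorm F (mdiff F (\<pi> u w) w)) \<longlongrightarrow> 0) U"
      using tendsto_add[of "\<lambda>u. K * norm (u * a - a)" 0 U "\<lambda>u. mnorm F (mdiff F (\<pi> u w) w)" 0] Cons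
      by (simp add: w_def)
    then show ?case
    proof (rule Lim_null_comparison[rotated], intro always_eventually allI)
      fix u
      have "mnorm F (mdiff F (\<pi> u (madd F (\<tau> a x) w)) (madd F (\<tau> a x) w))
          \<le> mnorm F (mdiff F (\<tau> (u * a) x) (\<tau> a x)) + mnorm F (mdiff F (\<pi> u w) w)"
        using x w by (simp add: adjointable_map.T_add[OF adjointable_map_rep] rep_\<tau> F.mnorm_add_diff_le)
      also have "mnorm F (mdiff F (\<tau> (u * a) x) (\<tau> a x)) \<le> K * norm (u * a - a)"
        using K(2)[of "u * a - a"] x by (simp add: \<tau>_diff)
      finally show "norm (mnorm F (mdiff F (\<pi> u (lsum F \<tau>\<^sub>p (p # ps))) (lsum F \<tau>\<^sub>p (p # ps))))
          \<le> K * norm (u * a - a) + mnorm F (mdiff F (\<pi> u w) w)"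
        by (simp add: p w_def)
    qed
  qed
  then have "\<forall>\<^sub>F u in U. mnorm F (mdiff F (\<pi> u (lsum F \<tau>\<^sub>p ps)) (lsum F \<tau>\<^sub>p ps)) < \<epsilon> / 3"
    using \<open>0 < \<epsilon>\<close> by (intro order_tendstoD) auto
  moreover have "\<forall>\<^sub>F u in U. norm u \<le> 1"
    using U unfolding approximate_unit_def by (auto elim: eventually_mono)
  ultimately show "\<forall>\<^sub>F u in U. dist (mnorm F (mdiff F (\<pi> u z) z)) 0 < \<epsilon>"
  proof eventually_elim
    case (elim u)
    define w where "w = lsum F \<tau>\<^sub>p ps"
    have w: "w \<in> mcar F" unfolding w_def using ps(1) by (intro F.lsum_in) auto
    have "mnorm F (mdiff F (\<pi> u z) (\<pi> u w)) = mnorm F (\<pi> u (mdiff F z w))"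
      using z w by (simp add: adjointable_map.T_diff[OF adjointable_map_rep])
    also have "\<dots> \<le> norm u * mnorm F (mdiff F z w)" using z w by (intro rep_bound) simp
    also have "\<dots> \<le> mnorm F (mdiff F z w)" using elim by (intro mult_left_le_one_le) simp_all
    finally have "mnorm F (mdiff F (\<pi> u z) (\<pi> u w)) < \<epsilon> / 3" using ps(2) by (simp add: w_def)
    moreover have "mnorm F (mdiff F w z) < \<epsilon> / 3"
      using ps(2) F.mnorm_diff_commute[OF w z] by (simp add: w_def)
    moreover have "mnorm F (mdiff F (\<pi> u z) z) \<le> mnorm F (mdiff F (\<pi> u z) (\<pi> u w))
        + (mnorm F (mdiff F (\<pi> u w) w) + mnorm F (mdiff F w z))"
      using F.mnorm_diff_triangle[of "\<pi> u z" "\<pi> u w" z] F.mnorm_diff_triangle[of "\<pi> u w" w z] z w by simp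
    ultimately show ?case using elim by (simp add: w_def)
  qed
qed

text \<open>The net \<pi>(u) converges strongly to the identity. An approximate unit consists
  eventually of self-adjoint elements, so one estimate covers the operators and their
  adjoints.\<close>

lemma rep_strict: "strict_map F \<pi>"
proof -
  obtain U :: "'a filter" where U: "approximate_unit U" using strict by (auto simp: strict_map_def)
  have "strictly_cauchy F (filtermap \<pi> U)"
    unfolding strictly_cauchy_def
  proof (intro ballI allI impI)
    fix z and \<epsilon> :: real assume z: "z \<in> mcar F" and \<epsilon>: "0 < \<epsilon>"
    \<comment> \<open>The predicate lives on operators, because the filter does. It remembers a
      self-adjoint \<open>u\<close> so that \<open>madjoint_rep\<close> can evaluate the
      adjoint.\<close>
    define Q where "Q T \<longleftrightarrow> (\<exists>u. T = \<pi> u \<and> star u = u \<and> mnorm F (mdiff F (\<pi> u z) z) < \<epsilon> / 2)" for T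
    have "\<forall>\<^sub>F u in U. mnorm F (mdiff F (\<pi> u z) z) < \<epsilon> / 2"
      using rep_approx[OF U z] \<epsilon> by (intro order_tendstoD) auto
    moreover have "\<forall>\<^sub>F u in U. star u = u"
      using U unfolding approximate_unit_def by (auto elim: eventually_mono simp: cs_positive_star)
    ultimately have "\<forall>\<^sub>F u in U. Q (\<pi> u)"
      by eventually_elim (auto simp: Q_def)
    then have Q: "eventually Q (filtermap \<pi> U)" by (simp add: eventually_filtermap)
    have close: "mnorm F (mdiff F (\<pi> u z) (\<pi> v z)) < \<epsilon>"
      if "mnorm F (mdiff F (\<pi> u z) z) < \<epsilon> / 2" "mnorm F (mdiff F (\<pi> v z) z) < \<epsilon> / 2" for u v
      using that F.mnorm_diff_triangle[of "\<pi> u z" z "\<pi> v z"] F.mnorm_diff_commute[of "\<pi> v z" z] z by simp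
    show "\<forall>\<^sub>F (S, T) in filtermap \<pi> U \<times>\<^sub>F filtermap \<pi> U.
        mnorm F (mdiff F (S z) (T z)) < \<epsilon> \<and> mnorm F (mdiff F (madjoint F F S z) (madjoint F F T z)) < \<epsilon>"
      unfolding eventually_prod_same
    proof (intro exI[of _ Q] conjI allI impI Q)
      fix S T assume "Q S" "Q T"
      then show "case (S, T) of (S, T) \<Rightarrow> mnorm F (mdiff F (S z) (T z)) < \<epsilon> \<and>
          mnorm F (mdiff F (madjoint F F S z) (madjoint F F T z)) < \<epsilon>"
        by (auto simp: Q_def madjoint_rep close)
    qed
  qed
  with U show ?thesis by (auto simp: strict_map_def)
qed

lemma ksgns_poscor_rep: "ksgns_poscor F \<pi>"
  by unfold_locales (rule rep_completely_positive rep_strict)+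

text \<open>Non-degeneracy of \<pi>: the single vector \<pi>(u) z, with \<open>u\<close> far out in
  an approximate unit, already approximates \<open>z\<close>.\<close>

lemma rep_total: "total_family F (\<lambda>p. \<pi> (fst p) (snd p)) (UNIV \<times> mcar F)"
  unfolding total_family_def
proof (intro conjI ballI allI impI)
  show "(\<lambda>p. \<pi> (fst p) (snd p)) ` (UNIV \<times> mcar F) \<subseteq> mcar F" by auto
  fix z and \<epsilon> :: real assume z: "z \<in> mcar F" and \<epsilon>: "0 < \<epsilon>"
  obtain U :: "'a filter" where U: "approximate_unit U" using strict by (auto simp: strict_map_def)
  have "\<forall>\<^sub>F u in U. mnorm F (mdiff F (\<pi> u z) z) < \<epsilon>"
    using rep_approx[OF U z] \<epsilon> by (intro order_tendstoD) auto
  moreover have "U \<noteq> bot" using U by (simp add: approximate_unit_def)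
  ultimately obtain u where u: "mnorm F (mdiff F (\<pi> u z) z) < \<epsilon>"
    using eventually_happens by blast
  show "\<exists>is. set is \<subseteq> UNIV \<times> mcar F \<and> mnorm F (mdiff F z (lsum F (\<lambda>p. \<pi> (fst p) (snd p)) is)) < \<epsilon>"
    using u z F.mnorm_diff_commute[of z "\<pi> u z"] by (intro exI[of _ "[(u, z)]"]) (simp add: F.madd_zero)
qed

end

subsection \<open>Morphisms\<close>

lemma star_automorphismD:
  assumes "star_automorphism \<alpha>"
  shows "bij \<alpha>" "\<alpha> (a + b) = \<alpha> a + \<alpha> b" "\<alpha> (c *\<^sub>C a) = c *\<^sub>C \<alpha> a" "\<alpha> (a * b) = \<alpha> a * \<alpha> b"
    "\<alpha> (star a) = star (\<alpha> a)" "\<alpha> (- a) = - \<alpha> a"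
proof -
  show "bij \<alpha>" "\<alpha> (a + b) = \<alpha> a + \<alpha> b" "\<alpha> (a * b) = \<alpha> a * \<alpha> b" "\<alpha> (star a) = star (\<alpha> a)"
    using assms by (simp_all add: star_automorphism_def)
  show scale: "\<alpha> (c *\<^sub>C a) = c *\<^sub>C \<alpha> a" for c a using assms by (simp add: star_automorphism_def)
  show "\<alpha> (- a) = - \<alpha> a" using scale[of "-1" a] by (simp add: scaleC_minus_one)
qed

lemma star_automorphism_id: "star_automorphism id"
  by (simp add: star_automorphism_def)

lemma star_automorphism_comp: "star_automorphism \<beta> \<Longrightarrow> star_automorphism \<alpha> \<Longrightarrow> star_automorphism (\<beta> \<circ> \<alpha>)"
  by (simp add: star_automorphism_def bij_comp)

lemma compose_eqD: "compose A f g = compose A f' g' \<Longrightarrow> x \<in> A \<Longrightarrow> f (g x) = f' (g' x)"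
  by (metis compose_eq)

locale ksgns_morphism =
  P1: ksgns_poscor E1 \<phi>1 + P2: ksgns_poscor E2 \<phi>2
  for E1 E2 :: "('b::cstar_algebra, ('a::cstar_algebra, 'k) univ) rmod" and \<phi>1 \<phi>2 +
  fixes \<eta> \<alpha>
  assumes \<eta>: "\<eta> \<in> adjointable E1 E2" and \<alpha>: "star_automorphism \<alpha>"
    and intertwines: "x \<in> mcar E1 \<Longrightarrow> \<phi>2 (\<alpha> a) (\<eta> x) = \<eta> (\<phi>1 a x)"
begin

sublocale h: adjointable_map E1 E2 \<eta>
  by unfold_locales (rule \<eta>)

lemmas \<alpha>_simps = star_automorphismD(2-6)[OF \<alpha>]

text \<open>The adjoint of the intertwining relation, found by moving \<phi> across the inner
  products of both modules. \<open>\<phi>_mip_left\<close> does this for products, hence the form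
  \<open>star a * b\<close>.\<close>

lemma S_intertwines:
  assumes w: "w \<in> mcar E2"
  shows "h.S (\<phi>2 (star (\<alpha> a) * \<alpha> b) w) = \<phi>1 (star a * b) (h.S w)"
proof (rule P1.mip_eqI)
  fix x assume x: "x \<in> mcar E1"
  have "mip E1 x (h.S (\<phi>2 (star (\<alpha> a) * \<alpha> b) w)) = mip E2 (\<eta> x) (\<phi>2 (star (\<alpha> a) * \<alpha> b) w)"
    using x w by (simp add: h.mip_T)
  also have "\<dots> = mip E2 (\<phi>2 (\<alpha> (star b * a)) (\<eta> x)) w"
    using x w by (simp add: P2.\<phi>_mip_left \<alpha>_simps)
  also have "\<dots> = mip E1 (\<phi>1 (star b * a) x) (h.S w)"
    using x w by (simp add: intertwines h.mip_T)
  also have "\<dots> = mip E1 x (\<phi>1 (star a * b) (h.S w))"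
    using x w by (simp add: P1.\<phi>_mip_left)
  finally show "mip E1 x (h.S (\<phi>2 (star (\<alpha> a) * \<alpha> b) w)) = mip E1 x (\<phi>1 (star a * b) (h.S w))" .
qed (use w in simp_all)

definition H :: "('a, 'k) univ \<Rightarrow> ('a, 'k) univ" where
  "H x = h.S (\<eta> x)"

lemma H_in [simp]: "x \<in> mcar E1 \<Longrightarrow> H x \<in> mcar E1"
  by (simp add: H_def)

lemma H_funpow_in [simp]: "x \<in> mcar E1 \<Longrightarrow> (H ^^ n) x \<in> mcar E1"
  by (induction n) simp_all

lemma H_selfadjoint: "x \<in> mcar E1 \<Longrightarrow> y \<in> mcar E1 \<Longrightarrow> mip E1 (H x) y = mip E1 x (H y)"
  by (simp add: H_def h.mip_S flip: h.mip_T)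

text \<open>The relations for \<eta> and for its adjoint combine, and \<alpha> drops out.
  Consequently \<open>H\<close> acting on the second tensor factor is symmetric for the tensor inner
  product.\<close>

lemma H_commutes: "x \<in> mcar E1 \<Longrightarrow> H (\<phi>1 (star a * b) x) = \<phi>1 (star a * b) (H x)"
  using S_intertwines[of "\<eta> x" a b] by (simp add: H_def \<alpha>_simps flip: intertwines)

lemma mip_H_funpow:
  assumes "x \<in> mcar E1"
  shows "y \<in> mcar E1 \<Longrightarrow> mip E1 ((H ^^ m) x) (\<phi>1 (star a * b) y) = mip E1 x (\<phi>1 (star a * b) ((H ^^ m) y))"
proof (induction m arbitrary: y)
  case (Suc m)
  have "mip E1 ((H ^^ Suc m) x) (\<phi>1 (star a * b) y) = mip E1 ((H ^^ m) x) (\<phi>1 (star a * b) (H y))"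
    using Suc.prems assms by (simp add: H_selfadjoint H_commutes)
  also have "\<dots> = mip E1 x (\<phi>1 (star a * b) ((H ^^ m) (H y)))"
    using Suc.prems by (intro Suc.IH) simp
  also have "(H ^^ m) (H y) = (H ^^ Suc m) y" by (simp only: funpow_Suc_right comp_apply)
  finally show ?case .
qed simp

lemma H_bounded: "\<exists>R\<ge>0. \<forall>x\<in>mcar E1. mnorm E1 (H x) \<le> R * mnorm E1 x"
proof -
  interpret HH: adjointable_map E1 E1 "compose (mcar E1) h.S \<eta>"
    by unfold_locales (rule adjointable_compose[OF h.S_adjointable \<eta>])
  show ?thesis using HH.bounded by (auto simp: compose_def H_def)
qed

lemma H_funpow_bounded:
  assumes "0 \<le> R" "\<And>x. x \<in> mcar E1 \<Longrightarrow> mnorm E1 (H x) \<le> R * mnorm E1 x"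
  shows "x \<in> mcar E1 \<Longrightarrow> mnorm E1 ((H ^^ n) x) \<le> R ^ n * mnorm E1 x"
proof (induction n)
  case (Suc n)
  then have "mnorm E1 (H ((H ^^ n) x)) \<le> R * mnorm E1 ((H ^^ n) x)" by (intro assms) simp
  also have "\<dots> \<le> R * (R ^ n * mnorm E1 x)" using Suc assms(1) by (intro mult_left_mono) simp_all
  finally show ?case by (simp add: mult.assoc)
qed simp

definition g :: "'a \<times> ('a, 'k) univ \<Rightarrow> ('a, 'k) univ" where
  "g p = P2.\<tau> (\<alpha> (fst p)) (\<eta> (snd p))"

lemma g_in [simp]: "snd p \<in> mcar E1 \<Longrightarrow> g p \<in> mcar P2.F"
  by (simp add: g_def)

text \<open>The scheme of \<open>rep_bound_sum\<close> with the iteration in the second factor: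
  \<open>t n p\<close> is a \<otimes> H^n x. Pairing the zeroth with the first iterate gives the
  inner products of the images \<open>g\<close>, so a bound \<open>R\<close> for \<open>H\<close>
  yields the constant \<open>sqrt R\<close>.\<close>

lemma mor_bound_sum:
  "\<exists>C\<ge>0. \<forall>ps. set ps \<subseteq> P1.gens \<longrightarrow>
    mnorm P2.F (lsum P2.F g ps) \<le> C * mnorm P1.F (lsum P1.F P1.\<tau>\<^sub>p ps)"
proof -
  obtain R where R: "0 \<le> R" "\<And>x. x \<in> mcar E1 \<Longrightarrow> mnorm E1 (H x) \<le> R * mnorm E1 x"
    using H_bounded by blast
  have "mnorm P2.F (lsum P2.F g ps) \<le> sqrt R * mnorm P1.F (lsum P1.F P1.\<tau>\<^sub>p ps)"
    if ps: "set ps \<subseteq> P1.gens" for ps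
  proof (rule power2_le_imp_le)
    define t where "t = (\<lambda>n p. P1.\<tau> (fst p) ((H ^^ n) (snd p)))"
    have snd: "snd p \<in> mcar E1" if "p \<in> set ps" for p using that ps by auto
    have "norm (mip P1.F (lsum P1.F (t 0) ps) (lsum P1.F (t 1) ps)) \<le> R * norm (mip P1.F (lsum P1.F (t 0) ps) (lsum P1.F (t 0) ps))"
    proof (rule P1.F.norm_mip_lsum_iterate_le)
      show "t n p \<in> mcar P1.F" if "p \<in> set ps" for n p using snd[OF that] by (simp add: t_def)
      show "mip P1.F (t m p) (t n q) = mip P1.F (t 0 p) (t (m + n) q)" if "p \<in> set ps" "q \<in> set ps" for m n p q
        using that snd by (simp add: t_def P1.\<tau>_mip mip_H_funpow funpow_add)
      show "\<exists>K. \<forall>n. mnorm P1.F (t n p) \<le> K * R ^ n" if p: "p \<in> set ps" for p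
      proof -
        \<comment> \<open>The second factor varies here, so \<open>\<tau>_bounded\<close> is of no
          help. The square of the norm of a \<otimes> y is that of \<langle>y, \<phi>1(star a * a)
          y\<rangle>, and the single adjointable operator in it is bounded.\<close>
        interpret a: adjointable_map E1 E1 "\<phi>1 (star (fst p) * fst p)" by (rule P1.adjointable_map_\<phi>)
        obtain L where L: "0 \<le> L" "\<And>x. x \<in> mcar E1 \<Longrightarrow> mnorm E1 (\<phi>1 (star (fst p) * fst p) x) \<le> L * mnorm E1 x"
          using a.bounded by blast
        have "mnorm P1.F (t n p) \<le> (sqrt L * mnorm E1 (snd p)) * R ^ n" for n
        proof -
          define y where "y = (H ^^ n) (snd p)"
          have y: "y \<in> mcar E1" using snd[OF p] by (simp add: y_def)
          have "mnorm P1.F (t n p) \<le> sqrt L * mnorm E1 y"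
          proof (rule power2_le_imp_le)
            have "(mnorm P1.F (t n p))\<^sup>2 = norm (mip E1 y (\<phi>1 (star (fst p) * fst p) y))"
              using y by (simp add: t_def P1.\<tau>_mnorm flip: y_def)
            also have "\<dots> \<le> mnorm E1 y * mnorm E1 (\<phi>1 (star (fst p) * fst p) y)"
              by (intro P1.norm_mip_le y P1.\<phi>_in)
            also have "\<dots> \<le> mnorm E1 y * (L * mnorm E1 y)" by (intro mult_left_mono L y) simp
            finally show "(mnorm P1.F (t n p))\<^sup>2 \<le> (sqrt L * mnorm E1 y)\<^sup>2"
              using L(1) by (simp add: power_mult_distrib power2_eq_square[of "mnorm E1 y"] ac_simps)
          qed (use L(1) in simp)
          also have "\<dots> \<le> sqrt L * (R ^ n * mnorm E1 (snd p))"
            unfolding y_def by (intro mult_left_mono H_funpow_bounded R snd p) (use L(1) in simp_all)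
          finally show ?thesis by (simp add: ac_simps)
        qed
        then show ?thesis by blast
      qed
    qed (rule R(1))
    moreover have "lsum P1.F (t 0) ps = lsum P1.F P1.\<tau>\<^sub>p ps" by (simp add: t_def)
    moreover have "mip P1.F (lsum P1.F (t 0) ps) (lsum P1.F (t 1) ps)
        = mip P2.F (lsum P2.F g ps) (lsum P2.F g ps)"
    proof -
      have eq: "mip P1.F (t 0 p) (t 1 q) = mip P2.F (g p) (g q)"
        if "p \<in> set ps" "q \<in> set ps" for p q
      proof -
        have "mip P2.F (g p) (g q)
            = mip E1 (snd p) (h.S (\<phi>2 (star (\<alpha> (fst p)) * \<alpha> (fst q)) (\<eta> (snd q))))"
          using snd that by (simp add: g_def P2.\<tau>_mip h.mip_T)
        also have "\<dots> = mip P1.F (t 0 p) (t 1 q)"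
          using snd that by (simp add: S_intertwines t_def P1.\<tau>_mip H_def)
        finally show ?thesis by simp
      qed
      have "mip P1.F (lsum P1.F (t 0) ps) (lsum P1.F (t 1) ps) = (\<Sum>p\<leftarrow>ps. \<Sum>q\<leftarrow>ps. mip P1.F (t 0 p) (t 1 q))"
        using snd by (intro P1.F.mip_lsum_lsum) (simp_all add: t_def)
      also have "\<dots> = (\<Sum>p\<leftarrow>ps. \<Sum>q\<leftarrow>ps. mip P2.F (g p) (g q))"
        by (intro arg_cong[of _ _ sum_list] map_cong HOL.refl eq)
      also have "\<dots> = mip P2.F (lsum P2.F g ps) (lsum P2.F g ps)"
        using snd by (intro P2.F.mip_lsum_lsum[symmetric]) simp_all
      finally show ?thesis .
    qed
    ultimately show "(mnorm P2.F (lsum P2.F g ps))\<^sup>2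
        \<le> (sqrt R * mnorm P1.F (lsum P1.F P1.\<tau>\<^sub>p ps))\<^sup>2"
      using R(1) by (simp add: P1.F.mnorm_power2 P2.F.mnorm_power2 power_mult_distrib)
  qed (use R(1) in simp)
  then show ?thesis using R(1) by (intro exI[of _ "sqrt R"]) simp
qed

text \<open>On generators the adjoint is b \<otimes> y \<mapsto> \<open>inv \<alpha> b\<close>
  \<otimes> \<open>h.S y\<close>; surjectivity of \<alpha> makes it fit.\<close>

lemma mor_ex:
  "\<exists>T. T \<in> adjointable P1.F P2.F \<and> (\<forall>a. \<forall>x\<in>mcar E1. T (P1.\<tau> a x) = P2.\<tau> (\<alpha> a) (\<eta> x))"
proof -
  obtain C where C: "0 \<le> C" "\<And>ps. set ps \<subseteq> P1.gens \<Longrightarrow>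
    mnorm P2.F (lsum P2.F g ps) \<le> C * mnorm P1.F (lsum P1.F P1.\<tau>\<^sub>p ps)"
    using mor_bound_sum by blast
  have inv: "\<alpha> (inv \<alpha> b) = b" for b
    using star_automorphismD(1)[OF \<alpha>] by (simp add: bij_is_surj surj_f_inv_f)
  obtain T where T: "T \<in> adjointable P1.F P2.F" "\<And>p. p \<in> P1.gens \<Longrightarrow> T (P1.\<tau>\<^sub>p p) = g p"
    "\<And>z. z \<in> mcar P1.F \<Longrightarrow> mnorm P2.F (T z) \<le> C * mnorm P1.F z"
  proof (rule extend_adjointable[OF P1.ksgns_hilbert P2.ksgns_hilbert P1.\<tau>_total P2.\<tau>_total,
        where g = g and h = "\<lambda>p. P1.\<tau> (inv \<alpha> (fst p)) (h.S (snd p))" and C = C])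
    show "mip P2.F (g p) (P2.\<tau>\<^sub>p q) = mip P1.F (P1.\<tau>\<^sub>p p) (P1.\<tau> (inv \<alpha> (fst q)) (h.S (snd q)))"
      if "p \<in> P1.gens" "q \<in> P2.gens" for p q
    proof -
      have "mip P2.F (g p) (P2.\<tau>\<^sub>p q)
          = mip E1 (snd p) (h.S (\<phi>2 (star (\<alpha> (fst p)) * \<alpha> (inv \<alpha> (fst q))) (snd q)))"
        using that by (auto simp: g_def P2.\<tau>_mip h.mip_T inv)
      also have "\<dots> = mip P1.F (P1.\<tau>\<^sub>p p) (P1.\<tau> (inv \<alpha> (fst q)) (h.S (snd q)))"
        using that by (auto simp: S_intertwines P1.\<tau>_mip)
      finally show ?thesis .
    qed
    show "\<exists>q\<in>P1.gens. P1.\<tau>\<^sub>p q = mscale P1.F (-1) (P1.\<tau>\<^sub>p p) \<and>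
        g q = mscale P2.F (-1) (g p)"
      if "p \<in> P1.gens" for p
      using that P1.\<tau>_neg[of p] P2.\<tau>_neg[of "(\<alpha> (fst p), \<eta> (snd p))"]
      by (intro bexI[of _ "(- fst p, snd p)"]) (auto simp: g_def \<alpha>_simps)
  qed (use C in auto)
  then show ?thesis by (intro exI[of _ T]) (auto simp: g_def)
qed

lemma mor_unique:
  assumes "T \<in> adjointable P1.F P2.F" "\<And>a x. x \<in> mcar E1 \<Longrightarrow> T (P1.\<tau> a x) = P2.\<tau> (\<alpha> a) (\<eta> x)"
    "T' \<in> adjointable P1.F P2.F" "\<And>a x. x \<in> mcar E1 \<Longrightarrow> T' (P1.\<tau> a x) = P2.\<tau> (\<alpha> a) (\<eta> x)"
  shows "T = T'"
  by (rule adjointable_total_eqI[OF P1.\<tau>_total P1.ksgns_hilbert P2.ksgns_hilbert assms(1,3)])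
    (auto simp: assms(2,4))

lemma ksgns_mor_eqI:
  assumes "T \<in> adjointable P1.F P2.F" "\<And>a x. x \<in> mcar E1 \<Longrightarrow> T (P1.\<tau> a x) = P2.\<tau> (\<alpha> a) (\<eta> x)"
  shows "ksgns_mor P1.X P2.X (\<eta>, \<alpha>) = (T, \<alpha>)"
  unfolding ksgns_mor_def fst_conv prod.case prod.inject
  by (rule conjI[OF the_equality HOL.refl]) (use assms mor_unique in auto)

definition mor :: "('a, 'k) univ \<Rightarrow> ('a, 'k) univ" where
  "mor = fst (ksgns_mor P1.X P2.X (\<eta>, \<alpha>))"

lemma mor_adjointable: "mor \<in> adjointable P1.F P2.F"
  and mor_\<tau>: "x \<in> mcar E1 \<Longrightarrow> mor (P1.\<tau> a x) = P2.\<tau> (\<alpha> a) (\<eta> x)"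
  and ksgns_mor_eq: "ksgns_mor P1.X P2.X (\<eta>, \<alpha>) = (mor, \<alpha>)"
proof -
  obtain T where T: "T \<in> adjointable P1.F P2.F" "\<forall>a. \<forall>x\<in>mcar E1. T (P1.\<tau> a x) = P2.\<tau> (\<alpha> a) (\<eta> x)"
    using mor_ex by blast
  have eq: "ksgns_mor P1.X P2.X (\<eta>, \<alpha>) = (T, \<alpha>)"
    by (rule ksgns_mor_eqI) (simp_all add: T)
  then have "mor = T" by (simp add: mor_def)
  with T eq show "mor \<in> adjointable P1.F P2.F" "x \<in> mcar E1 \<Longrightarrow> mor (P1.\<tau> a x) = P2.\<tau> (\<alpha> a) (\<eta> x)"
    "ksgns_mor P1.X P2.X (\<eta>, \<alpha>) = (mor, \<alpha>)"
    by simp_all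
qed

lemma mor_rep:
  assumes "z \<in> mcar P1.F"
  shows "P2.\<pi> (\<alpha> a) (mor z) = mor (P1.\<pi> a z)"
proof -
  have "compose (mcar P1.F) (P2.\<pi> (\<alpha> a)) mor = compose (mcar P1.F) mor (P1.\<pi> a)"
    by (rule adjointable_total_eqI[OF P1.\<tau>_total P1.ksgns_hilbert P2.ksgns_hilbert
          adjointable_compose[OF P2.rep_adjointable mor_adjointable]
          adjointable_compose[OF mor_adjointable P1.rep_adjointable]])
      (auto simp: compose_def mor_\<tau> P2.rep_\<tau> P1.rep_\<tau> \<alpha>_simps)
  then show ?thesis using assms by (rule compose_eqD)
qed

end

section \<open>The functor and the natural isomorphism\<close>

lemma PosCor_Obj: "(E, \<phi>) \<in> Obj PosCor \<longleftrightarrow> poscor E \<phi>"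
  by (simp add: PosCor_def poscor_def poscor_axioms_def)

lemma PosCor_Hom: "(\<eta>, \<alpha>) \<in> Hom PosCor (E1, \<phi>1) (E2, \<phi>2) \<longleftrightarrow>
    \<eta> \<in> adjointable E1 E2 \<and> star_automorphism \<alpha> \<and> (\<forall>a. \<forall>x\<in>mcar E1. \<phi>2 (\<alpha> a) (\<eta> x) = \<eta> (\<phi>1 a x))"
  by (simp add: PosCor_def)

lemma PosCor_Ident: "Ident PosCor (E, \<phi>) = (restrict id (mcar E), id)"
  by (simp add: PosCor_def)

lemma PosCor_Comp: "Comp PosCor (E1, \<phi>1) (E2, \<phi>2) (E3, \<phi>3) (\<xi>, \<beta>) (\<eta>, \<alpha>) = (compose (mcar E1) \<xi> \<eta>, \<beta> \<circ> \<alpha>)"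
  by (simp add: PosCor_def)

text \<open>For the unit laws: \<open>compose\<close> produces \<open>undefined\<close> off the
  carrier, and the map it is compared with has to do the same.\<close>

lemma adjointable_undefined: "T \<in> adjointable E F \<Longrightarrow> x \<notin> mcar E \<Longrightarrow> undefined = T x"
  by (auto simp: adjointable_def dest: PiE_arb)

lemma is_category_PosCor: "is_category PosCor"
proof (unfold_locales, goal_cases)
  case (1 X)
  then show ?case
    by (cases X) (auto simp: PosCor_Obj PosCor_Ident PosCor_Hom adjointable_restrict_id star_automorphism_id
        poscor.\<phi>_in)
next
  case (2 X Y Z f g)
  then show ?case
    by (cases X; cases Y; cases Z; cases f; cases g)
      (auto simp: PosCor_Hom PosCor_Comp PosCor_Obj adjointable_compose star_automorphism_comp
        compose_eq adjointable_in poscor.\<phi>_in)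
next
  case (3 X Y f)
  then show ?case
    by (cases X; cases Y; cases f)
      (auto simp: PosCor_Hom PosCor_Comp PosCor_Ident compose_def fun_eq_iff restrict_def
        intro: adjointable_in adjointable_undefined)
next
  case (4 X Y f)
  then show ?case
    by (cases X; cases Y; cases f)
      (auto simp: PosCor_Hom PosCor_Comp PosCor_Ident compose_def fun_eq_iff restrict_def
        intro: adjointable_undefined)
next
  case (5 W X Y Z f g h)
  then show ?case
    by (cases W; cases X; cases Y; cases Z; cases f; cases g; cases h)
      (auto simp: PosCor_Hom PosCor_Comp compose_def fun_eq_iff restrict_def adjointable_in)
qed

section \<open>The endofunctor\<close>

lemma KSGNS_sel: "fobj KSGNS X = (ksgns_module X, ksgns_rep X)" "fmap KSGNS X Y f = ksgns_mor X Y f"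
  by (simp_all add: KSGNS_def)

lemma ksgns_poscorI: "(E, \<phi>) \<in> Obj PosCor \<Longrightarrow> ksgns_poscor E \<phi>"
  by (simp add: PosCor_Obj ksgns_poscor_def)

lemma ksgns_morphismI:
  "(E1, \<phi>1) \<in> Obj PosCor \<Longrightarrow> (E2, \<phi>2) \<in> Obj PosCor \<Longrightarrow> (\<eta>, \<alpha>) \<in> Hom PosCor (E1, \<phi>1) (E2, \<phi>2)
    \<Longrightarrow> ksgns_morphism E1 E2 \<phi>1 \<phi>2 \<eta> \<alpha>"
  by (auto simp: ksgns_morphism_def ksgns_morphism_axioms_def PosCor_Hom dest: ksgns_poscorI)

lemma KSGNS_obj: "X \<in> Obj PosCor \<Longrightarrow> fobj KSGNS X \<in> Obj PosCor"
  using ksgns_poscor.ksgns_poscor_rep[of "fst X" "snd X"] ksgns_poscorI[of "fst X" "snd X"]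
  by (simp add: KSGNS_sel PosCor_Obj ksgns_poscor_def)

lemma KSGNS_hom:
  assumes "X \<in> Obj PosCor" "Y \<in> Obj PosCor" "f \<in> Hom PosCor X Y"
  shows "fmap KSGNS X Y f \<in> Hom PosCor (fobj KSGNS X) (fobj KSGNS Y)"
proof -
  obtain E1 \<phi>1 E2 \<phi>2 \<eta> \<alpha> where eq: "X = (E1, \<phi>1)" "Y = (E2, \<phi>2)" "f = (\<eta>, \<alpha>)"
    by (metis surj_pair)
  interpret ksgns_morphism E1 E2 \<phi>1 \<phi>2 \<eta> \<alpha> using assms by (intro ksgns_morphismI) (simp_all add: eq)
  show ?thesis
    by (simp add: eq KSGNS_sel ksgns_mor_eq PosCor_Hom mor_adjointable \<alpha> mor_rep)
qed

text \<open>Both functor laws are instances of \<open>ksgns_mor_eqI\<close>: the identity and the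
  composite take the prescribed values on elementary tensors.\<close>

lemma is_functor_KSGNS:
  "is_functor (PosCor :: (('a::cstar_algebra, 'b::cstar_algebra, ('a, 'k) univ) poscor, _) cat) PosCor KSGNS"
proof (intro is_functor.intro is_functor_axioms.intro is_category_PosCor KSGNS_obj KSGNS_hom; assumption?)
  fix X :: "('a, 'b, ('a, 'k) univ) poscor" assume X: "X \<in> Obj PosCor"
  obtain E \<phi> where eq: "X = (E, \<phi>)" by (cases X)
  interpret ksgns_poscor E \<phi> using X by (intro ksgns_poscorI) (simp add: eq)
  interpret ksgns_morphism E E \<phi> \<phi> "restrict id (mcar E)" id
    by unfold_locales (auto simp: adjointable_restrict_id star_automorphism_id)
  show "fmap KSGNS X X (Ident PosCor X) = Ident PosCor (fobj KSGNS X)"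
    using ksgns_mor_eqI[of "restrict id (mcar F)"]
    by (simp add: eq KSGNS_sel PosCor_Ident adjointable_restrict_id)
next
  fix X Y Z :: "('a, 'b, ('a, 'k) univ) poscor" and f g
  assume *: "X \<in> Obj PosCor" "Y \<in> Obj PosCor" "Z \<in> Obj PosCor" "f \<in> Hom PosCor X Y" "g \<in> Hom PosCor Y Z"
  obtain E1 \<phi>1 E2 \<phi>2 E3 \<phi>3 \<eta> \<alpha> \<xi> \<beta> where
    eq: "X = (E1, \<phi>1)" "Y = (E2, \<phi>2)" "Z = (E3, \<phi>3)" "f = (\<eta>, \<alpha>)" "g = (\<xi>, \<beta>)"
    by (metis surj_pair)
  interpret f: ksgns_morphism E1 E2 \<phi>1 \<phi>2 \<eta> \<alpha> using * by (intro ksgns_morphismI) (simp_all add: eq)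
  interpret g: ksgns_morphism E2 E3 \<phi>2 \<phi>3 \<xi> \<beta> using * by (intro ksgns_morphismI) (simp_all add: eq)
  have "Comp PosCor X Y Z g f \<in> Hom PosCor X Z"
    using is_category.Comp_in_Hom[OF is_category_PosCor] * by blast
  then interpret gf: ksgns_morphism E1 E3 \<phi>1 \<phi>3 "compose (mcar E1) \<xi> \<eta>" "\<beta> \<circ> \<alpha>"
    using * by (intro ksgns_morphismI) (simp_all add: eq PosCor_Comp)
  have "ksgns_mor (E1, \<phi>1) (E3, \<phi>3) (compose (mcar E1) \<xi> \<eta>, \<beta> \<circ> \<alpha>)
      = (compose (mcar f.P1.F) g.mor f.mor, \<beta> \<circ> \<alpha>)"
    by (rule gf.ksgns_mor_eqI)
      (simp_all add: adjointable_compose[OF g.mor_adjointable f.mor_adjointable] compose_eq f.mor_\<tau> g.mor_\<tau>)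
  then show "fmap KSGNS X Z (Comp PosCor X Y Z g f)
      = Comp PosCor (fobj KSGNS X) (fobj KSGNS Y) (fobj KSGNS Z) (fmap KSGNS Y Z g) (fmap KSGNS X Y f)"
    by (simp add: eq KSGNS_sel PosCor_Comp f.ksgns_mor_eq g.ksgns_mor_eq)
qed

lemma is_functor_comp:
  assumes "is_functor C D F" "is_functor D D' G"
  shows "is_functor C D' (G \<circ>\<^bsub>F\<^esub> F)"
proof -
  interpret F: is_functor C D F by fact
  interpret G: is_functor D D' G by fact
  show ?thesis
    by unfold_locales
      (simp_all add: comp_funct_def F.fobj_in_Obj F.fmap_in_Hom F.fmap_Ident F.fmap_Comp
        G.fobj_in_Obj G.fmap_in_Hom G.fmap_Ident G.fmap_Comp)
qed

section \<open>The multiplication isomorphism\<close>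

context ksgns_poscor
begin

text \<open>The component of the natural transformation at (E, \<phi>). Fixing it by its values on
  generators makes naturality a computation on generators.\<close>

definition mult_iso :: "('a, 'k) univ \<Rightarrow> ('a, 'k) univ" where
  "mult_iso = (THE U. U \<in> adjointable (ksgns_module (F, \<pi>)) F \<and>
     (\<forall>a. \<forall>z\<in>mcar F. U (elementary_tensor (F, \<pi>) a z) = \<pi> a z))"

text \<open>\<open>a \<otimes> z \<mapsto> \<pi>(a) z\<close> preserves the inner product and has dense range.\<close>

lemma mult_iso:
  "mult_iso \<in> adjointable (ksgns_module (F, \<pi>)) F"
  "z \<in> mcar F \<Longrightarrow> mult_iso (elementary_tensor (F, \<pi>) a z) = \<pi> a z"
  "is_iso PosCor (ksgns_module (F, \<pi>), ksgns_rep (F, \<pi>)) (F, \<pi>) (mult_iso, id)"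
proof -
  interpret K: ksgns_poscor F \<pi> by (rule ksgns_poscor_rep)
  let ?s = "\<lambda>p. \<pi> (fst p) (snd p)"
  have ip: "mip F (?s p) (?s q) = mip K.F (K.\<tau>\<^sub>p p) (K.\<tau>\<^sub>p q)" if "p \<in> K.gens" "q \<in> K.gens" for p q
    using that by (auto simp: K.\<tau>_mip rep_left rep_mult)
  have norm_eq: "mnorm F (lsum F ?s ps) = mnorm K.F (lsum K.F K.\<tau>\<^sub>p ps)" if ps: "set ps \<subseteq> K.gens" for ps
  proof -
    have in_car: "p \<in> K.gens" "snd p \<in> mcar F" if "p \<in> set ps" for p using that ps by auto
    have "mip F (lsum F ?s ps) (lsum F ?s ps) = (\<Sum>p\<leftarrow>ps. \<Sum>q\<leftarrow>ps. mip F (?s p) (?s q))"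
      using in_car by (intro F.mip_lsum_lsum) simp_all
    also have "\<dots> = (\<Sum>p\<leftarrow>ps. \<Sum>q\<leftarrow>ps. mip K.F (K.\<tau>\<^sub>p p) (K.\<tau>\<^sub>p q))"
      by (intro arg_cong[of _ _ sum_list] map_cong HOL.refl ip in_car)
    also have "\<dots> = mip K.F (lsum K.F K.\<tau>\<^sub>p ps) (lsum K.F K.\<tau>\<^sub>p ps)"
      using in_car by (intro K.F.mip_lsum_lsum[symmetric]) simp_all
    finally show ?thesis by (simp add: mnorm_def)
  qed
  have neg: "\<exists>q\<in>K.gens. K.\<tau>\<^sub>p q = mscale K.F (-1) (K.\<tau>\<^sub>p p) \<and> ?s q = mscale F (-1) (?s p)" if "p \<in> K.gens" for p
    using that K.\<tau>_neg[of p] by (intro bexI[of _ "(- fst p, snd p)"]) (auto simp: rep_neg)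
  obtain U where U: "U \<in> adjointable K.F F" "\<And>p. p \<in> K.gens \<Longrightarrow> U (K.\<tau>\<^sub>p p) = ?s p"
    "\<And>z. z \<in> mcar K.F \<Longrightarrow> mnorm F (U z) \<le> 1 * mnorm K.F z"
  proof (rule extend_adjointable[OF K.ksgns_hilbert ksgns_hilbert K.\<tau>_total rep_total,
        where g = ?s and h = K.\<tau>\<^sub>p and C = 1])
    show "mip F (?s p) (?s q) = mip K.F (K.\<tau>\<^sub>p p) (K.\<tau>\<^sub>p q)" if "p \<in> K.gens" "q \<in> K.gens" for p q
      using that by (rule ip)
  qed (use norm_eq neg in auto)
  \<comment> \<open>The identity \<open>ip\<close> treats both families alike, so exchanging them
    gives the inverse from the same extension lemma. That \<open>V\<close> is defined on all of
    \<open>F\<close> rests on \<open>rep_total\<close>.\<close>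
  obtain V where V: "V \<in> adjointable F K.F" "\<And>p. p \<in> K.gens \<Longrightarrow> V (?s p) = K.\<tau>\<^sub>p p"
    "\<And>z. z \<in> mcar F \<Longrightarrow> mnorm K.F (V z) \<le> 1 * mnorm F z"
  proof (rule extend_adjointable[OF ksgns_hilbert K.ksgns_hilbert rep_total K.\<tau>_total,
        where g = K.\<tau>\<^sub>p and h = ?s and C = 1])
    show "mip K.F (K.\<tau>\<^sub>p p) (K.\<tau>\<^sub>p q) = mip F (?s p) (?s q)" if "p \<in> K.gens" "q \<in> K.gens" for p q
      using ip[OF that] by simp
    show "\<exists>q\<in>K.gens. ?s q = mscale F (-1) (?s p) \<and> K.\<tau>\<^sub>p q = mscale K.F (-1) (K.\<tau>\<^sub>p p)" if "p \<in> K.gens" for p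
      using neg[OF that] by blast
  qed (use norm_eq in auto)
  have U\<tau>: "U (K.\<tau> a z) = \<pi> a z" and V\<pi>: "V (\<pi> a z) = K.\<tau> a z" if "z \<in> mcar F" for a z
    using U(2)[of "(a, z)"] V(2)[of "(a, z)"] that by simp_all
  have "mult_iso = U"
    unfolding mult_iso_def
  proof (rule the_equality)
    show "U \<in> adjointable (ksgns_module (F, \<pi>)) F \<and> (\<forall>a. \<forall>z\<in>mcar F. U (elementary_tensor (F, \<pi>) a z) = \<pi> a z)"
      using U(1) U\<tau> by simp
    fix U' assume U': "U' \<in> adjointable (ksgns_module (F, \<pi>)) F \<and> (\<forall>a. \<forall>z\<in>mcar F. U' (elementary_tensor (F, \<pi>) a z) = \<pi> a z)"
    show "U' = U"
      by (rule adjointable_total_eqI[OF K.\<tau>_total K.ksgns_hilbert ksgns_hilbert]) (use U' U(1) U\<tau> in auto)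
  qed
  then show "mult_iso \<in> adjointable (ksgns_module (F, \<pi>)) F"
    "z \<in> mcar F \<Longrightarrow> mult_iso (elementary_tensor (F, \<pi>) a z) = \<pi> a z"
    using U(1) U\<tau> by simp_all
  have VU: "compose (mcar K.F) V U = restrict id (mcar K.F)"
    by (rule adjointable_total_eqI[OF K.\<tau>_total K.ksgns_hilbert K.ksgns_hilbert
          adjointable_compose[OF V(1) U(1)] adjointable_restrict_id])
      (auto simp: compose_eq U\<tau> V\<pi>)
  have UV: "compose (mcar F) U V = restrict id (mcar F)"
    by (rule adjointable_total_eqI[OF rep_total ksgns_hilbert ksgns_hilbert
          adjointable_compose[OF U(1) V(1)] adjointable_restrict_id])
      (auto simp: compose_eq U\<tau> V\<pi>)
  have "compose (mcar K.F) (\<pi> a) U = compose (mcar K.F) U (K.\<pi> a)" for a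
    by (rule adjointable_total_eqI[OF K.\<tau>_total K.ksgns_hilbert ksgns_hilbert
          adjointable_compose[OF rep_adjointable U(1)] adjointable_compose[OF U(1) K.rep_adjointable]])
      (auto simp: compose_eq U\<tau> K.rep_\<tau> rep_mult)
  then have U_int: "\<pi> a (U z) = U (K.\<pi> a z)" if "z \<in> mcar K.F" for a z
    using that by (rule compose_eqD)
  have "compose (mcar F) (K.\<pi> a) V = compose (mcar F) V (\<pi> a)" for a
    by (rule adjointable_total_eqI[OF rep_total ksgns_hilbert K.ksgns_hilbert
          adjointable_compose[OF K.rep_adjointable V(1)] adjointable_compose[OF V(1) rep_adjointable]])
      (auto simp: compose_eq V\<pi> K.rep_\<tau> rep_mult)
  then have V_int: "K.\<pi> a (V z) = V (\<pi> a z)" if "z \<in> mcar F" for a z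
    using that by (rule compose_eqD)
  show "is_iso PosCor (ksgns_module (F, \<pi>), ksgns_rep (F, \<pi>)) (F, \<pi>) (mult_iso, id)"
    unfolding is_iso_def \<open>mult_iso = U\<close>
    by (intro conjI bexI[of _ "(V, id)"])
      (simp_all add: PosCor_Hom PosCor_Comp PosCor_Ident star_automorphism_id U(1) V(1) U_int V_int UV VU)
qed

end

theorem proposition4p5:
  shows "naturally_isomorphic
    (PosCor :: (('a::cstar_algebra, 'b::cstar_algebra, ('a, 'k) univ) poscor,
                ('a, ('a, 'k) univ) poscor_mor) cat)
    (PosCor :: (('a, 'b, ('a, 'k) univ) poscor, ('a, ('a, 'k) univ) poscor_mor) cat)
    (KSGNS \<circ>\<^bsub>F\<^esub> KSGNS) KSGNS"
  unfolding naturally_isomorphic_def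
proof (intro conjI exI[of _ "\<lambda>(E, \<phi>). (ksgns_poscor.mult_iso E \<phi>, id)"] ballI)
  let ?P = "PosCor :: (('a, 'b, ('a, 'k) univ) poscor, ('a, ('a, 'k) univ) poscor_mor) cat"
  show "is_functor ?P ?P (KSGNS \<circ>\<^bsub>F\<^esub> KSGNS)"
    by (rule is_functor_comp[OF is_functor_KSGNS is_functor_KSGNS])
  show "is_functor ?P ?P KSGNS" by (rule is_functor_KSGNS)
  show "is_iso ?P (fobj (KSGNS \<circ>\<^bsub>F\<^esub> KSGNS) X) (fobj KSGNS X) (case X of (E, \<phi>) \<Rightarrow> (ksgns_poscor.mult_iso E \<phi>, id))"
    if "X \<in> Obj ?P" for X
    using ksgns_poscor.mult_iso(3)[of "fst X" "snd X"] ksgns_poscorI[of "fst X" "snd X"] that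
    by (simp add: comp_funct_def KSGNS_sel case_prod_unfold)
  fix X Y f assume *: "X \<in> Obj ?P" "Y \<in> Obj ?P" "f \<in> Hom ?P X Y"
  obtain E1 \<phi>1 E2 \<phi>2 \<eta> \<alpha> where eq: "X = (E1, \<phi>1)" "Y = (E2, \<phi>2)" "f = (\<eta>, \<alpha>)"
    by (metis surj_pair)
  interpret f: ksgns_morphism E1 E2 \<phi>1 \<phi>2 \<eta> \<alpha> using * by (intro ksgns_morphismI) (simp_all add: eq)
  \<comment> \<open>\<open>f.mor\<close> is itself a morphism between KSGNS images, over the same
    \<alpha>. The square of the functor is thus handled by a second instance of the same
    locale.\<close>
  interpret g: ksgns_morphism f.P1.F f.P2.F f.P1.\<pi> f.P2.\<pi> f.mor \<alpha>
    by (intro ksgns_morphism.intro ksgns_morphism_axioms.intro f.P1.ksgns_poscor_rep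
        f.P2.ksgns_poscor_rep f.mor_adjointable f.\<alpha> f.mor_rep)
  \<comment> \<open>At a \<otimes> z the two sides are
    \<open>f.P2.\<pi> (\<alpha> a) (f.mor z)\<close> and \<open>f.mor (f.P1.\<pi> a z)\<close>,
    which \<open>f.mor_rep\<close> identifies.\<close>
  have "compose (mcar g.P1.F) f.P2.mult_iso g.mor = compose (mcar g.P1.F) f.mor f.P1.mult_iso"
    by (rule adjointable_total_eqI[OF g.P1.\<tau>_total g.P1.ksgns_hilbert f.P2.ksgns_hilbert
          adjointable_compose[OF f.P2.mult_iso(1) g.mor_adjointable]
          adjointable_compose[OF f.mor_adjointable f.P1.mult_iso(1)]])
      (auto simp: compose_eq g.mor_\<tau> f.P1.mult_iso(2) f.P2.mult_iso(2) f.mor_rep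
        adjointable_in[OF f.mor_adjointable])
  then show "Comp ?P (fobj (KSGNS \<circ>\<^bsub>F\<^esub> KSGNS) X) (fobj (KSGNS \<circ>\<^bsub>F\<^esub> KSGNS) Y) (fobj KSGNS Y)
        (case Y of (E, \<phi>) \<Rightarrow> (ksgns_poscor.mult_iso E \<phi>, id)) (fmap (KSGNS \<circ>\<^bsub>F\<^esub> KSGNS) X Y f)
      = Comp ?P (fobj (KSGNS \<circ>\<^bsub>F\<^esub> KSGNS) X) (fobj KSGNS X) (fobj KSGNS Y)
        (fmap KSGNS X Y f) (case X of (E, \<phi>) \<Rightarrow> (ksgns_poscor.mult_iso E \<phi>, id))"
    by (simp add: eq comp_funct_def KSGNS_sel PosCor_Comp f.ksgns_mor_eq g.ksgns_mor_eq)
qed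

end
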